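(* Stochastic non-convex case. Assume (A1)--(A5) of the context and $\mu<0$. Run AmIGO with $\alpha_k=L_g^{-1}$, $\beta_k=(2L_g)^{-1}$, $\gamma_k=L^{-1}$, $T,N$ as in the context (both $O(\kappa_g)$ up to logarithmic factors), and (integer) batch sizes $$|\mathcal D_{g_{xy}}|=\Theta\Big(\frac{\kappa_g^2}\epsilon\tilde\sigma_{g_{xy}}^2\Big),\ |\mathcal D_{g_{yy}}|=\Theta\Big(\frac{\kappa_g^3}\epsilon\tilde\sigma_{g_{yy}}^2(1\vee\epsilon\mu_g^2)\Big),\ |\mathcal D_f|=\Theta\Big(\frac{\kappa_g^2\tilde\sigma_f^2}\epsilon\Big),\ |\mathcal D_g|=\Theta\Big(\frac{\kappa_g^5\tilde\sigma_g^2}\epsilon\Big).$$ Then AmIGO achieves $\frac1k\sum_{i=1}^k\mathbb E\|\nabla\mathcal L(x_i)\|^2\le\epsilon$ with complexity $$\mathcal C(\epsilon)=O\Big(\frac{\kappa_g^5}{\epsilon^2}\big(\kappa_g^4\tilde\sigma_g^2+\kappa_g^2(1\vee\epsilon\mu_g^2)\tilde\sigma_{g_{yy}}^2+\tilde\sigma_{g_{xy}}^2+\tilde\sigma_f^2\big)\big(\mathbb E[\mathcal L(x_0)-\mathcal L^\star]+E_0^y+E_0^z\big)\Big).$$ Here $O$ and $\Theta$ treat $L_f,B,L_g,L_g',M_g$ and an upper bound on $\tilde\sigma_{g_{xy}}^2$ as fixed constants, the constants in $\Theta$ being suitably chosen, and $O$ suppresses factors logarithmic in $\kappa_g$.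
   Context: **Problem.** $\mathcal X=\mathbb R^{d_x}$, $\mathcal Y=\mathbb R^{d_y}$; $f,g:\mathcal X\times\mathcal Y\to\mathbb R$, $f$ differentiable, $g$ twice differentiable; $\partial_{xy}g(x,y)$ is the $d_x\times d_y$ matrix with entries $\partial^2g/\partial x_i\partial y_j$. $y^\star(x)=\arg\min_yg(x,y)$, $z^\star(x,y)=-\partial_{yy}g(x,y)^{-1}\partial_yf(x,y)$, $\mathcal L(x)=f(x,y^\star(x))$, $\mathcal L^\star=\inf\mathcal L$ (assumed finite). **Assumptions.** (A1) For every $x$, $y\mapsto g(x,y)$ is $L_g$-smooth and $\mu_g$-strongly convex ($\mu_g>0$); $\kappa_g=L_g/\mu_g$. (A2) $\nabla f$ is $L_f$-Lipschitz and $\|\partial_yf\|\le B$. (A3) $\partial_{xy}g,\partial_{yy}g$ are $M_g$-Lipschitz in $(x,y)$; $\|\partial_yg(x,y)-\partial_yg(x',y)\|\le L_g'\|x-x'\|$. (A4) $f=\mathbb E_\xi\hat f(\cdot,\xi)$, $g=\mathbb E_\xi\hat g(\cdot,\xi)$; for a batch $\mathcal D$ of i.i.d. copies of $\xi$, $\hat f(x,y,\mathcal D),\hat g(x,y,\mathcal D)$ are averages over $\mathcal D$; $\nabla\hat f,\partial_y\hat g$ are unbiased with $\mathbb E\|\nabla\hat f-\nabla f\|^2\le\tilde\sigma_f^2/|\mathcal D|$, $\mathbb E\|\partial_y\hat g-\partial_yg\|^2\le\tilde\sigma_g^2/|\mathcal D|$. (A5) $F_1=\partial_{xy}\hat g(x,y,\mathcal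 D)-\partial_{xy}g(x,y)$, $F_2=\partial_{yy}\hat g(x,y,\mathcal D)-\partial_{yy}g(x,y)$ have zero mean, $\|\mathbb E[F_1^\top F_1]\|_{op}\le\tilde\sigma_{g_{xy}}^2/|\mathcal D|$, $\|\mathbb E[F_2^\top F_2]\|_{op}\le\tilde\sigma_{g_{yy}}^2/|\mathcal D|$. Write $\sigma_{g_{xy}}^2=\tilde\sigma_{g_{xy}}^2/|\mathcal D_{g_{xy}}|$, $\sigma_{g_{yy}}^2=\tilde\sigma_{g_{yy}}^2/|\mathcal D_{g_{yy}}|$. **AmIGO.** Given $x_0,y_{-1},z_{-1}$, for $k\ge0$, with fresh independent batches of sizes $|\mathcal D_g|,|\mathcal D_f|,|\mathcal D_{g_{yy}}|,|\mathcal D_{g_{xy}}|$ at every step: (1) $y_k^0=y_{k-1}$, $y_k^t=y_k^{t-1}-\alpha_k\partial_y\hat g(x_k,y_k^{t-1},\mathcal D^g_{t,k})$, $t=1..T$, $y_k=y_k^T$; (2) $(u_k,v_k)=(\partial_x\hat f,\partial_y\hat f)(x_k,y_k,\mathcal D_f)$; (3) $z_k^0=z_{k-1}$, $z_k^n=z_k^{n-1}-\beta_k(\partial_{yy}\hat g(x_k,y_k,\mathcal D^{g_{yy}}_{n,k})z_k^{n-1}+v_k)$, $n=1..N$, $z_k=z_k^N$; (4) $\hat\psi_k=u_k+\partial_{xy}\hat g(x_k,y_k,\mathcal D_{g_{xy}})z_k$; (5) $x_{k+1}=x_k-\gamma_{k+1}\hat\psi_k$. $E_0^y=\mathbb E\|y_{-1}-y^\star(x_0)\|^2$,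 $E_0^z=\mathbb E\|z_{-1}-z^\star(x_0,y_0)\|^2$. **Complexity.** $\mathcal C(\epsilon)=k(T|\mathcal D_g|+N|\mathcal D_{g_{yy}}|+|\mathcal D_{g_{xy}}|+|\mathcal D_f|)$, the total number of queries to gradients of $f,g$ and Jacobian/Hessian-vector products, $k$ being the number of outer iterations used. **Constants.** $L_y=\mu_g^{-1}L_g'$, $L_z=\mu_g^{-2}M_gB+\mu_g^{-1}L_f$, $L_\psi=\max(L_f+M_g\mu_g^{-1}B+L_g'L_z,L_g')$, $L=(L_f+\mu_g^{-2}L_g'M_gB+\mu_g^{-1}(L_g'L_f+M_gB))(1+\mu_g^{-1}L_g')$. $\mathcal L$ is $L$-smooth, hence satisfies $\mathcal L(x)-\mathcal L(x')\le\nabla\mathcal L(x)^\top(x-x')-\frac\mu2\|x-x'\|^2$ for a $\mu$ with $|\mu|\le L$; the non-convex case refers to $\mu<0$ (no convexity of $\mathcal L$ is assumed). $\sigma_x^2=2\sigma_{g_{xy}}^2+2(L_g')^2\mu_g^{-2}\sigma_{g_{yy}}^2$. **Choice of $T,N$.** With $\eta_0=L$, $\gamma=L^{-1}$, $\alpha=L_g^{-1}$, $\beta=(2L_g)^{-1}$, $\zeta_0=2L$: $T=\lfloor\alpha^{-1}\mu_g^{-1}\max(C_1,C_2,C_3)\rfloor+1$, $N=\lfloor2\beta^{-1}\mu_g^{-1}(\max(C_1,C_2,C_3)+\max(C_1',C_2',C_3'))\rfloor+1$, where $C_1=1+2\log(6+24L_\psi^2\eta_0^{-1})$, $C_2=2\log(1+4L_y^2L^{-2}\max(\eta_0,8\zeta_0))$,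 $C_3=\max(0,-2\log(5L_\psi^2\eta_0^{-1}),-2\log\frac L{4L_y^2})$, $C_1'=1+2\log(4+12\eta_0^{-1}(2L_\psi^2+\sigma_x^2))$, $C_2'=2\log(1+2L_z^2L_y^{-2}(1+16L_y^2))$, $C_3'=\max(0,-2\log\frac{L_\psi^2}{4L_z^2\eta_0},-2\log(\gamma(\sigma_{g_{xy}}^2+(L_g')^2)))$.
   Formalization: The complexity bound is claimed only when κ_g³(E[L(x_0)-L*]+E_0^y+E_0^z)/ε and κ_g/ε times the bracketed noise sum are at least a constant; otherwise it fails, as at least one iteration is made (e.g. zero initial error). Batch sizes below one are rounded up to one. *)

theory Defs
  imports "HOL-Probability.Probability"
begin

definition grad :: "(real^'n \<Rightarrow> real) \<Rightarrow> real^'n \<Rightarrow> real^'n" where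
  "grad h x = (\<chi> i. frechet_derivative h (at x) (axis i 1))"

definition dx :: "(real^'x \<Rightarrow> real^'y \<Rightarrow> real) \<Rightarrow> real^'x \<Rightarrow> real^'y \<Rightarrow> real^'x" where
  "dx h x y = grad (\<lambda>x'. h x' y) x"

definition dy :: "(real^'x \<Rightarrow> real^'y \<Rightarrow> real) \<Rightarrow> real^'x \<Rightarrow> real^'y \<Rightarrow> real^'y" where
  "dy h x y = grad (h x) y"

definition nabla ::
    "(real^'x \<Rightarrow> real^'y \<Rightarrow> real) \<Rightarrow> real^'x \<Rightarrow> real^'y \<Rightarrow> (real^'x) \<times> (real^'y)" where
  "nabla h x y = (dx h x y, dy h x y)"

text \<open>Entry \<open>(i, j)\<close> of \<open>dxy h x y\<close> is the derivative in \<open>x\<^sub>i\<close> of the derivative in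
  \<open>y\<^sub>j\<close>; the matrix maps \<open>real^'y\<close> to \<open>real^'x\<close>.\<close>

definition dxy :: "(real^'x \<Rightarrow> real^'y \<Rightarrow> real) \<Rightarrow> real^'x \<Rightarrow> real^'y \<Rightarrow> real^'y^'x" where
  "dxy h x y = (\<chi> i j. frechet_derivative (\<lambda>x'. dy h x' y $ j) (at x) (axis i 1))"

definition dyy :: "(real^'x \<Rightarrow> real^'y \<Rightarrow> real) \<Rightarrow> real^'x \<Rightarrow> real^'y \<Rightarrow> real^'y^'y" where
  "dyy h x y = (\<chi> i j. frechet_derivative (\<lambda>y'. dy h x y' $ j) (at y) (axis i 1))"

definition twice_differentiable :: "(real^'x \<Rightarrow> real^'y \<Rightarrow> real) \<Rightarrow> bool" where
  "twice_differentiable h \<longleftrightarrow>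
     (\<forall>q. case_prod h differentiable (at q)) \<and> (\<forall>q. case_prod (nabla h) differentiable (at q))"

text \<open>The library norm on \<open>real^'n^'m\<close> is the Frobenius norm; matrices are measured here in the
  (smaller) operator norm.\<close>

definition op_norm :: "real^'n^'m \<Rightarrow> real" where
  "op_norm A = onorm ((*v) A)"

definition gram :: "real^'n^'m \<Rightarrow> real^'n^'n" where
  "gram A = transpose A ** A"

definition strongly_convex :: "real \<Rightarrow> ('a::real_normed_vector \<Rightarrow> real) \<Rightarrow> bool" where
  "strongly_convex m h \<longleftrightarrow>
     (\<forall>y y' t. 0 \<le> t \<longrightarrow> t \<le> 1 \<longrightarrow>
        h (t *\<^sub>R y + (1 - t) *\<^sub>R y')
          \<le> t * h y + (1 - t) * h y' - m / 2 * t * (1 - t) * (norm (y - y'))\<^sup>2)"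

definition ystar :: "(real^'x \<Rightarrow> real^'y \<Rightarrow> real) \<Rightarrow> real^'x \<Rightarrow> real^'y" where
  "ystar g x = arg_min (g x) (\<lambda>_. True)"

definition zstar ::
    "(real^'x \<Rightarrow> real^'y \<Rightarrow> real) \<Rightarrow> (real^'x \<Rightarrow> real^'y \<Rightarrow> real) \<Rightarrow> real^'x \<Rightarrow> real^'y \<Rightarrow> real^'y" where
  "zstar f g x y = - (matrix_inv (dyy g x y) *v dy f x y)"

definition outer_obj ::
    "(real^'x \<Rightarrow> real^'y \<Rightarrow> real) \<Rightarrow> (real^'x \<Rightarrow> real^'y \<Rightarrow> real) \<Rightarrow> real^'x \<Rightarrow> real" where
  "outer_obj f g x = f x (ystar g x)"

definition outer_inf ::
    "(real^'x \<Rightarrow> real^'y \<Rightarrow> real) \<Rightarrow> (real^'x \<Rightarrow> real^'y \<Rightarrow> real) \<Rightarrow> real" where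
  "outer_inf f g = (INF x. outer_obj f g x)"

text \<open>The noise levels \<open>sd_f\<close>, \<open>sd_g\<close>, \<open>sd_gxy\<close>, \<open>sd_gyy\<close> are standard deviations for a single
  sample.\<close>

record bilevel_consts =
  Lf :: real
  Bf :: real
  Lg :: real
  Lg' :: real
  Mg :: real
  mug :: real
  sd_f :: real
  sd_g :: real
  sd_gxy :: real
  sd_gyy :: real

definition kappa_g :: "bilevel_consts \<Rightarrow> real" where
  "kappa_g p = Lg p / mug p"

text \<open>A batch of size \<open>b\<close> is a function on \<open>{..<b}\<close>; the values elsewhere are irrelevant.\<close>

definition batch_measure :: "'s measure \<Rightarrow> nat \<Rightarrow> (nat \<Rightarrow> 's) measure" where
  "batch_measure P b = (\<Pi>\<^sub>M j\<in>{..<b}. P)"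

definition batch_avg ::
    "nat \<Rightarrow> (real^'x \<Rightarrow> real^'y \<Rightarrow> 's \<Rightarrow> real) \<Rightarrow> (nat \<Rightarrow> 's) \<Rightarrow> real^'x \<Rightarrow> real^'y \<Rightarrow> real" where
  "batch_avg b h D x y = (\<Sum>j<b. h x y (D j)) / real b"

text \<open>\<open>Lf + Mg * Bf > 0\<close> and \<open>Lg' > 0\<close> say exactly that the constants \<open>L\<close>, \<open>L\<^sub>y\<close>, \<open>L\<^sub>z\<close> below,
  by which the choice of \<open>T\<close> and \<open>N\<close> divides, do not vanish.\<close>

locale stochastic_bilevel = P: prob_space P
  for f g :: "real^'x \<Rightarrow> real^'y \<Rightarrow> real"
    and fh gh :: "real^'x \<Rightarrow> real^'y \<Rightarrow> 's \<Rightarrow> real"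
    and P :: "'s measure"
    and p :: bilevel_consts +
  assumes consts_nonneg: "0 \<le> Lf p" "0 \<le> Bf p" "0 \<le> Mg p"
    and consts_pos: "0 < Lg' p" "0 < mug p" "0 < Lf p + Mg p * Bf p"
    and f_differentiable: "\<And>q. case_prod f differentiable (at q)"
    and g_twice_differentiable: "twice_differentiable g"
    and g_smooth: "\<And>x. (Lg p)-lipschitz_on UNIV (dy g x)"
    and g_strongly_convex: "\<And>x. strongly_convex (mug p) (g x)"
    and f_smooth: "(Lf p)-lipschitz_on UNIV (case_prod (nabla f))"
    and dy_f_bounded: "\<And>x y. norm (dy f x y) \<le> Bf p"
    and dxy_g_lipschitz:
      "\<And>x y x' y'. op_norm (dxy g x y - dxy g x' y') \<le> Mg p * dist (x, y) (x', y')"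
    and dyy_g_lipschitz:
      "\<And>x y x' y'. op_norm (dyy g x y - dyy g x' y') \<le> Mg p * dist (x, y) (x', y')"
    and dy_g_lipschitz_x:
      "\<And>x x' y. norm (dy g x y - dy g x' y) \<le> Lg' p * norm (x - x')"
    and fh_measurable: "(\<lambda>((x, y), s). fh x y s) \<in> borel_measurable (borel \<Otimes>\<^sub>M P)"
    and gh_measurable: "(\<lambda>((x, y), s). gh x y s) \<in> borel_measurable (borel \<Otimes>\<^sub>M P)"
    and fh_differentiable:
      "\<And>s q. s \<in> space P \<Longrightarrow> (\<lambda>(x, y). fh x y s) differentiable (at q)"
    and gh_twice_differentiable:
      "\<And>s. s \<in> space P \<Longrightarrow> twice_differentiable (\<lambda>x y. gh x y s)"
    and f_expectation: "\<And>x y. has_bochner_integral P (fh x y) (f x y)"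
    and g_expectation: "\<And>x y. has_bochner_integral P (gh x y) (g x y)"
    and nabla_f_unbiased:
      "\<And>b x y. 1 \<le> b \<Longrightarrow>
         has_bochner_integral (batch_measure P b) (\<lambda>D. nabla (batch_avg b fh D) x y) (nabla f x y)"
    and nabla_f_variance:
      "\<And>b x y. 1 \<le> b \<Longrightarrow>
         integrable (batch_measure P b)
           (\<lambda>D. (norm (nabla (batch_avg b fh D) x y - nabla f x y))\<^sup>2)"
      "\<And>b x y. 1 \<le> b \<Longrightarrow>
         (LINT D|batch_measure P b. (norm (nabla (batch_avg b fh D) x y - nabla f x y))\<^sup>2)
           \<le> (sd_f p)\<^sup>2 / real b"
    and dy_g_unbiased:
      "\<And>b x y. 1 \<le> b \<Longrightarrow>
         has_bochner_integral (batch_measure P b) (\<lambda>D. dy (batch_avg b gh D) x y) (dy g x y)"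
    and dy_g_variance:
      "\<And>b x y. 1 \<le> b \<Longrightarrow>
         integrable (batch_measure P b) (\<lambda>D. (norm (dy (batch_avg b gh D) x y - dy g x y))\<^sup>2)"
      "\<And>b x y. 1 \<le> b \<Longrightarrow>
         (LINT D|batch_measure P b. (norm (dy (batch_avg b gh D) x y - dy g x y))\<^sup>2)
           \<le> (sd_g p)\<^sup>2 / real b"
    and dxy_g_zero_mean:
      "\<And>b x y. 1 \<le> b \<Longrightarrow>
         has_bochner_integral (batch_measure P b) (\<lambda>D. dxy (batch_avg b gh D) x y - dxy g x y) 0"
    and dxy_g_variance:
      "\<And>b x y. 1 \<le> b \<Longrightarrow>
         integrable (batch_measure P b)
           (\<lambda>D. gram (dxy (batch_avg b gh D) x y - dxy g x y))"
      "\<And>b x y. 1 \<le> b \<Longrightarrow>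
         op_norm (LINT D|batch_measure P b.
             gram (dxy (batch_avg b gh D) x y - dxy g x y))
           \<le> (sd_gxy p)\<^sup>2 / real b"
    and dyy_g_zero_mean:
      "\<And>b x y. 1 \<le> b \<Longrightarrow>
         has_bochner_integral (batch_measure P b) (\<lambda>D. dyy (batch_avg b gh D) x y - dyy g x y) 0"
    and dyy_g_variance:
      "\<And>b x y. 1 \<le> b \<Longrightarrow>
         integrable (batch_measure P b)
           (\<lambda>D. gram (dyy (batch_avg b gh D) x y - dyy g x y))"
      "\<And>b x y. 1 \<le> b \<Longrightarrow>
         op_norm (LINT D|batch_measure P b.
             gram (dyy (batch_avg b gh D) x y - dyy g x y))
           \<le> (sd_gyy p)\<^sup>2 / real b"

record batch_sizes =
  size_g :: nat
  size_f :: nat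
  size_gyy :: nat
  size_gxy :: nat

text \<open>Labels of the samples: outer iteration \<open>k\<close>, inner iteration (\<open>t\<close> or \<open>n\<close>), position in the
  batch. Distinct labels carry independent samples, so every batch is fresh.\<close>

datatype sample_label =
    Sample_g nat nat nat
  | Sample_f nat nat
  | Sample_gyy nat nat nat
  | Sample_gxy nat nat

primrec y_inner ::
    "real \<Rightarrow> real^'x \<Rightarrow> (nat \<Rightarrow> real^'x \<Rightarrow> real^'y \<Rightarrow> real) \<Rightarrow> real^'y \<Rightarrow> nat \<Rightarrow> real^'y" where
  "y_inner \<alpha> x gD y 0 = y"
| "y_inner \<alpha> x gD y (Suc t) =
     y_inner \<alpha> x gD y t - \<alpha> *\<^sub>R dy (gD (Suc t)) x (y_inner \<alpha> x gD y t)"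

primrec z_inner ::
    "real \<Rightarrow> (nat \<Rightarrow> real^'y^'y) \<Rightarrow> real^'y \<Rightarrow> real^'y \<Rightarrow> nat \<Rightarrow> real^'y" where
  "z_inner \<beta> H v z 0 = z"
| "z_inner \<beta> H v z (Suc n) =
     z_inner \<beta> H v z n - \<beta> *\<^sub>R (H (Suc n) *v z_inner \<beta> H v z n + v)"

text \<open>One outer iteration, for the realisation \<open>s\<close> of the samples; it maps
  \<open>(x\<^sub>k, y\<^sub>k\<^sub>-\<^sub>1, z\<^sub>k\<^sub>-\<^sub>1)\<close> to \<open>(x\<^sub>k\<^sub>+\<^sub>1, y\<^sub>k, z\<^sub>k)\<close>.\<close>

definition amigo_step ::
    "(real^'x \<Rightarrow> real^'y \<Rightarrow> 's \<Rightarrow> real) \<Rightarrow> (real^'x \<Rightarrow> real^'y \<Rightarrow> 's \<Rightarrow> real) \<Rightarrow> batch_sizes \<Rightarrow>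
     nat \<Rightarrow> nat \<Rightarrow> (nat \<Rightarrow> real) \<Rightarrow> (nat \<Rightarrow> real) \<Rightarrow> (nat \<Rightarrow> real) \<Rightarrow> (sample_label \<Rightarrow> 's) \<Rightarrow> nat \<Rightarrow>
     (real^'x) \<times> (real^'y) \<times> (real^'y) \<Rightarrow> (real^'x) \<times> (real^'y) \<times> (real^'y)" where
  "amigo_step fh gh bs T N \<alpha> \<beta> \<gamma> s k st =
    (let (x, y_prev, z_prev) = st;
         y = y_inner (\<alpha> k) x
               (\<lambda>t. batch_avg (size_g bs) gh (\<lambda>j. s (Sample_g k t j))) y_prev T;
         fD = batch_avg (size_f bs) fh (\<lambda>j. s (Sample_f k j));
         u = dx fD x y;
         v = dy fD x y;
         z = z_inner (\<beta> k)
               (\<lambda>n. dyy (batch_avg (size_gyy bs) gh (\<lambda>j. s (Sample_gyy k n j))) x y) v z_prev N;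
         \<psi> = u + dxy (batch_avg (size_gxy bs) gh (\<lambda>j. s (Sample_gxy k j))) x y *v z
     in (x - \<gamma> (Suc k) *\<^sub>R \<psi>, y, z))"

primrec amigo ::
    "(real^'x \<Rightarrow> real^'y \<Rightarrow> 's \<Rightarrow> real) \<Rightarrow> (real^'x \<Rightarrow> real^'y \<Rightarrow> 's \<Rightarrow> real) \<Rightarrow> batch_sizes \<Rightarrow>
     nat \<Rightarrow> nat \<Rightarrow> (nat \<Rightarrow> real) \<Rightarrow> (nat \<Rightarrow> real) \<Rightarrow> (nat \<Rightarrow> real) \<Rightarrow> (sample_label \<Rightarrow> 's) \<Rightarrow>
     (real^'x) \<times> (real^'y) \<times> (real^'y) \<Rightarrow> nat \<Rightarrow> (real^'x) \<times> (real^'y) \<times> (real^'y)" where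
  "amigo fh gh bs T N \<alpha> \<beta> \<gamma> s st 0 = st"
| "amigo fh gh bs T N \<alpha> \<beta> \<gamma> s st (Suc k) =
     amigo_step fh gh bs T N \<alpha> \<beta> \<gamma> s k (amigo fh gh bs T N \<alpha> \<beta> \<gamma> s st k)"

text \<open>\<open>init\<close> is \<open>(x\<^sub>0, y\<^sub>-\<^sub>1, z\<^sub>-\<^sub>1)\<close>; the initial points may be random.\<close>

locale amigo_randomness = prob_space M
  for M :: "'w measure"
    and P :: "'s measure"
    and \<xi> :: "sample_label \<Rightarrow> 'w \<Rightarrow> 's"
    and init :: "'w \<Rightarrow> (real^'x) \<times> (real^'y) \<times> (real^'y)" +
  assumes samples_indep: "indep_vars (\<lambda>_. P) \<xi> UNIV"
    and samples_distr: "\<And>l. distr M P (\<xi> l) = P"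
    and init_measurable: "init \<in> borel_measurable M"
    and init_indep:
      "indep_set (sets (vimage_algebra (space M) init borel))
         (sets (vimage_algebra (space M) (\<lambda>\<omega> l. \<xi> l \<omega>) (\<Pi>\<^sub>M l\<in>UNIV. P)))"

definition complexity :: "batch_sizes \<Rightarrow> nat \<Rightarrow> nat \<Rightarrow> nat \<Rightarrow> nat" where
  "complexity bs T N k = k * (T * size_g bs + N * size_gyy bs + size_gxy bs + size_f bs)"

definition L_y :: "bilevel_consts \<Rightarrow> real" where
  "L_y p = Lg' p / mug p"

definition L_z :: "bilevel_consts \<Rightarrow> real" where
  "L_z p = Mg p * Bf p / (mug p)\<^sup>2 + Lf p / mug p"

definition L_psi :: "bilevel_consts \<Rightarrow> real" where
  "L_psi p = max (Lf p + Mg p * Bf p / mug p + Lg' p * L_z p) (Lg' p)"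

definition L_outer :: "bilevel_consts \<Rightarrow> real" where
  "L_outer p = (Lf p + Lg' p * Mg p * Bf p / (mug p)\<^sup>2 + (Lg' p * Lf p + Mg p * Bf p) / mug p)
                 * (1 + Lg' p / mug p)"

definition var_gxy :: "bilevel_consts \<Rightarrow> batch_sizes \<Rightarrow> real" where
  "var_gxy p bs = (sd_gxy p)\<^sup>2 / real (size_gxy bs)"

definition var_gyy :: "bilevel_consts \<Rightarrow> batch_sizes \<Rightarrow> real" where
  "var_gyy p bs = (sd_gyy p)\<^sup>2 / real (size_gyy bs)"

definition var_x :: "bilevel_consts \<Rightarrow> batch_sizes \<Rightarrow> real" where
  "var_x p bs = 2 * var_gxy p bs + 2 * (Lg' p)\<^sup>2 / (mug p)\<^sup>2 * var_gyy p bs"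

definition step_alpha :: "bilevel_consts \<Rightarrow> real" where "step_alpha p = 1 / Lg p"
definition step_beta :: "bilevel_consts \<Rightarrow> real" where "step_beta p = 1 / (2 * Lg p)"
definition step_gamma :: "bilevel_consts \<Rightarrow> real" where "step_gamma p = 1 / L_outer p"
definition eta0 :: "bilevel_consts \<Rightarrow> real" where "eta0 p = L_outer p"
definition zeta0 :: "bilevel_consts \<Rightarrow> real" where "zeta0 p = 2 * L_outer p"

definition C1 :: "bilevel_consts \<Rightarrow> real" where
  "C1 p = 1 + 2 * ln (6 + 24 * (L_psi p)\<^sup>2 / eta0 p)"

definition C2 :: "bilevel_consts \<Rightarrow> real" where
  "C2 p = 2 * ln (1 + 4 * (L_y p)\<^sup>2 / (L_outer p)\<^sup>2 * max (eta0 p) (8 * zeta0 p))"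

definition C3 :: "bilevel_consts \<Rightarrow> real" where
  "C3 p = max 0 (max (- 2 * ln (5 * (L_psi p)\<^sup>2 / eta0 p))
                     (- 2 * ln (L_outer p / (4 * (L_y p)\<^sup>2))))"

definition C1' :: "bilevel_consts \<Rightarrow> batch_sizes \<Rightarrow> real" where
  "C1' p bs = 1 + 2 * ln (4 + 12 / eta0 p * (2 * (L_psi p)\<^sup>2 + var_x p bs))"

definition C2' :: "bilevel_consts \<Rightarrow> real" where
  "C2' p = 2 * ln (1 + 2 * (L_z p)\<^sup>2 / (L_y p)\<^sup>2 * (1 + 16 * (L_y p)\<^sup>2))"

definition C3' :: "bilevel_consts \<Rightarrow> batch_sizes \<Rightarrow> real" where
  "C3' p bs = max 0 (max (- 2 * ln ((L_psi p)\<^sup>2 / (4 * (L_z p)\<^sup>2 * eta0 p)))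
                         (- 2 * ln (step_gamma p * (var_gxy p bs + (Lg' p)\<^sup>2))))"

definition T_choice :: "bilevel_consts \<Rightarrow> nat" where
  "T_choice p =
     nat \<lfloor>1 / step_alpha p * (1 / mug p) * max (C1 p) (max (C2 p) (C3 p))\<rfloor> + 1"

definition N_choice :: "bilevel_consts \<Rightarrow> batch_sizes \<Rightarrow> nat" where
  "N_choice p bs =
     nat \<lfloor>2 * (1 / step_beta p) * (1 / mug p) *
           (max (C1 p) (max (C2 p) (C3 p)) + max (C1' p bs) (max (C2' p) (C3' p bs)))\<rfloor> + 1"

text \<open>The value at \<open>k\<close> is the random triple \<open>(x\<^sub>k, y\<^sub>k\<^sub>-\<^sub>1, z\<^sub>k\<^sub>-\<^sub>1)\<close>.\<close>

definition amigo_run ::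
    "(real^'x \<Rightarrow> real^'y \<Rightarrow> 's \<Rightarrow> real) \<Rightarrow> (real^'x \<Rightarrow> real^'y \<Rightarrow> 's \<Rightarrow> real) \<Rightarrow>
     bilevel_consts \<Rightarrow> batch_sizes \<Rightarrow> (sample_label \<Rightarrow> 'w \<Rightarrow> 's) \<Rightarrow>
     ('w \<Rightarrow> (real^'x) \<times> (real^'y) \<times> (real^'y)) \<Rightarrow> nat \<Rightarrow> 'w \<Rightarrow> (real^'x) \<times> (real^'y) \<times> (real^'y)"
  where
  "amigo_run fh gh p bs \<xi> init k \<omega> =
     amigo fh gh bs (T_choice p) (N_choice p bs)
       (\<lambda>_. step_alpha p) (\<lambda>_. step_beta p) (\<lambda>_. step_gamma p) (\<lambda>l. \<xi> l \<omega>) (init \<omega>) k"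

text \<open>Here \<open>y\<^sub>0\<close> is the second component of the state after the first outer iteration.\<close>

definition initial_gap ::
    "'w measure \<Rightarrow> (real^'x \<Rightarrow> real^'y \<Rightarrow> real) \<Rightarrow> (real^'x \<Rightarrow> real^'y \<Rightarrow> real) \<Rightarrow>
     (real^'x \<Rightarrow> real^'y \<Rightarrow> 's \<Rightarrow> real) \<Rightarrow> (real^'x \<Rightarrow> real^'y \<Rightarrow> 's \<Rightarrow> real) \<Rightarrow>
     bilevel_consts \<Rightarrow> batch_sizes \<Rightarrow> (sample_label \<Rightarrow> 'w \<Rightarrow> 's) \<Rightarrow>
     ('w \<Rightarrow> (real^'x) \<times> (real^'y) \<times> (real^'y)) \<Rightarrow> real" where
  "initial_gap M f g fh gh p bs \<xi> init =
     (let x0 = (\<lambda>\<omega>. fst (init \<omega>));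
          y_init = (\<lambda>\<omega>. fst (snd (init \<omega>)));
          z_init = (\<lambda>\<omega>. snd (snd (init \<omega>)));
          y0 = (\<lambda>\<omega>. fst (snd (amigo_run fh gh p bs \<xi> init 1 \<omega>)))
      in (LINT \<omega>|M. outer_obj f g (x0 \<omega>) - outer_inf f g)
         + (LINT \<omega>|M. (norm (y_init \<omega> - ystar g (x0 \<omega>)))\<^sup>2)
         + (LINT \<omega>|M. (norm (z_init \<omega> - zstar f g (x0 \<omega>) (y0 \<omega>)))\<^sup>2))"

text \<open>\<open>b = \<Theta>(r)\<close> for a batch size, with constants \<open>c \<le> c'\<close>. A batch has at least one sample, so
  when \<open>r\<close> is small or zero the size one is what \<open>\<Theta>(r)\<close> rounds to.\<close>

definition Theta_size :: "real \<Rightarrow> real \<Rightarrow> real \<Rightarrow> nat \<Rightarrow> bool" where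
  "Theta_size c c' r b \<longleftrightarrow> 1 \<le> b \<and> c * r \<le> real b \<and> real b \<le> max 1 (c' * r)"

definition Theta_sizes :: "real \<Rightarrow> real \<Rightarrow> bilevel_consts \<Rightarrow> real \<Rightarrow> batch_sizes \<Rightarrow> bool" where
  "Theta_sizes c c' p \<epsilon> bs \<longleftrightarrow>
     Theta_size c c' ((kappa_g p)^2 / \<epsilon> * (sd_gxy p)\<^sup>2) (size_gxy bs) \<and>
     Theta_size c c' ((kappa_g p)^3 / \<epsilon> * (sd_gyy p)\<^sup>2 * max 1 (\<epsilon> * (mug p)\<^sup>2)) (size_gyy bs) \<and>
     Theta_size c c' ((kappa_g p)^2 * (sd_f p)\<^sup>2 / \<epsilon>) (size_f bs) \<and>
     Theta_size c c' ((kappa_g p)^5 * (sd_g p)\<^sup>2 / \<epsilon>) (size_g bs)"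

text \<open>The complexity is of order (number of outer iterations) times (queries per iteration), of
  orders \<open>kappa_g^3 / \<epsilon> * initial_gap\<close> and \<open>kappa_g^2 / \<epsilon> * noise_level\<close> up to logarithms. At least one
  iteration is made, and one iteration makes at least \<open>T + N + 2\<close> queries, which is at least of order
  \<open>kappa_g\<close>. So an \<open>O\<close> of the product can only be claimed where, up to a constant, the first
  factor is at least \<open>1\<close> and the second at least \<open>kappa_g\<close>; this is so for all small \<open>\<epsilon>\<close> unless the
  product is identically zero.\<close>

definition noise_level :: "bilevel_consts \<Rightarrow> real \<Rightarrow> real" where
  "noise_level p \<epsilon> =
     (kappa_g p)^4 * (sd_g p)\<^sup>2 + (kappa_g p)^2 * max 1 (\<epsilon> * (mug p)\<^sup>2) * (sd_gyy p)\<^sup>2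
       + (sd_gxy p)\<^sup>2 + (sd_f p)\<^sup>2"

text \<open>The constants hidden in \<open>\<Theta>\<close> and \<open>O\<close> may depend only on \<open>Lf\<close>, \<open>Bf\<close>, \<open>Lg\<close>, \<open>Lg'\<close>, \<open>Mg\<close> and
  on an upper bound \<open>S\<close> of \<open>(sd_gxy)\<^sup>2\<close>, not on \<open>mug\<close>, \<open>\<epsilon>\<close>, the noise levels or the dimensions. Since
  dimensions are types, an existential quantifier inside the statement could not express the
  latter; explicit (deliberately crude) functions of these six quantities do.\<close>

definition magnitude :: "bilevel_consts \<Rightarrow> real \<Rightarrow> real" where
  "magnitude p S = 1 + Lf p + Bf p + Lg p + 1 / Lg p + Lg' p + 1 / Lg' p + Mg p
                     + 1 / (Lf p + Mg p * Bf p) + S"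

definition Theta_const :: "bilevel_consts \<Rightarrow> real \<Rightarrow> real" where
  "Theta_const p S = 10^10 * (magnitude p S)^40"

definition O_const :: "bilevel_consts \<Rightarrow> real \<Rightarrow> real \<Rightarrow> real" where
  "O_const p S c' = 10^10 * (magnitude p S)^40 * c'\<^sup>2"

end

theory Submission
  imports Defs
begin

text \<open>With step size \<open>1 / L\<close> the outer objective drops in every iteration by the squared gradient over
  \<open>2 * L\<close>, up to the squared error of \<open>\<psi>\<close> over \<open>2 * L\<close>; no unbiasedness of \<open>\<psi>\<close> is needed. That error is
  controlled by the distances of \<open>y\<close> to \<open>ystar g x\<close> and of \<open>z\<close> to \<open>zstar f g x y\<close>. The inner loops contract
  these distances by factors at most \<open>exp (- X)\<close> and \<open>exp (- 2 * (X + X'))\<close>, where \<open>X\<close>, \<open>X'\<close> are the maxima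
  in the choice of \<open>T\<close> and \<open>N\<close>, and a move of \<open>x\<close> spoils them only by a multiple of the gradient and of the
  error of \<open>\<psi>\<close>. So a weighted sum of the objective gap and of the two squared distances decreases in
  expectation by the squared gradient over \<open>4 * L\<close>, up to a noise term that the batch sizes keep below a
  multiple of \<open>\<epsilon> / L\<close>.\<close>

section \<open>Convexity and partial derivatives\<close>

text \<open>Three obstacles shape the details. The loop for \<open>z\<close> freezes one noisy
  gradient \<open>vk\<close>, so it approaches \<open>zsol\<close> at \<open>vk\<close> and not
  \<open>zstar\<close>; the gap between the two is noise that no contraction reduces. The errors of
  \<open>y\<close> and \<open>z\<close> feed the error of \<open>psik\<close> and are fed by it
  through the move of \<open>x\<close>: the weights of the Lyapunov sum must be small enough that a
  move costs little, yet large enough that the inner loops can pay for them. The exponents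
  \<open>C1\<close>, \<open>C2\<close>, \<open>C1'\<close>, \<open>C2'\<close> are matched to these
  two demands. Finally, the powers of \<open>\<kappa>\<close> in the batch sizes leave little slack:
  the bound for \<open>L_outer\<close> alone is of order \<open>\<kappa> ^ 3\<close>, and only
  because \<open>weight_z p * L_outer p\<close> is bounded independently of \<open>\<kappa>\<close>
  does a batch size of order \<open>\<kappa>\<^sup>2\<close> suffice for \<open>f\<close>. The outer
  objective is differentiated through a two-sided quadratic expansion, and Fubini's theorem for the
  product law of the current state and a fresh batch takes the place of conditional
  expectations.\<close>

lemma taylor_quadratic_bound:
  fixes \<phi> \<phi>' :: "real \<Rightarrow> real"
  assumes deriv: "\<And>t. 0 \<le> t \<Longrightarrow> t \<le> 1 \<Longrightarrow> (\<phi> has_real_derivative \<phi>' t) (at t)"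
    and lip: "\<And>t. 0 \<le> t \<Longrightarrow> t \<le> 1 \<Longrightarrow> \<bar>\<phi>' t - \<phi>' 0\<bar> \<le> K * t"
  shows "\<bar>\<phi> 1 - \<phi> 0 - \<phi>' 0\<bar> \<le> K / 2"
proof -
  \<comment> \<open>Subtracting the tangent and the parabola \<open>K / 2 * t\<^sup>2\<close> leaves
    a function whose derivative is at most 0; adding the parabola gives the other side. This
    replaces an integration of \<open>\<phi>'\<close>.\<close>
  have "\<phi> 1 - \<phi>' 0 * 1 - K / 2 * 1\<^sup>2 \<le> \<phi> 0 - \<phi>' 0 * 0 - K / 2 * 0\<^sup>2"
  proof (rule DERIV_nonpos_imp_nonincreasing[of 0 1 "\<lambda>t. \<phi> t - \<phi>' 0 * t - K / 2 * t\<^sup>2"])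
    fix t :: real assume t: "0 \<le> t" "t \<le> 1"
    have "((\<lambda>t. \<phi> t - \<phi>' 0 * t - K / 2 * t\<^sup>2) has_real_derivative \<phi>' t - \<phi>' 0 - K * t) (at t)"
      using t by (auto intro!: derivative_eq_intros deriv)
    moreover have "\<phi>' t - \<phi>' 0 - K * t \<le> 0" using lip[OF t] by simp
    ultimately show "\<exists>y. ((\<lambda>t. \<phi> t - \<phi>' 0 * t - K / 2 * t\<^sup>2) has_real_derivative y) (at t) \<and> y \<le> 0"
      by blast
  qed simp
  moreover have "\<phi> 0 - \<phi>' 0 * 0 + K / 2 * 0\<^sup>2 \<le> \<phi> 1 - \<phi>' 0 * 1 + K / 2 * 1\<^sup>2"
  proof (rule DERIV_nonneg_imp_nondecreasing[of 0 1 "\<lambda>t. \<phi> t - \<phi>' 0 * t + K / 2 * t\<^sup>2"])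
    fix t :: real assume t: "0 \<le> t" "t \<le> 1"
    have "((\<lambda>t. \<phi> t - \<phi>' 0 * t + K / 2 * t\<^sup>2) has_real_derivative \<phi>' t - \<phi>' 0 + K * t) (at t)"
      using t by (auto intro!: derivative_eq_intros deriv)
    moreover have "0 \<le> \<phi>' t - \<phi>' 0 + K * t" using lip[OF t] by simp
    ultimately show "\<exists>y. ((\<lambda>t. \<phi> t - \<phi>' 0 * t + K / 2 * t\<^sup>2) has_real_derivative y) (at t) \<and> 0 \<le> y"
      by blast
  qed simp
  ultimately show ?thesis unfolding abs_le_iff by (simp add: field_simps)
qed

lemma has_derivative_along_line:
  assumes "(h has_derivative h') (at (y + t *\<^sub>R v))"
  shows "((\<lambda>t. h (y + t *\<^sub>R v)) has_vector_derivative h' v) (at t)"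
proof -
  have "((\<lambda>t. y + t *\<^sub>R v) has_derivative (\<lambda>s. s *\<^sub>R v)) (at t)"
    by (rule has_derivative_eq_rhs) (rule derivative_intros | simp)+
  from has_derivative_compose[of "\<lambda>t. y + t *\<^sub>R v", OF this assms]
  have "((\<lambda>t. h (y + t *\<^sub>R v)) has_derivative (\<lambda>s. h' (s *\<^sub>R v))) (at t)" .
  then show ?thesis
    using linear_scale[OF has_derivative_linear[OF assms]]
    by (simp add: has_vector_derivative_def)
qed

text \<open>Serves to pass from inequalities between increments to inequalities for derivatives. The
  limit is one-sided because those inequalities are used for \<open>0 < t < 1\<close>.\<close>

lemma has_derivative_difference_quotient:
  assumes "(h has_derivative h') (at y)"
  shows "((\<lambda>t. (h (y + t *\<^sub>R v) - h y) /\<^sub>R t) \<longlongrightarrow> h' v) (at_right 0)"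
proof -
  have "((\<lambda>t. h (y + t *\<^sub>R v)) has_vector_derivative h' v) (at 0)"
    by (rule has_derivative_along_line) (use assms in simp)
  then have "((\<lambda>t. norm (h (y + t *\<^sub>R v) - h y - t *\<^sub>R h' v) / norm t) \<longlongrightarrow> 0) (at 0)"
    by (simp add: has_vector_derivative_def has_derivative_at)
  moreover have "\<forall>\<^sub>F t in at 0. norm (h (y + t *\<^sub>R v) - h y - t *\<^sub>R h' v) / norm t
      = norm ((h (y + t *\<^sub>R v) - h y) /\<^sub>R t - h' v)"
    unfolding eventually_at_filter
  proof (intro always_eventually allI impI)
    fix t :: real assume "t \<noteq> 0"
    then have "(h (y + t *\<^sub>R v) - h y) /\<^sub>R t - h' v = (h (y + t *\<^sub>R v) - h y - t *\<^sub>R h' v) /\<^sub>R t"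
      by (simp add: scaleR_diff_right)
    then show "norm (h (y + t *\<^sub>R v) - h y - t *\<^sub>R h' v) / norm t
      = norm ((h (y + t *\<^sub>R v) - h y) /\<^sub>R t - h' v)" by (simp add: divide_inverse mult.commute)
  qed
  ultimately have "((\<lambda>t. norm ((h (y + t *\<^sub>R v) - h y) /\<^sub>R t - h' v)) \<longlongrightarrow> 0) (at 0)"
    by (rule Lim_transform_eventually)
  then have "((\<lambda>t. (h (y + t *\<^sub>R v) - h y) /\<^sub>R t) \<longlongrightarrow> h' v) (at 0)"
    by (simp add: tendsto_norm_zero_iff LIM_zero_iff)
  then show ?thesis by (rule filterlim_mono) (simp_all add: at_le)
qed

section \<open>Smooth strongly convex functions\<close>

locale smooth_strongly_convex =
  fixes h :: "'a::euclidean_space \<Rightarrow> real" and D :: "'a \<Rightarrow> 'a" and m L :: real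
  assumes deriv: "\<And>y. (h has_derivative (\<lambda>v. inner (D y) v)) (at y)"
    and lip: "L-lipschitz_on UNIV D"
    and sc: "strongly_convex m h"
    and m_pos: "0 < m"
begin

lemma D_lip: "norm (D y - D y') \<le> L * norm (y - y')"
  using lipschitz_onD[OF lip, of y y'] by (simp add: dist_norm)

lemma line_deriv:
  "((\<lambda>t. h (y + t *\<^sub>R v)) has_real_derivative inner (D (y + t *\<^sub>R v)) v) (at t)"
  using has_derivative_along_line[OF deriv] by (simp add: has_real_derivative_iff_has_vector_derivative)

text \<open>Strong convexity on the segment, divided by \<open>t\<close>, in the limit of small
  \<open>t\<close>; the factor \<open>1 - t\<close> tends to 1, so the full constant
  \<open>m / 2\<close> survives.\<close>

lemma first_order: "h y + inner (D y) (y' - y) + m / 2 * (norm (y' - y))\<^sup>2 \<le> h y'"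
proof -
  let ?d = "y' - y"
  have lim: "((\<lambda>t. (h (y + t *\<^sub>R ?d) - h y) /\<^sub>R t) \<longlongrightarrow> inner (D y) ?d) (at_right 0)"
    by (rule has_derivative_difference_quotient[OF deriv])
  have lim2: "((\<lambda>t. h y' - h y - m / 2 * (1 - t) * (norm ?d)\<^sup>2)
      \<longlongrightarrow> h y' - h y - m / 2 * (1 - 0) * (norm ?d)\<^sup>2) (at_right 0)"
    by (intro tendsto_intros)
  have "\<forall>\<^sub>F t in at_right 0. (h (y + t *\<^sub>R ?d) - h y) /\<^sub>R t \<le> h y' - h y - m / 2 * (1 - t) * (norm ?d)\<^sup>2"
    unfolding eventually_at_right_field
  proof (intro exI[of _ 1] conjI allI impI)
    fix t :: real assume t: "0 < t" "t < 1"
    have "h (t *\<^sub>R y' + (1 - t) *\<^sub>R y)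
        \<le> t * h y' + (1 - t) * h y - m / 2 * t * (1 - t) * (norm ?d)\<^sup>2"
      using sc t unfolding strongly_convex_def by (simp add: less_imp_le)
    moreover have "t *\<^sub>R y' + (1 - t) *\<^sub>R y = y + t *\<^sub>R ?d" by (simp add: algebra_simps)
    ultimately have "h (y + t *\<^sub>R ?d) - h y \<le> t * (h y' - h y - m / 2 * (1 - t) * (norm ?d)\<^sup>2)"
      by (simp add: algebra_simps)
    then show "(h (y + t *\<^sub>R ?d) - h y) /\<^sub>R t \<le> h y' - h y - m / 2 * (1 - t) * (norm ?d)\<^sup>2"
      using t by (simp add: divide_simps mult.commute)
  qed simp
  then have "inner (D y) ?d \<le> h y' - h y - m / 2 * (1 - 0) * (norm ?d)\<^sup>2"
    by (intro tendsto_le[OF _ lim2 lim]) simp_all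
  then show ?thesis by simp
qed

lemma strongly_monotone: "m * (norm (y - y'))\<^sup>2 \<le> inner (D y - D y') (y - y')"
  using first_order[of y y'] first_order[of y' y]
  by (simp add: inner_diff_left inner_diff_right norm_minus_commute)

lemma descent: "h (y + v) \<le> h y + inner (D y) v + L / 2 * (norm v)\<^sup>2"
proof -
  have "\<bar>h (y + 1 *\<^sub>R v) - h (y + 0 *\<^sub>R v) - inner (D (y + 0 *\<^sub>R v)) v\<bar> \<le> L * (norm v)\<^sup>2 / 2"
  proof (rule taylor_quadratic_bound[OF line_deriv])
    fix t :: real assume t: "0 \<le> t" "t \<le> 1"
    have "\<bar>inner (D (y + t *\<^sub>R v) - D y) v\<bar> \<le> norm (D (y + t *\<^sub>R v) - D y) * norm v"
      by (rule Cauchy_Schwarz_ineq2)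
    also have "\<dots> \<le> (L * norm (t *\<^sub>R v)) * norm v"
      by (intro mult_right_mono order_trans[OF D_lip]) auto
    finally show "\<bar>inner (D (y + t *\<^sub>R v)) v - inner (D (y + 0 *\<^sub>R v)) v\<bar> \<le> L * (norm v)\<^sup>2 * t"
      using t by (simp add: inner_diff_left power2_eq_square algebra_simps)
  qed
  then show ?thesis unfolding abs_le_iff by (simp add: field_simps)
qed

text \<open>A unit vector squeezes both constants between monotonicity and the Lipschitz bound. This
  is the source of \<open>0 < L\<close> and of \<open>1 \<le> kappa_g p\<close>.\<close>

lemma m_le_L: "m \<le> L"
proof -
  obtain b :: 'a where b: "b \<in> Basis" using nonempty_Basis by blast
  have "m * (norm b)\<^sup>2 \<le> inner (D (0 + b) - D 0) b" using strongly_monotone[of "0 + b" 0] by simp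
  also have "\<dots> \<le> norm (D (0 + b) - D 0) * norm b" by (rule norm_cauchy_schwarz)
  also have "\<dots> \<le> (L * norm b) * norm b" by (intro mult_right_mono order_trans[OF D_lip]) auto
  finally show ?thesis using b by simp
qed

lemma L_pos: "0 < L" using m_le_L m_pos by simp

text \<open>The Baillon-Haddad argument: \<open>h\<close> minus its tangent at \<open>a\<close> is
  smallest at \<open>a\<close>, and a step of size \<open>1 / L\<close> from \<open>b\<close> along
  the difference of the gradients lowers it by the left-hand side of \<open>*\<close>. Adding the
  inequality with \<open>a\<close> and \<open>b\<close> exchanged gives the claim.\<close>

lemma cocoercive: "(norm (D y - D y'))\<^sup>2 \<le> L * inner (D y - D y') (y - y')"
proof -
  have *: "(norm (D b - D a))\<^sup>2 / (2 * L) \<le> h b - h a - inner (D a) (b - a)" for a b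
  proof -
    let ?r = "D b - D a"
    let ?v = "(- 1 / L) *\<^sub>R ?r"
    have v: "(norm ?v)\<^sup>2 = (norm ?r)\<^sup>2 / L\<^sup>2" using L_pos by (simp add: power_divide)
    have "h a + inner (D a) (b + ?v - a) \<le> h (b + ?v)"
      using first_order[of a "b + ?v"] m_pos
      by (smt (verit) mult_nonneg_nonneg zero_le_power2 half_gt_zero)
    also have "\<dots> \<le> h b + inner (D b) ?v + L / 2 * (norm ?v)\<^sup>2" by (rule descent)
    finally have "h a + inner (D a) (b + ?v - a) \<le> h b + inner (D b) ?v + L / 2 * (norm ?v)\<^sup>2" .
    moreover have "inner (D a) (b + ?v - a) = inner (D a) (b - a) + inner (D a) ?v"
      by (simp only: inner_add_right[symmetric]) (simp add: algebra_simps)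
    moreover have "inner ?r ?v = inner (D b) ?v - inner (D a) ?v" by (rule inner_diff_left)
    ultimately have "h a + inner (D a) (b - a) - inner ?r ?v - L / 2 * (norm ?v)\<^sup>2 \<le> h b" by simp
    moreover have "inner ?r ?v = - ((norm ?r)\<^sup>2 / L)"
      by (simp add: power2_norm_eq_inner)
    moreover have "L / 2 * (norm ?v)\<^sup>2 = (norm ?r)\<^sup>2 / L / 2"
      using L_pos unfolding v by (simp add: power2_eq_square)
    ultimately have "(norm ?r)\<^sup>2 / L / 2 \<le> h b - h a - inner (D a) (b - a)" by linarith
    then show ?thesis by simp
  qed
  from *[of y y'] *[of y' y] have "(norm (D y - D y'))\<^sup>2 / L \<le> inner (D y - D y') (y - y')"
    by (simp add: norm_minus_commute inner_diff_left inner_diff_right)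
  then show ?thesis using L_pos by (simp add: divide_simps mult.commute)
qed

text \<open>Cocoercivity spends one half of the cross term on the square of the gradient difference;
  the other half yields the rate through strong monotonicity.\<close>

lemma gradient_step_contraction:
  "(norm (y - (1 / L) *\<^sub>R D y - (y' - (1 / L) *\<^sub>R D y')))\<^sup>2 \<le> (1 - m / L) * (norm (y - y'))\<^sup>2"
proof -
  let ?d = "y - y'" and ?r = "D y - D y'"
  have "y - (1 / L) *\<^sub>R D y - (y' - (1 / L) *\<^sub>R D y') = ?d - (1 / L) *\<^sub>R ?r"
    by (simp add: algebra_simps)
  then have "(norm (y - (1 / L) *\<^sub>R D y - (y' - (1 / L) *\<^sub>R D y')))\<^sup>2
     = (norm ?d)\<^sup>2 - 2 / L * inner ?r ?d + (norm ?r)\<^sup>2 / L\<^sup>2"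
    by (simp only: power2_norm_eq_inner)
      (simp add: inner_diff_left inner_diff_right inner_commute power2_eq_square diff_divide_distrib add_divide_distrib algebra_simps)
  also have "\<dots> \<le> (norm ?d)\<^sup>2 - 2 / L * inner ?r ?d + L * inner ?r ?d / L\<^sup>2"
    using cocoercive[of y y'] by (simp add: divide_right_mono)
  also have "\<dots> = (norm ?d)\<^sup>2 - inner ?r ?d / L"
    using L_pos by (simp add: power2_eq_square field_simps)
  also have "\<dots> \<le> (norm ?d)\<^sup>2 - m * (norm ?d)\<^sup>2 / L"
    using strongly_monotone[of y y'] L_pos by (simp add: divide_right_mono)
  finally show ?thesis by (simp add: algebra_simps)
qed

text \<open>The gradient step is a contraction of a complete space, and its fixed points are the
  zeros of \<open>D\<close>.\<close>

lemma ex_D_zero: "\<exists>y. D y = 0"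
proof -
  let ?F = "\<lambda>y. y - (1 / L) *\<^sub>R D y"
  let ?q = "sqrt (1 - m / L)"
  have q: "0 \<le> ?q" "?q < 1" using m_pos L_pos m_le_L by (auto simp: divide_simps)
  have "\<exists>!y\<in>UNIV. ?F y = y"
  proof (rule Banach_fix[OF complete_UNIV _ q])
    fix y y' :: 'a
    show "dist (?F y) (?F y') \<le> ?q * dist y y'"
      unfolding dist_norm using real_sqrt_le_mono[OF gradient_step_contraction[of y y']]
      by (simp add: real_sqrt_mult)
  qed auto
  then show ?thesis using L_pos by auto
qed

text \<open>\<open>arg_min\<close> is a choice operator and says something only once a minimiser is
  known to exist. A zero of \<open>D\<close> is one, and quadratic growth around it makes it the
  only one.\<close>

lemma D_arg_min: "D (arg_min h (\<lambda>_. True)) = 0"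
proof -
  obtain y where y: "D y = 0" using ex_D_zero by blast
  have le: "h y + m / 2 * (norm (z - y))\<^sup>2 \<le> h z" for z
    using first_order[of y z] y by simp
  have "is_arg_min h (\<lambda>_. True) y"
    unfolding is_arg_min_def using le m_pos
    by (smt (verit) mult_nonneg_nonneg zero_le_power2 half_gt_zero)
  then have "is_arg_min h (\<lambda>_. True) (arg_min h (\<lambda>_. True))"
    unfolding arg_min_def by (rule someI)
  then have "h (arg_min h (\<lambda>_. True)) \<le> h y"
    unfolding is_arg_min_def by (metis not_le)
  then have "m / 2 * (norm (arg_min h (\<lambda>_. True) - y))\<^sup>2 \<le> 0"
    using le[of "arg_min h (\<lambda>_. True)"] by simp
  then have "arg_min h (\<lambda>_. True) = y" using m_pos by (simp add: mult_le_0_iff)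
  then show ?thesis using y by simp
qed

lemma hessian_lower:
  assumes "(D has_derivative D') (at y)"
  shows "m * (norm w)\<^sup>2 \<le> inner (D' w) w"
proof -
  have lim: "((\<lambda>t. inner ((D (y + t *\<^sub>R w) - D y) /\<^sub>R t) w) \<longlongrightarrow> inner (D' w) w) (at_right 0)"
    by (intro tendsto_intros has_derivative_difference_quotient assms)
  have "\<forall>\<^sub>F t in at_right 0. m * (norm w)\<^sup>2 \<le> inner ((D (y + t *\<^sub>R w) - D y) /\<^sub>R t) w"
    unfolding eventually_at_right_field
  proof (intro exI[of _ 1] conjI allI impI)
    fix t :: real assume t: "0 < t" "t < 1"
    show "m * (norm w)\<^sup>2 \<le> inner ((D (y + t *\<^sub>R w) - D y) /\<^sub>R t) w"
      using strongly_monotone[of "y + t *\<^sub>R w" y] t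
      by (simp add: power_mult_distrib divide_simps power2_eq_square mult_ac)
  qed simp
  then show ?thesis by (intro tendsto_lowerbound[OF lim]) simp_all
qed

text \<open>The limit of \<open>cocoercive\<close> along a line. It takes the place of an upper
  bound on eigenvalues, which would presuppose that \<open>D'\<close> is symmetric.\<close>

lemma hessian_cocoercive:
  assumes "(D has_derivative D') (at y)"
  shows "(norm (D' w))\<^sup>2 \<le> L * inner (D' w) w"
proof -
  let ?q = "\<lambda>t. (D (y + t *\<^sub>R w) - D y) /\<^sub>R t"
  have lim: "(?q \<longlongrightarrow> D' w) (at_right 0)"
    by (rule has_derivative_difference_quotient[OF assms])
  have lims: "((\<lambda>t. (norm (?q t))\<^sup>2) \<longlongrightarrow> (norm (D' w))\<^sup>2) (at_right 0)"
    "((\<lambda>t. L * inner (?q t) w) \<longlongrightarrow> L * inner (D' w) w) (at_right 0)"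
    by (intro tendsto_intros lim)+
  have "\<forall>\<^sub>F t in at_right 0. (norm (?q t))\<^sup>2 \<le> L * inner (?q t) w"
    unfolding eventually_at_right_field
  proof (intro exI[of _ 1] conjI allI impI)
    fix t :: real assume t: "0 < t" "t < 1"
    show "(norm (?q t))\<^sup>2 \<le> L * inner (?q t) w"
      using cocoercive[of "y + t *\<^sub>R w" y] t
      by (simp add: power_mult_distrib divide_simps power2_eq_square mult_ac)
  qed simp
  then show ?thesis by (intro tendsto_le[OF _ lims(2,1)]) simp_all
qed

end

text \<open>A matrix and its transpose have the same operator norm: test the transpose with
  \<open>u = A *v w\<close>, apply Cauchy-Schwarz and cancel the square of
  \<open>norm (A *v w)\<close>.\<close>

lemma matrix_norm_le_transpose:
  fixes A :: "real^'n^'n"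
  assumes "\<And>u. (norm (u v* A))\<^sup>2 \<le> q * (norm u)\<^sup>2"
  shows "(norm (A *v w))\<^sup>2 \<le> q * (norm w)\<^sup>2"
proof (cases "A *v w = 0")
  case True
  then show ?thesis using order_trans[OF zero_le_power2 assms[of w]] by simp
next
  case False
  let ?a = "norm (A *v w)"
  have "?a\<^sup>2 = inner ((A *v w) v* A) w"
    by (simp add: power2_norm_eq_inner dot_lmul_matrix)
  also have "\<dots> \<le> norm ((A *v w) v* A) * norm w" by (rule norm_cauchy_schwarz)
  finally have "(?a\<^sup>2)\<^sup>2 \<le> (norm ((A *v w) v* A))\<^sup>2 * (norm w)\<^sup>2"
    by (metis power_mono power_mult_distrib zero_le_power2)
  also have "\<dots> \<le> q * ?a\<^sup>2 * (norm w)\<^sup>2" by (intro mult_right_mono assms) auto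
  finally have "?a\<^sup>2 * ?a\<^sup>2 \<le> ?a\<^sup>2 * (q * (norm w)\<^sup>2)" by (simp add: power2_eq_square[of "?a\<^sup>2"] mult_ac)
  then show ?thesis using False by (subst (asm) mult_le_cancel_left_pos) simp_all
qed

section \<open>Gradients and Jacobians of functions on a product\<close>

lemma linear_eq_inner_axis:
  fixes F :: "real^'n \<Rightarrow> real"
  assumes "linear F"
  shows "F v = inner (\<chi> i. F (axis i 1)) v"
proof -
  have "F v = F (\<Sum>i\<in>UNIV. (v $ i) *\<^sub>R axis i 1)"
    using basis_expansion[of v] by (simp add: scalar_mult_eq_scaleR)
  also have "\<dots> = (\<Sum>i\<in>UNIV. (v $ i) * F (axis i 1))"
    by (simp add: linear_sum[OF assms] linear_scale[OF assms])
  finally show ?thesis by (simp add: inner_vec_def mult.commute)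
qed

lemma grad_has_derivative:
  assumes "h differentiable (at x)"
  shows "(h has_derivative (\<lambda>v. inner (grad h x) v)) (at x)"
proof -
  have 1: "(h has_derivative frechet_derivative h (at x)) (at x)"
    using assms frechet_derivative_works by blast
  have "frechet_derivative h (at x) = (\<lambda>v. inner (grad h x) v)"
    unfolding grad_def using linear_eq_inner_axis[OF has_derivative_linear[OF 1]] by blast
  with 1 show ?thesis by simp
qed

lemma grad_eqI:
  assumes "(h has_derivative (\<lambda>v. inner a v)) (at x)"
  shows "grad h x = a"
  using frechet_derivative_at[OF assms, symmetric]
  by (simp add: grad_def vec_eq_iff inner_axis)

lemma partial_x_has_derivative:
  assumes "(F has_derivative F') (at (x, y))"
  shows "((\<lambda>x. F (x, y)) has_derivative (\<lambda>u. F' (u, 0))) (at x)"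
proof -
  have "((\<lambda>x. (x, y)) has_derivative (\<lambda>u. (u, 0))) (at x)"
    by (intro has_derivative_Pair has_derivative_ident has_derivative_const)
  from has_derivative_compose[of "\<lambda>x. (x, y)", OF this assms] show ?thesis .
qed

lemma partial_y_has_derivative:
  assumes "(F has_derivative F') (at (x, y))"
  shows "((\<lambda>y. F (x, y)) has_derivative (\<lambda>v. F' (0, v))) (at y)"
proof -
  have "((\<lambda>y. (x, y)) has_derivative (\<lambda>v. (0, v))) (at y)"
    by (intro has_derivative_Pair has_derivative_ident has_derivative_const)
  from has_derivative_compose[of "\<lambda>y. (x, y)", OF this assms] show ?thesis .
qed

lemma dx_has_derivative:
  assumes "case_prod h differentiable (at (x, y))"
  shows "((\<lambda>x. h x y) has_derivative (\<lambda>v. inner (dx h x y) v)) (at x)"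
  unfolding dx_def using assms partial_x_has_derivative[of "case_prod h"]
  by (intro grad_has_derivative) (auto simp: differentiable_def)

lemma dy_has_derivative:
  assumes "case_prod h differentiable (at (x, y))"
  shows "(h x has_derivative (\<lambda>v. inner (dy h x y) v)) (at y)"
  unfolding dy_def using assms partial_y_has_derivative[of "case_prod h"]
  by (intro grad_has_derivative) (auto simp: differentiable_def)

text \<open>The total derivative is linear, hence the sum of its values on \<open>(u, 0)\<close> and
  \<open>(0, v)\<close>; uniqueness of derivatives identifies these with the two partial
  gradients.\<close>

lemma nabla_has_derivative:
  assumes "case_prod h differentiable (at (x, y))"
  shows "(case_prod h has_derivative (\<lambda>v. inner (nabla h x y) v)) (at (x, y))"
proof -
  obtain F' where F': "(case_prod h has_derivative F') (at (x, y))"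
    using assms by (auto simp: differentiable_def)
  have 1: "F' (u, 0) = inner (dx h x y) u" for u
    using has_derivative_unique[OF partial_x_has_derivative[OF F']] dx_has_derivative[OF assms]
    by (simp add: fun_eq_iff)
  have 2: "F' (0, v) = inner (dy h x y) v" for v
    using has_derivative_unique[OF partial_y_has_derivative[OF F']] dy_has_derivative[OF assms]
    by (simp add: fun_eq_iff)
  have "F' w = inner (nabla h x y) w" for w
    using linear_add[OF has_derivative_linear[OF F'], of "(fst w, 0)" "(0, snd w)"] 1 2
    by (simp add: nabla_def inner_prod_def)
  then have "F' = (\<lambda>w. inner (nabla h x y) w)" by blast
  with F' show ?thesis by simp
qed

text \<open>The row index of \<open>dxy\<close> and \<open>dyy\<close> is the direction of
  differentiation, so the derivative multiplies these matrices by a row vector from the left. The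
  matrices acting on column vectors are therefore the transposes of the derivatives, which is why
  duality arguments recur below.\<close>

lemma dy_has_total_derivative:
  assumes "twice_differentiable h"
  shows "(case_prod (dy h) has_derivative (\<lambda>(u, v). u v* dxy h x y + v v* dyy h x y)) (at (x, y))"
proof -
  obtain F where F: "(case_prod (nabla h) has_derivative F) (at (x, y))"
    using assms unfolding differentiable_def twice_differentiable_def by blast
  have D: "(case_prod (dy h) has_derivative (\<lambda>w. snd (F w))) (at (x, y))"
    using has_derivative_snd[OF F] by (simp add: nabla_def case_prod_unfold)
  have 1: "((\<lambda>x'. dy h x' y $ j) has_derivative (\<lambda>u. snd (F (u, 0)) $ j)) (at x)" for j
    using bounded_linear.has_derivative[OF bounded_linear_vec_nth partial_x_has_derivative[OF D]] by simp
  have 2: "((\<lambda>y'. dy h x y' $ j) has_derivative (\<lambda>v. snd (F (0, v)) $ j)) (at y)" for j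
    using bounded_linear.has_derivative[OF bounded_linear_vec_nth partial_y_has_derivative[OF D]] by simp
  have a: "snd (F (u, 0)) = u v* dxy h x y" for u
  proof -
    have "snd (F (u, 0)) $ j = inner (\<chi> i. snd (F (axis i 1, 0)) $ j) u" for j
      by (rule linear_eq_inner_axis[OF has_derivative_linear[OF 1]])
    then show ?thesis using frechet_derivative_at[OF 1, symmetric]
      by (simp add: vec_eq_iff vector_matrix_mult_def dxy_def inner_vec_def mult.commute)
  qed
  have b: "snd (F (0, v)) = v v* dyy h x y" for v
  proof -
    have "snd (F (0, v)) $ j = inner (\<chi> i. snd (F (0, axis i 1)) $ j) v" for j
      by (rule linear_eq_inner_axis[OF has_derivative_linear[OF 2]])
    then show ?thesis using frechet_derivative_at[OF 2, symmetric]
      by (simp add: vec_eq_iff vector_matrix_mult_def dyy_def inner_vec_def mult.commute)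
  qed
  have "snd (F w) = (case w of (u, v) \<Rightarrow> u v* dxy h x y + v v* dyy h x y)" for w
    using linear_add[OF has_derivative_linear[OF D], of "(fst w, 0)" "(0, snd w)"] a b
    by (simp add: case_prod_unfold)
  then have "(\<lambda>w. snd (F w)) = (\<lambda>(u, v). u v* dxy h x y + v v* dyy h x y)" by blast
  with D show ?thesis by simp
qed

lemma op_norm_bound: "norm (A *v w) \<le> op_norm A * norm w"
  unfolding op_norm_def by (rule onorm[OF matrix_vector_mul_bounded_linear])

section \<open>The bilevel problem\<close>

text \<open>The factor common to \<open>L_z\<close>, \<open>L_psi\<close> and
  \<open>L_outer\<close>. It arises when the variation of the gradient of \<open>f\<close> is added
  to that of the second derivatives of \<open>g\<close>, the latter applied to a vector of length at
  most \<open>Bf p / mug p\<close>.\<close>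

definition lam :: "bilevel_consts \<Rightarrow> real" where
  "lam p = Lf p + Mg p * Bf p / mug p"

lemma L_z_eq: "mug p \<noteq> 0 \<Longrightarrow> L_z p = lam p / mug p"
  by (simp add: L_z_def lam_def power2_eq_square field_simps)

lemma L_outer_eq: "mug p \<noteq> 0 \<Longrightarrow> L_outer p = lam p * (1 + L_y p)\<^sup>2"
  by (simp add: L_outer_def lam_def L_y_def power2_eq_square field_simps)

lemma L_psi_eq: "mug p \<noteq> 0 \<Longrightarrow> L_psi p = max (lam p * (1 + L_y p)) (Lg' p)"
proof -
  assume "mug p \<noteq> 0"
  then have "Lf p + Mg p * Bf p / mug p + Lg' p * L_z p = lam p * (1 + L_y p)"
    by (simp add: L_z_eq) (simp add: lam_def L_y_def field_simps)
  then show ?thesis by (simp add: L_psi_def)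
qed

lemma matrix_mult_inv_right:
  assumes "invertible A"
  shows "A ** matrix_inv A = mat 1"
  using someI_ex[OF assms[unfolded invertible_def]] by (simp add: matrix_inv_def)

lemma norm_mult_cancel:
  fixes a :: "'a::real_normed_vector"
  assumes "norm a * b \<le> norm a * c" and "a = 0 \<Longrightarrow> b \<le> c"
  shows "b \<le> c"
  using assms by (cases "a = 0") (simp_all add: mult_le_cancel_left_pos)

lemma norm_Pair_le_sum: "norm (a, b) \<le> norm a + norm b"
  by (simp add: norm_Pair sqrt_sum_squares_le_sum)

text \<open>\<open>zstar\<close> with a free right-hand side: the exact solution that the loop for
  \<open>z\<close> approaches when it is run with a sampled gradient \<open>v\<close>.\<close>

definition zsol :: "(real^'x \<Rightarrow> real^'y \<Rightarrow> real) \<Rightarrow> real^'x \<Rightarrow> real^'y \<Rightarrow> real^'y \<Rightarrow> real^'y" where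
  "zsol g x y v = - (matrix_inv (dyy g x y) *v v)"

text \<open>The hypergradient formula with \<open>y\<close> left free. At
  \<open>y = ystar g x\<close> it is the gradient of the outer objective
  (\<open>grad_outer\<close>); at the computed \<open>y\<close> it is the quantity that the
  algorithm estimates.\<close>

definition psi ::
    "(real^'x \<Rightarrow> real^'y \<Rightarrow> real) \<Rightarrow> (real^'x \<Rightarrow> real^'y \<Rightarrow> real) \<Rightarrow> real^'x \<Rightarrow> real^'y \<Rightarrow> real^'x" where
  "psi f g x y = dx f x y + dxy g x y *v zstar f g x y"

lemma zstar_eq_zsol: "zstar f g x y = zsol g x y (dy f x y)"
  by (simp add: zstar_def zsol_def)

context stochastic_bilevel
begin

lemma g_differentiable: "case_prod g differentiable (at q)"
  using g_twice_differentiable unfolding twice_differentiable_def by blast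

sublocale ssc: smooth_strongly_convex "g x" "dy g x" "mug p" "Lg p" for x
  using g_smooth g_strongly_convex consts_pos dy_has_derivative[OF g_differentiable]
  by unfold_locales auto

lemma Lg_pos: "0 < Lg p"
  by (rule ssc.L_pos)

lemma kappa_g_ge_1: "1 \<le> kappa_g p"
  unfolding kappa_g_def using ssc.m_le_L consts_pos by simp

lemma lam_pos: "0 < lam p"
proof (cases "Lf p = 0")
  case True
  then have "0 < Mg p * Bf p" using consts_pos by simp
  then show ?thesis using consts_pos consts_nonneg by (simp add: lam_def add_nonneg_pos)
next
  case False
  then have "0 < Lf p" using consts_nonneg by simp
  then show ?thesis unfolding lam_def using consts_pos consts_nonneg by (intro add_pos_nonneg) auto
qed

lemma L_y_pos: "0 < L_y p"
  using consts_pos by (simp add: L_y_def)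

lemma L_z_pos: "0 < L_z p"
  using lam_pos consts_pos by (simp add: L_z_eq)

lemma L_outer_pos: "0 < L_outer p"
  using lam_pos L_y_pos consts_pos by (simp add: L_outer_eq)

lemma L_psi_ge: "lam p * (1 + L_y p) \<le> L_psi p" "Lg' p \<le> L_psi p"
  using consts_pos by (auto simp: L_psi_eq)

lemma L_psi_pos: "0 < L_psi p"
  using L_psi_ge(2) consts_pos by linarith

lemma dy_g_ystar: "dy g x (ystar g x) = 0"
  unfolding ystar_def by (rule ssc.D_arg_min)

lemma dyy_has_derivative: "(dy g x has_derivative (\<lambda>v. v v* dyy g x y)) (at y)"
  using partial_y_has_derivative[OF dy_has_total_derivative[OF g_twice_differentiable]] by simp

lemma dxy_has_derivative: "((\<lambda>x. dy g x y) has_derivative (\<lambda>u. u v* dxy g x y)) (at x)"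
  using partial_x_has_derivative[OF dy_has_total_derivative[OF g_twice_differentiable]] by simp

lemma dyy_lower: "mug p * (norm w)\<^sup>2 \<le> inner w (dyy g x y *v w)"
  using ssc.hessian_lower[OF dyy_has_derivative, of w x y] by (simp add: dot_lmul_matrix)

text \<open>Coercivity and Cauchy-Schwarz. Both the invertibility of the Hessian and the bound
  \<open>1 / mug p\<close> for its inverse are read off from here.\<close>

lemma dyy_norm_lower: "mug p * norm w \<le> norm (dyy g x y *v w)"
proof (cases "w = 0")
  case False
  have "(mug p * norm w) * norm w \<le> norm (dyy g x y *v w) * norm w"
    using order_trans[OF dyy_lower[of w x y] norm_cauchy_schwarz]
    by (simp add: power2_eq_square mult_ac)
  then show ?thesis using False by simp
qed simp

lemma invertible_dyy: "invertible (dyy g x y)"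
proof -
  have "w = 0" if "dyy g x y *v w = 0" for w
    using dyy_norm_lower[of w x y] that consts_pos by (simp add: mult_le_0_iff)
  then show ?thesis
    using matrix_left_invertible_ker invertible_left_inverse by metis
qed

lemma dyy_zsol: "dyy g x y *v zsol g x y v = - v"
  using matrix_mult_inv_right[OF invertible_dyy, of x y]
  by (simp add: zsol_def matrix_vector_mul_assoc
        linear_neg[OF matrix_vector_mul_linear])

lemma norm_zsol: "norm (zsol g x y v) \<le> norm v / mug p"
  using dyy_norm_lower[of "zsol g x y v" x y] consts_pos
  by (simp add: dyy_zsol pos_le_divide_eq mult.commute)

text \<open>A resolvent identity: the Hessian at \<open>(x, y)\<close>, applied to the difference of
  the two solutions, leaves the change of the right-hand side and the change of the Hessian acting
  on the second solution.\<close>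

lemma zsol_lipschitz:
  "norm (zsol g x y v - zsol g x' y' v')
    \<le> (norm (v - v') + Mg p * dist (x, y) (x', y') * norm (zsol g x' y' v')) / mug p"
proof -
  let ?z = "zsol g x y v" and ?z' = "zsol g x' y' v'"
  have "dyy g x y *v (?z - ?z') = - (v - v') - (dyy g x y - dyy g x' y') *v ?z'"
    by (simp add: matrix_vector_mult_diff_distrib matrix_vector_mult_diff_rdistrib dyy_zsol)
  then have "norm (dyy g x y *v (?z - ?z')) \<le> norm (v - v') + norm ((dyy g x y - dyy g x' y') *v ?z')"
    by (metis norm_minus_cancel norm_triangle_ineq4)
  also have "norm ((dyy g x y - dyy g x' y') *v ?z') \<le> Mg p * dist (x, y) (x', y') * norm ?z'"
    by (rule order_trans[OF op_norm_bound mult_right_mono[OF dyy_g_lipschitz]]) simp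
  finally have "mug p * norm (?z - ?z') \<le> norm (v - v') + Mg p * dist (x, y) (x', y') * norm ?z'"
    using dyy_norm_lower[of "?z - ?z'" x y] by simp
  then show ?thesis using consts_pos by (simp add: pos_le_divide_eq mult.commute)
qed

lemma zsol_diff: "norm (zsol g x y v - zsol g x y v') \<le> norm (v - v') / mug p"
  using zsol_lipschitz[of x y v x y v'] by simp

text \<open>\<open>dyy g x y\<close> is the transpose of the derivative of \<open>dy g x\<close>, so cocoercivity bounds the
  transposed matrix; its operator norm is the same.\<close>

lemma hessian_step_contraction:
  defines "\<beta> \<equiv> 1 / (2 * Lg p)"
  shows "(norm (w - \<beta> *\<^sub>R (dyy g x y *v w)))\<^sup>2 \<le> (1 - 3 / 2 * \<beta> * mug p) * (norm w)\<^sup>2"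
proof -
  let ?H = "dyy g x y"
  have "(norm (u - \<beta> *\<^sub>R (u v* ?H)))\<^sup>2 \<le> (1 - 3 / 2 * \<beta> * mug p) * (norm u)\<^sup>2" for u
  proof -
    have "(norm (u - \<beta> *\<^sub>R (u v* ?H)))\<^sup>2
        = (norm u)\<^sup>2 - 2 * \<beta> * inner (u v* ?H) u + \<beta>\<^sup>2 * (norm (u v* ?H))\<^sup>2"
      by (simp only: power2_norm_eq_inner)
        (simp add: inner_diff_left inner_diff_right inner_commute power2_eq_square)
    also have "\<dots> \<le> (norm u)\<^sup>2 - 2 * \<beta> * inner (u v* ?H) u + \<beta>\<^sup>2 * (Lg p * inner (u v* ?H) u)"
      using ssc.hessian_cocoercive[OF dyy_has_derivative, of u x y]
      by (intro add_left_mono mult_left_mono) auto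
    \<comment> \<open>\<open>\<beta> * Lg p = 1 / 2\<close>, so the quadratic term eats only a
      quarter of the linear one. The rate obtained is better than the \<open>\<beta> * mug p\<close>
      used later; the surplus pays for the noise of the Hessian batches.\<close>
    also have "\<dots> = (norm u)\<^sup>2 - 3 / 2 * \<beta> * inner (u v* ?H) u"
      using Lg_pos by (simp add: \<beta>_def power2_eq_square field_simps)
    also have "\<dots> \<le> (norm u)\<^sup>2 - 3 / 2 * \<beta> * (mug p * (norm u)\<^sup>2)"
      using ssc.hessian_lower[OF dyy_has_derivative, of u x y] Lg_pos
      by (intro diff_left_mono mult_left_mono) (auto simp: \<beta>_def)
    finally show ?thesis by (simp add: algebra_simps)
  qed
  moreover have "u - \<beta> *\<^sub>R (u v* ?H) = u v* (mat 1 - \<beta> *\<^sub>R ?H)" for u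
  proof -
    have "u v* (\<beta> *\<^sub>R ?H) = \<beta> *\<^sub>R (u v* ?H)"
      by (simp add: vec_eq_iff vector_matrix_mult_def sum_distrib_left mult_ac)
    then show ?thesis by (simp add: vector_matrix_mult_diff_rdistrib)
  qed
  moreover have "w - \<beta> *\<^sub>R (?H *v w) = (mat 1 - \<beta> *\<^sub>R ?H) *v w"
    by (simp add: matrix_vector_mult_diff_rdistrib scaleR_matrix_vector_assoc)
  ultimately show ?thesis
    using matrix_norm_le_transpose[of "mat 1 - \<beta> *\<^sub>R ?H" "1 - 3 / 2 * \<beta> * mug p" w] by simp
qed

lemma norm_zstar: "norm (zstar f g x y) \<le> Bf p / mug p"
  unfolding zstar_eq_zsol
  by (rule order_trans[OF norm_zsol divide_right_mono[OF dy_f_bounded]]) (use consts_pos in simp)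

lemma nabla_f_lipschitz:
  "norm (nabla f x y - nabla f x' y') \<le> Lf p * dist (x, y) (x', y')"
  using lipschitz_onD[OF f_smooth, of "(x, y)" "(x', y')"] by (simp add: dist_norm)

lemma dx_f_lipschitz: "norm (dx f x y - dx f x' y') \<le> Lf p * dist (x, y) (x', y')"
  by (rule order_trans[OF _ nabla_f_lipschitz])
    (use norm_fst_le[of "dx f x y - dx f x' y'" "dy f x y - dy f x' y'"] in \<open>simp add: nabla_def\<close>)

lemma dy_f_lipschitz: "norm (dy f x y - dy f x' y') \<le> Lf p * dist (x, y) (x', y')"
  by (rule order_trans[OF _ nabla_f_lipschitz])
    (use norm_snd_le[of "dy f x y - dy f x' y'" "dx f x y - dx f x' y'"] in \<open>simp add: nabla_def\<close>)

lemma zstar_lipschitz: "norm (zstar f g x y - zstar f g x' y') \<le> L_z p * dist (x, y) (x', y')"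
proof -
  let ?d = "dist (x, y) (x', y')"
  have "norm (zstar f g x y - zstar f g x' y')
      \<le> (norm (dy f x y - dy f x' y') + Mg p * ?d * norm (zstar f g x' y')) / mug p"
    using zsol_lipschitz[of x y "dy f x y" x' y' "dy f x' y'"] by (simp add: zstar_eq_zsol)
  also have "\<dots> \<le> (Lf p * ?d + Mg p * ?d * (Bf p / mug p)) / mug p"
    using consts_pos consts_nonneg
    by (intro divide_right_mono add_mono mult_left_mono dy_f_lipschitz norm_zstar) auto
  also have "\<dots> = L_z p * ?d"
    using consts_pos by (simp add: L_z_def power2_eq_square field_simps)
  finally show ?thesis .
qed

text \<open>The Lipschitz bound in \<open>x\<close> controls the derivative of \<open>dy g\<close>,
  that is the transposed matrix; testing with \<open>dxy g x y *v w\<close> carries the bound over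
  to the matrix itself.\<close>

lemma norm_dxy: "norm (dxy g x y *v w) \<le> Lg' p * norm w"
proof -
  have "norm (u v* dxy g x y) \<le> Lg' p * norm u" for u
  proof -
    have lim: "((\<lambda>t. norm ((dy g (x + t *\<^sub>R u) y - dy g x y) /\<^sub>R t)) \<longlongrightarrow> norm (u v* dxy g x y)) (at_right 0)"
      by (intro tendsto_intros has_derivative_difference_quotient[OF dxy_has_derivative])
    have "\<forall>\<^sub>F t in at_right 0. norm ((dy g (x + t *\<^sub>R u) y - dy g x y) /\<^sub>R t) \<le> Lg' p * norm u"
      unfolding eventually_at_right_field
    proof (intro exI[of _ 1] conjI allI impI)
      fix t :: real assume t: "0 < t" "t < 1"
      show "norm ((dy g (x + t *\<^sub>R u) y - dy g x y) /\<^sub>R t) \<le> Lg' p * norm u"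
        using dy_g_lipschitz_x[of "x + t *\<^sub>R u" y x] t by (simp add: divide_simps mult_ac)
    qed simp
    then show ?thesis by (intro tendsto_upperbound[OF lim]) simp_all
  qed
  note * = this
  let ?a = "dxy g x y *v w"
  have "norm ?a * norm ?a = inner (?a v* dxy g x y) w"
    by (simp add: dot_lmul_matrix power2_norm_eq_inner power2_eq_square[symmetric])
  also have "\<dots> \<le> norm (?a v* dxy g x y) * norm w" by (rule norm_cauchy_schwarz)
  also have "\<dots> \<le> (Lg' p * norm ?a) * norm w" by (intro mult_right_mono *) simp
  finally have "norm ?a * norm ?a \<le> norm ?a * (Lg' p * norm w)" by (simp add: mult_ac)
  then show ?thesis by (rule norm_mult_cancel) (use consts_pos in simp)
qed

text \<open>A product rule. The change of the Jacobian meets a value of \<open>zstar\<close>, which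
  is bounded; the change of \<open>zstar\<close> meets a Jacobian of norm at most
  \<open>Lg' p\<close>.\<close>

lemma psi_lipschitz: "norm (psi f g x y - psi f g x' y') \<le> L_psi p * dist (x, y) (x', y')"
proof -
  let ?d = "dist (x, y) (x', y')" and ?z = "zstar f g x y" and ?z' = "zstar f g x' y'"
  have eq: "psi f g x y - psi f g x' y' = (dx f x y - dx f x' y') + (dxy g x y *v (?z - ?z')
      + (dxy g x y - dxy g x' y') *v ?z')"
    by (simp add: psi_def matrix_vector_mult_diff_distrib matrix_vector_mult_diff_rdistrib)
  have "norm (psi f g x y - psi f g x' y')
      \<le> norm (dx f x y - dx f x' y') + (norm (dxy g x y *v (?z - ?z'))
        + norm ((dxy g x y - dxy g x' y') *v ?z'))"
    unfolding eq by (intro order_trans[OF norm_triangle_ineq] add_left_mono norm_triangle_ineq)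
  also have "\<dots> \<le> Lf p * ?d + (Lg' p * (L_z p * ?d) + Mg p * ?d * (Bf p / mug p))"
  proof (intro add_mono)
    show "norm (dx f x y - dx f x' y') \<le> Lf p * ?d" by (rule dx_f_lipschitz)
    show "norm (dxy g x y *v (?z - ?z')) \<le> Lg' p * (L_z p * ?d)"
      using consts_pos by (intro order_trans[OF norm_dxy] mult_left_mono zstar_lipschitz) simp
    have "norm ((dxy g x y - dxy g x' y') *v ?z') \<le> Mg p * ?d * norm ?z'"
      by (intro order_trans[OF op_norm_bound] mult_right_mono dxy_g_lipschitz) simp
    also have "\<dots> \<le> Mg p * ?d * (Bf p / mug p)"
      using consts_nonneg by (intro mult_left_mono norm_zstar) simp
    finally show "norm ((dxy g x y - dxy g x' y') *v ?z') \<le> Mg p * ?d * (Bf p / mug p)" .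
  qed
  also have "\<dots> = (Lf p + Mg p * Bf p / mug p + Lg' p * L_z p) * ?d"
    by (simp add: algebra_simps)
  also have "\<dots> \<le> L_psi p * ?d" by (intro mult_right_mono) (auto simp: L_psi_def)
  finally show ?thesis .
qed

text \<open>Strong monotonicity of \<open>dy g x'\<close> between the two minimisers. Since each
  gradient vanishes at its own minimiser, the gradient difference is a change of \<open>x\<close>
  alone, at the fixed point \<open>ystar g x\<close>.\<close>

lemma ystar_lipschitz: "norm (ystar g x - ystar g x') \<le> L_y p * norm (x - x')"
proof -
  let ?y = "ystar g x" and ?y' = "ystar g x'"
  have "mug p * (norm (?y - ?y'))\<^sup>2 \<le> inner (dy g x' ?y - dy g x' ?y') (?y - ?y')"
    by (rule ssc.strongly_monotone)
  also have "dy g x' ?y - dy g x' ?y' = dy g x' ?y - dy g x ?y" by (simp add: dy_g_ystar)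
  also have "inner \<dots> (?y - ?y') \<le> norm \<dots> * norm (?y - ?y')" by (rule norm_cauchy_schwarz)
  also have "\<dots> \<le> (Lg' p * norm (x - x')) * norm (?y - ?y')"
    using dy_g_lipschitz_x[of x' ?y x] by (intro mult_right_mono) (simp_all add: norm_minus_commute)
  finally have "norm (?y - ?y') * (mug p * norm (?y - ?y')) \<le> norm (?y - ?y') * (Lg' p * norm (x - x'))"
    by (simp add: power2_eq_square mult_ac)
  then have "mug p * norm (?y - ?y') \<le> Lg' p * norm (x - x')"
    by (rule norm_mult_cancel) (use consts_pos in simp)
  then show ?thesis using consts_pos by (simp add: L_y_def field_simps)
qed

lemma zstar_ystar_lipschitz:
  "norm (zstar f g x (ystar g x) - zstar f g x' (ystar g x')) \<le> L_z p * (1 + L_y p) * norm (x - x')"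
proof -
  have "dist (x, ystar g x) (x', ystar g x') \<le> norm (x - x') + norm (ystar g x - ystar g x')"
    by (simp add: dist_norm norm_Pair_le_sum)
  also have "\<dots> \<le> (1 + L_y p) * norm (x - x')" using ystar_lipschitz[of x x'] by (simp add: algebra_simps)
  finally have "L_z p * dist (x, ystar g x) (x', ystar g x') \<le> L_z p * ((1 + L_y p) * norm (x - x'))"
    using L_z_pos by (intro mult_left_mono) auto
  then show ?thesis using zstar_lipschitz[of x "ystar g x" x' "ystar g x'"] by (simp add: mult_ac)
qed

section \<open>The outer objective and its gradient\<close>

lemma f_quadratic_bound:
  "\<bar>f (x + u) (y + v) - f x y - (inner (dx f x y) u + inner (dy f x y) v)\<bar> \<le> Lf p * (norm (u, v))\<^sup>2 / 2"
proof -
  let ?D = "\<lambda>t. nabla f (x + t *\<^sub>R u) (y + t *\<^sub>R v)"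
  let ?\<phi> = "\<lambda>t. case_prod f ((x, y) + t *\<^sub>R (u, v))"
  have "\<bar>?\<phi> 1 - ?\<phi> 0 - inner (?D 0) (u, v)\<bar> \<le> Lf p * (norm (u, v))\<^sup>2 / 2"
  proof (rule taylor_quadratic_bound)
    fix t :: real
    have "(case_prod f has_derivative (\<lambda>w. inner (?D t) w)) (at ((x, y) + t *\<^sub>R (u, v)))"
      using nabla_has_derivative[OF f_differentiable, of "x + t *\<^sub>R u" "y + t *\<^sub>R v"] by simp
    from has_derivative_along_line[OF this]
    show "(?\<phi> has_real_derivative inner (?D t) (u, v)) (at t)"
      by (simp add: has_real_derivative_iff_has_vector_derivative)
    assume t: "0 \<le> t" "t \<le> 1"
    have "\<bar>inner (?D t - ?D 0) (u, v)\<bar> \<le> norm (?D t - ?D 0) * norm (u, v)"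
      by (rule Cauchy_Schwarz_ineq2)
    also have "\<dots> \<le> Lf p * dist (x + t *\<^sub>R u, y + t *\<^sub>R v) (x, y) * norm (u, v)"
      using nabla_f_lipschitz[of "x + t *\<^sub>R u" "y + t *\<^sub>R v" x y] by (intro mult_right_mono) auto
    also have "dist (x + t *\<^sub>R u, y + t *\<^sub>R v) (x, y) = t * norm (u, v)"
      using t norm_scaleR[of t "(u, v)"] by (simp add: dist_norm)
    finally show "\<bar>inner (?D t) (u, v) - inner (?D 0) (u, v)\<bar> \<le> Lf p * (norm (u, v))\<^sup>2 * t"
      using t by (simp only: inner_diff_left) (simp add: power2_eq_square mult_ac)
  qed
  then show ?thesis by (simp add: nabla_def)
qed

text \<open>First-order expansion of \<open>dy g\<close>, tested with \<open>w\<close>. Along the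
  segment each of the two matrices changes by at most \<open>Mg p * t * norm (u, v)\<close>, hence
  the mixed factor \<open>norm u + norm v\<close>.\<close>

lemma dy_g_quadratic_bound:
  "\<bar>inner (dy g (x + u) (y + v) - dy g x y) w - (inner u (dxy g x y *v w) + inner v (dyy g x y *v w))\<bar>
     \<le> Mg p * norm (u, v) * (norm u + norm v) * norm w / 2"
proof -
  let ?A = "\<lambda>t. dxy g (x + t *\<^sub>R u) (y + t *\<^sub>R v)" and ?B = "\<lambda>t. dyy g (x + t *\<^sub>R u) (y + t *\<^sub>R v)"
  let ?\<phi> = "\<lambda>t. inner (case_prod (dy g) ((x, y) + t *\<^sub>R (u, v))) w"
  let ?\<phi>' = "\<lambda>t. inner (u v* ?A t + v v* ?B t) w"
  have "\<bar>?\<phi> 1 - ?\<phi> 0 - ?\<phi>' 0\<bar> \<le> Mg p * norm (u, v) * (norm u + norm v) * norm w / 2"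
  proof (rule taylor_quadratic_bound)
    fix t :: real
    have "(case_prod (dy g) has_derivative (\<lambda>(u, v). u v* ?A t + v v* ?B t)) (at ((x, y) + t *\<^sub>R (u, v)))"
      using dy_has_total_derivative[OF g_twice_differentiable, of "x + t *\<^sub>R u" "y + t *\<^sub>R v"] by simp
    from bounded_linear.has_vector_derivative[OF bounded_linear_inner_left has_derivative_along_line[OF this]]
    show "(?\<phi> has_real_derivative ?\<phi>' t) (at t)"
      by (simp add: has_real_derivative_iff_has_vector_derivative)
    assume t: "0 \<le> t" "t \<le> 1"
    have d: "dist (x + t *\<^sub>R u, y + t *\<^sub>R v) (x, y) = t * norm (u, v)"
      using t norm_scaleR[of t "(u, v)"] by (simp add: dist_norm)
    have "?\<phi>' t - ?\<phi>' 0 = inner u ((?A t - ?A 0) *v w) + inner v ((?B t - ?B 0) *v w)"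
      by (simp add: inner_add_left dot_lmul_matrix matrix_vector_mult_diff_rdistrib inner_diff_right)
    also have "\<bar>\<dots>\<bar> \<le> norm u * norm ((?A t - ?A 0) *v w) + norm v * norm ((?B t - ?B 0) *v w)"
      by (intro order_trans[OF abs_triangle_ineq] add_mono Cauchy_Schwarz_ineq2)
    also have "\<dots> \<le> norm u * (Mg p * (t * norm (u, v)) * norm w) + norm v * (Mg p * (t * norm (u, v)) * norm w)"
      unfolding d[symmetric]
      by (intro add_mono mult_left_mono order_trans[OF op_norm_bound] mult_right_mono)
        (use dxy_g_lipschitz[of "x + t *\<^sub>R u" "y + t *\<^sub>R v" x y]
            dyy_g_lipschitz[of "x + t *\<^sub>R u" "y + t *\<^sub>R v" x y] in auto)
    also have "\<dots> = Mg p * norm (u, v) * (norm u + norm v) * norm w * t"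
      by (simp only: distrib_left distrib_right mult_ac)
    finally show "\<bar>?\<phi>' t - ?\<phi>' 0\<bar> \<le> Mg p * norm (u, v) * (norm u + norm v) * norm w * t" .
  qed
  then show ?thesis by (simp add: inner_diff_left inner_add_left dot_lmul_matrix)
qed

text \<open>Testing the stationarity of \<open>ystar\<close> with the multiplier \<open>zstar\<close> removes the derivative of
  \<open>ystar\<close> from the expansion.\<close>

lemma outer_quadratic_bound:
  "\<bar>outer_obj f g (x + u) - outer_obj f g x - inner (psi f g x (ystar g x)) u\<bar>
     \<le> L_outer p / 2 * (norm u)\<^sup>2"
proof -
  define y v w where "y = ystar g x" and "v = ystar g (x + u) - y" and "w = zstar f g x y"
  have y': "ystar g (x + u) = y + v" by (simp add: v_def)
  have v: "norm v \<le> L_y p * norm u" using ystar_lipschitz[of "x + u" x] by (simp add: v_def y_def)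
  have uv: "norm u + norm v \<le> (1 + L_y p) * norm u" using v by (simp add: algebra_simps)
  have nuv: "norm (u, v) \<le> (1 + L_y p) * norm u" using norm_Pair_le_sum uv by (rule order_trans)
  have pos: "0 \<le> (1 + L_y p) * norm u" using L_y_pos by simp
  have "dy g (x + u) (y + v) = 0" "dy g x y = 0"
    using dy_g_ystar[of "x + u"] dy_g_ystar[of x] by (simp_all add: y' y_def)
  then have 1: "\<bar>inner u (dxy g x y *v w) + inner v (dyy g x y *v w)\<bar>
      \<le> Mg p * norm (u, v) * (norm u + norm v) * norm w / 2"
    using dy_g_quadratic_bound[of x u y v w]
    by (simp only: diff_self inner_zero_left diff_0 abs_minus_cancel)
  have 2: "dyy g x y *v w = - dy f x y" by (simp add: w_def zstar_eq_zsol dyy_zsol)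
  have "outer_obj f g (x + u) - outer_obj f g x - inner (psi f g x y) u
      = (f (x + u) (y + v) - f x y - (inner (dx f x y) u + inner (dy f x y) v))
        - (inner u (dxy g x y *v w) + inner v (dyy g x y *v w))"
    unfolding outer_obj_def y' y_def[symmetric] 2
    by (simp add: psi_def w_def[symmetric] inner_add_left inner_add_right inner_commute)
  also have "\<bar>\<dots>\<bar> \<le> Lf p * (norm (u, v))\<^sup>2 / 2 + Mg p * norm (u, v) * (norm u + norm v) * norm w / 2"
    by (intro order_trans[OF abs_triangle_ineq4] add_mono f_quadratic_bound 1)
  \<comment> \<open>Both remainders become \<open>(1 + L_y p)\<^sup>2 * (norm u)\<^sup>2 / 2\<close>
    times a coefficient, and the coefficients \<open>Lf p\<close> and
    \<open>Mg p * Bf p / mug p\<close> add up to \<open>lam p\<close>.\<close>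
  also have "\<dots> \<le> Lf p * ((1 + L_y p) * norm u)\<^sup>2 / 2
      + Mg p * ((1 + L_y p) * norm u) * ((1 + L_y p) * norm u) * (Bf p / mug p) / 2"
    using consts_nonneg consts_pos pos norm_zstar[of x y]
    by (intro add_mono divide_right_mono mult_mono power_mono nuv uv mult_left_mono)
      (auto simp: w_def)
  also have "\<dots> = L_outer p / 2 * (norm u)\<^sup>2"
    using consts_pos by (simp add: L_outer_eq lam_def power2_eq_square field_simps)
  finally show ?thesis by (simp add: y_def)
qed

text \<open>A two-sided quadratic error is all that a Frechet derivative asks for, so the chain rule
  through \<open>ystar\<close>, and with it the implicit function theorem, is bypassed.\<close>

lemma outer_has_derivative:
  "(outer_obj f g has_derivative (\<lambda>u. inner (psi f g x (ystar g x)) u)) (at x)"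
  unfolding has_derivative_at
proof
  let ?G = "psi f g x (ystar g x)"
  show "bounded_linear (\<lambda>u. inner ?G u)" by (rule bounded_linear_inner_right)
  show "(\<lambda>u. norm (outer_obj f g (x + u) - outer_obj f g x - inner ?G u) / norm u) \<midarrow>0\<rightarrow> 0"
  proof (rule tendsto_sandwich[OF always_eventually always_eventually tendsto_const])
    show "((\<lambda>u::real^'x. L_outer p / 2 * norm u) \<longlongrightarrow> 0) (at 0)"
      by (intro tendsto_mult_right_zero tendsto_norm_zero tendsto_ident_at)
    show "\<forall>u. norm (outer_obj f g (x + u) - outer_obj f g x - inner ?G u) / norm u \<le> L_outer p / 2 * norm u"
      using outer_quadratic_bound[of x] by (auto simp: divide_le_eq power2_eq_square mult_ac)
  qed simp
qed

lemma grad_outer: "grad (outer_obj f g) x = psi f g x (ystar g x)"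
  by (rule grad_eqI[OF outer_has_derivative])

lemma outer_descent:
  "outer_obj f g (x + u) \<le> outer_obj f g x + inner (grad (outer_obj f g) x) u + L_outer p / 2 * (norm u)\<^sup>2"
  using outer_quadratic_bound[of x u] unfolding grad_outer abs_le_iff by (simp add: field_simps)

text \<open>Completing the square: for the step \<open>1 / L_outer p\<close> the linear and the
  quadratic term combine to the squared error of \<open>w\<close> minus the squared
  gradient.\<close>

lemma outer_step:
  "outer_obj f g (x - (1 / L_outer p) *\<^sub>R w) \<le> outer_obj f g x
     - (norm (grad (outer_obj f g) x))\<^sup>2 / (2 * L_outer p)
     + (norm (w - grad (outer_obj f g) x))\<^sup>2 / (2 * L_outer p)"
proof -
  let ?G = "grad (outer_obj f g) x" and ?L = "L_outer p"
  have "outer_obj f g (x + - (1 / ?L) *\<^sub>R w)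
      \<le> outer_obj f g x + inner ?G (- (1 / ?L) *\<^sub>R w) + ?L / 2 * (norm (- (1 / ?L) *\<^sub>R w))\<^sup>2"
    by (rule outer_descent)
  also have "inner ?G (- (1 / ?L) *\<^sub>R w) = - (2 * inner ?G w) / (2 * ?L)" by simp
  also have "?L / 2 * (norm (- (1 / ?L) *\<^sub>R w))\<^sup>2 = (norm w)\<^sup>2 / (2 * ?L)"
    using L_outer_pos by (simp add: power_mult_distrib power2_eq_square)
  finally have "outer_obj f g (x - (1 / ?L) *\<^sub>R w)
      \<le> outer_obj f g x + - (2 * inner ?G w) / (2 * ?L) + (norm w)\<^sup>2 / (2 * ?L)" by simp
  moreover have "(norm (w - ?G))\<^sup>2 = (norm w)\<^sup>2 - 2 * inner ?G w + (norm ?G)\<^sup>2"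
    by (simp add: power2_norm_eq_inner inner_diff_left inner_diff_right inner_commute)
  ultimately show ?thesis by (simp add: add_divide_distrib diff_divide_distrib)
qed

text \<open>An exact gradient step cannot fall below the infimum. Integrability of the squared
  gradient is drawn from that of the objective in this way.\<close>

lemma norm_grad_outer_le:
  assumes "bdd_below (range (outer_obj f g))"
  shows "(norm (grad (outer_obj f g) x))\<^sup>2 \<le> 2 * L_outer p * (outer_obj f g x - outer_inf f g)"
proof -
  have "outer_inf f g \<le> outer_obj f g (x - (1 / L_outer p) *\<^sub>R grad (outer_obj f g) x)"
    unfolding outer_inf_def by (rule cINF_lower[OF assms]) simp
  also have "\<dots> \<le> outer_obj f g x - (norm (grad (outer_obj f g) x))\<^sup>2 / (2 * L_outer p)"
    using outer_step[of x "grad (outer_obj f g) x"] by simp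
  finally show ?thesis using L_outer_pos by (simp add: field_simps)
qed

section \<open>Continuity of the exact solutions, for measurability\<close>

lemma continuous_ystar: "continuous_on UNIV (ystar g)"
proof (rule lipschitz_on_continuous_on)
  show "(L_y p)-lipschitz_on UNIV (ystar g)"
    using ystar_lipschitz L_y_pos by (intro lipschitz_onI) (auto simp: dist_norm)
qed

lemma continuous_psi: "continuous_on UNIV (case_prod (psi f g))"
proof (rule lipschitz_on_continuous_on)
  show "(L_psi p)-lipschitz_on UNIV (case_prod (psi f g))"
    using psi_lipschitz consts_pos by (intro lipschitz_onI) (auto simp: dist_norm[of "psi f g _ _"] L_psi_def)
qed

lemma continuous_zstar: "continuous_on UNIV (case_prod (zstar f g))"
proof (rule lipschitz_on_continuous_on)
  show "(L_z p)-lipschitz_on UNIV (case_prod (zstar f g))"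
    using zstar_lipschitz L_z_pos by (intro lipschitz_onI) (auto simp: dist_norm[of "zstar f g _ _"])
qed

lemma continuous_grad_outer: "continuous_on UNIV (grad (outer_obj f g))"
proof -
  have "continuous_on UNIV (\<lambda>x. case_prod (psi f g) (x, ystar g x))"
    by (rule continuous_on_compose2[OF continuous_psi]) (auto intro!: continuous_intros continuous_ystar)
  then show ?thesis by (simp add: grad_outer[abs_def])
qed

lemma continuous_outer: "continuous_on UNIV (outer_obj f g)"
  by (rule has_derivative_continuous_on) (rule has_derivative_at_withinI[OF outer_has_derivative])

text \<open>The estimate of \<open>zsol_lipschitz\<close> contains the size of one solution and is
  not uniform; with that solution taken at the limit point it still tends to 0.\<close>

lemma continuous_zsol: "continuous_on UNIV (\<lambda>(x, y, v). zsol g x y v)"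
  unfolding continuous_on_eq_continuous_at[OF open_UNIV] isCont_def
proof safe
  fix x' y' v'
  let ?b = "\<lambda>q. (norm (snd (snd q) - v') + Mg p * dist (fst q, fst (snd q)) (x', y') * norm (zsol g x' y' v')) / mug p"
  have "(?b \<longlongrightarrow> (norm (snd (snd (x', y', v')) - v') + Mg p * dist (fst (x', y', v'), fst (snd (x', y', v'))) (x', y')
       * norm (zsol g x' y' v')) / mug p) (at (x', y', v'))"
    using consts_pos by (intro tendsto_intros) auto
  then have lim: "(?b \<longlongrightarrow> 0) (at (x', y', v'))" by simp
  have "((\<lambda>q. (case q of (x, y, v) \<Rightarrow> zsol g x y v) - zsol g x' y' v') \<longlongrightarrow> 0) (at (x', y', v'))"
    by (rule Lim_null_comparison[OF always_eventually lim]) (auto intro: zsol_lipschitz)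
  then show "(\<lambda>(x, y, v). zsol g x y v) \<midarrow>(x', y', v')\<rightarrow> zsol g x' y' v'"
    by (simp add: LIM_zero_iff)
qed

end

section \<open>Mini-batches\<close>

lemma borel_measurable_vecI:
  fixes F :: "'w \<Rightarrow> 'a::euclidean_space^'n"
  assumes "\<And>i. (\<lambda>w. F w $ i) \<in> borel_measurable N"
  shows "F \<in> borel_measurable N"
  unfolding borel_measurable_euclidean_space[of F]
proof
  fix b :: "'a^'n" assume "b \<in> Basis"
  then obtain i u where b: "b = axis i u" by (auto simp: Basis_vec_def)
  show "(\<lambda>w. inner (F w) b) \<in> borel_measurable N"
    unfolding b inner_axis using assms by measurable
qed

lemma borel_measurable_fst_borel:
  fixes F :: "'w \<Rightarrow> 'a::euclidean_space \<times> 'b::euclidean_space"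
  assumes "F \<in> borel_measurable N"
  shows "(\<lambda>w. fst (F w)) \<in> borel_measurable N"
  by (rule measurable_compose[OF assms borel_measurable_continuous_onI]) (intro continuous_intros)

lemma borel_measurable_snd_borel:
  fixes F :: "'w \<Rightarrow> 'a::euclidean_space \<times> 'b::euclidean_space"
  assumes "F \<in> borel_measurable N"
  shows "(\<lambda>w. snd (F w)) \<in> borel_measurable N"
  by (rule measurable_compose[OF assms borel_measurable_continuous_onI]) (intro continuous_intros)

lemma borel_measurable_vec_nth [measurable]:
  fixes F :: "'w \<Rightarrow> 'a::euclidean_space^'n"
  assumes "F \<in> borel_measurable N"
  shows "(\<lambda>w. F w $ i) \<in> borel_measurable N"
  by (rule measurable_compose[OF assms borel_measurable_continuous_onI])
    (intro continuous_intros linear_continuous_on bounded_linear_vec_nth)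

lemma borel_measurable_matrix_vector [measurable]:
  fixes F :: "'w \<Rightarrow> real^'n^'m"
  assumes [measurable]: "F \<in> borel_measurable N" "G \<in> borel_measurable N"
  shows "(\<lambda>w. F w *v G w) \<in> borel_measurable N"
  by (rule borel_measurable_vecI) (simp add: matrix_vector_mult_def)

text \<open>The directional derivative is the limit of difference quotients along
  \<open>1 / (n + 1)\<close>, and each of these is measurable because \<open>H\<close> is jointly
  measurable.\<close>

lemma frechet_derivative_measurable:
  fixes H :: "'w \<Rightarrow> 'a::euclidean_space \<Rightarrow> real"
  assumes H: "(\<lambda>(w, x). H w x) \<in> borel_measurable (N \<Otimes>\<^sub>M borel)"
    and X: "X \<in> borel_measurable N"
    and diff: "\<And>w. w \<in> space N \<Longrightarrow> H w differentiable (at (X w))"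
  shows "(\<lambda>w. frechet_derivative (H w) (at (X w)) v) \<in> borel_measurable N"
proof (rule borel_measurable_LIMSEQ_real)
  let ?c = "\<lambda>n. inverse (real (Suc n))"
  have c: "filterlim ?c (at_right 0) sequentially"
    by (rule tendsto_imp_filterlim_at_right[OF LIMSEQ_inverse_real_of_nat]) simp
  show "(\<lambda>n. (H w (X w + ?c n *\<^sub>R v) - H w (X w)) /\<^sub>R ?c n)
      \<longlonglongrightarrow> frechet_derivative (H w) (at (X w)) v" if "w \<in> space N" for w
    using frechet_derivative_works[THEN iffD1, OF diff[OF that]]
    by (intro filterlim_compose[OF has_derivative_difference_quotient c])
  have "(\<lambda>w. H w (Y w)) \<in> borel_measurable N" if "Y \<in> borel_measurable N" for Y
    using measurable_compose[OF measurable_Pair[OF measurable_ident_sets[OF refl] that] H] by simp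
  then show "(\<lambda>w. (H w (X w + ?c n *\<^sub>R v) - H w (X w)) /\<^sub>R ?c n) \<in> borel_measurable N" for n
    using X by (intro borel_measurable_scaleR borel_measurable_const borel_measurable_diff)
      (simp_all del: of_nat_Suc)
qed

lemma partial_y_measurable:
  fixes h :: "'d \<Rightarrow> 'x::euclidean_space \<Rightarrow> 'y::euclidean_space \<Rightarrow> real"
  assumes h: "(\<lambda>((x, y), d). h d x y) \<in> borel_measurable (borel \<Otimes>\<^sub>M N)"
    and diff: "\<And>d x y. d \<in> space N \<Longrightarrow> h d x differentiable (at y)"
  shows "(\<lambda>((x, y), d). frechet_derivative (h d x) (at y) v) \<in> borel_measurable (borel \<Otimes>\<^sub>M N)"
proof -
  let ?H = "\<lambda>w :: ('x \<times> 'y) \<times> 'd. h (snd w) (fst (fst w))"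
  have "(\<lambda>w. frechet_derivative (?H w) (at (snd (fst w))) v) \<in> borel_measurable (borel \<Otimes>\<^sub>M N)"
  proof (rule frechet_derivative_measurable)
    have "(\<lambda>u :: (('x \<times> 'y) \<times> 'd) \<times> 'y. ((fst (fst (fst u)), snd u), snd (fst u)))
        \<in> (borel \<Otimes>\<^sub>M N) \<Otimes>\<^sub>M borel \<rightarrow>\<^sub>M borel \<Otimes>\<^sub>M N"
      by (intro measurable_Pair borel_measurable_Pair borel_measurable_fst_borel) measurable
    from measurable_compose[OF this h]
    show "(\<lambda>(w, y). ?H w y) \<in> borel_measurable ((borel \<Otimes>\<^sub>M N) \<Otimes>\<^sub>M borel)"
      by (simp add: case_prod_unfold)
    show "(\<lambda>w :: ('x \<times> 'y) \<times> 'd. snd (fst w)) \<in> borel_measurable (borel \<Otimes>\<^sub>M N)"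
      by (intro borel_measurable_snd_borel measurable_fst)
    show "?H w differentiable (at (snd (fst w)))" if "w \<in> space (borel \<Otimes>\<^sub>M N)" for w
      using that by (intro diff) (auto simp: space_pair_measure)
  qed
  then show ?thesis by (simp add: case_prod_unfold)
qed

lemma swap_measurable:
  "(\<lambda>u :: ('a::euclidean_space \<times> 'b::euclidean_space) \<times> 'd. ((snd (fst u), fst (fst u)), snd u))
     \<in> borel \<Otimes>\<^sub>M N \<rightarrow>\<^sub>M borel \<Otimes>\<^sub>M N"
  by (intro measurable_Pair borel_measurable_Pair borel_measurable_fst_borel borel_measurable_snd_borel) measurable

lemma partial_x_measurable:
  fixes h :: "'d \<Rightarrow> 'x::euclidean_space \<Rightarrow> 'y::euclidean_space \<Rightarrow> real"
  assumes h: "(\<lambda>((x, y), d). h d x y) \<in> borel_measurable (borel \<Otimes>\<^sub>M N)"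
    and diff: "\<And>d x y. d \<in> space N \<Longrightarrow> (\<lambda>x. h d x y) differentiable (at x)"
  shows "(\<lambda>((x, y), d). frechet_derivative (\<lambda>x. h d x y) (at x) v) \<in> borel_measurable (borel \<Otimes>\<^sub>M N)"
proof -
  have "(\<lambda>((y, x), d). h d x y) \<in> borel_measurable (borel \<Otimes>\<^sub>M N)"
    using measurable_compose[OF swap_measurable h] by (simp add: case_prod_unfold)
  from measurable_compose[OF swap_measurable partial_y_measurable[OF this diff]] show ?thesis
    by (simp add: case_prod_unfold)
qed

lemma dy_measurable:
  fixes h :: "'d \<Rightarrow> real^'x \<Rightarrow> real^'y \<Rightarrow> real"
  assumes h: "(\<lambda>((x, y), d). h d x y) \<in> borel_measurable (borel \<Otimes>\<^sub>M N)"
    and diff: "\<And>d q. d \<in> space N \<Longrightarrow> case_prod (h d) differentiable (at q)"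
  shows "(\<lambda>((x, y), d). dy (h d) x y) \<in> borel_measurable (borel \<Otimes>\<^sub>M N)"
  by (rule borel_measurable_vecI)
    (use partial_y_measurable[OF h differentiableI[OF dy_has_derivative[OF diff]]]
      in \<open>simp add: dy_def grad_def case_prod_unfold\<close>)

lemma dx_measurable:
  fixes h :: "'d \<Rightarrow> real^'x \<Rightarrow> real^'y \<Rightarrow> real"
  assumes h: "(\<lambda>((x, y), d). h d x y) \<in> borel_measurable (borel \<Otimes>\<^sub>M N)"
    and diff: "\<And>d q. d \<in> space N \<Longrightarrow> case_prod (h d) differentiable (at q)"
  shows "(\<lambda>((x, y), d). dx (h d) x y) \<in> borel_measurable (borel \<Otimes>\<^sub>M N)"
  by (rule borel_measurable_vecI)
    (use partial_x_measurable[OF h differentiableI[OF dx_has_derivative[OF diff]]]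
      in \<open>simp add: dx_def grad_def case_prod_unfold\<close>)

lemma twice_differentiableD:
  assumes "twice_differentiable h"
  shows "case_prod h differentiable (at q)" "case_prod (nabla h) differentiable (at q)"
  using assms unfolding twice_differentiable_def by blast+

lemma dy_nth_differentiable:
  assumes "twice_differentiable h"
  shows "(\<lambda>x. dy h x y $ j) differentiable (at x)" "(\<lambda>y. dy h x y $ j) differentiable (at y)"
  unfolding differentiable_def
  using bounded_linear.has_derivative[OF bounded_linear_vec_nth[of j]
      partial_x_has_derivative[OF dy_has_total_derivative[OF assms, of x y]]]
    bounded_linear.has_derivative[OF bounded_linear_vec_nth[of j]
      partial_y_has_derivative[OF dy_has_total_derivative[OF assms, of x y]]]
  by (simp_all only: prod.case) blast+

lemma dyy_measurable:
  fixes h :: "'d \<Rightarrow> real^'x \<Rightarrow> real^'y \<Rightarrow> real"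
  assumes h: "(\<lambda>((x, y), d). h d x y) \<in> borel_measurable (borel \<Otimes>\<^sub>M N)"
    and diff: "\<And>d. d \<in> space N \<Longrightarrow> twice_differentiable (h d)"
  shows "(\<lambda>((x, y), d). dyy (h d) x y) \<in> borel_measurable (borel \<Otimes>\<^sub>M N)"
proof (intro borel_measurable_vecI)
  fix i j
  have "(\<lambda>((x, y), d). dy (h d) x y $ j) \<in> borel_measurable (borel \<Otimes>\<^sub>M N)"
    using borel_measurable_vec_nth[OF dy_measurable[OF h twice_differentiableD(1)[OF diff]]]
    by (simp add: case_prod_unfold)
  from partial_y_measurable[OF this dy_nth_differentiable(2)[OF diff]]
  show "(\<lambda>w. (case w of (q, d) \<Rightarrow> (case q of (x, y) \<Rightarrow> \<lambda>d. dyy (h d) x y) d) $ i $ j)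
      \<in> borel_measurable (borel \<Otimes>\<^sub>M N)"
    by (simp add: dyy_def case_prod_unfold)
qed

lemma dxy_measurable:
  fixes h :: "'d \<Rightarrow> real^'x \<Rightarrow> real^'y \<Rightarrow> real"
  assumes h: "(\<lambda>((x, y), d). h d x y) \<in> borel_measurable (borel \<Otimes>\<^sub>M N)"
    and diff: "\<And>d. d \<in> space N \<Longrightarrow> twice_differentiable (h d)"
  shows "(\<lambda>((x, y), d). dxy (h d) x y) \<in> borel_measurable (borel \<Otimes>\<^sub>M N)"
proof (intro borel_measurable_vecI)
  fix i j
  have "(\<lambda>((x, y), d). dy (h d) x y $ j) \<in> borel_measurable (borel \<Otimes>\<^sub>M N)"
    using borel_measurable_vec_nth[OF dy_measurable[OF h twice_differentiableD(1)[OF diff]]]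
    by (simp add: case_prod_unfold)
  from partial_x_measurable[OF this dy_nth_differentiable(1)[OF diff]]
  show "(\<lambda>w. (case w of (q, d) \<Rightarrow> (case q of (x, y) \<Rightarrow> \<lambda>d. dxy (h d) x y) d) $ i $ j)
      \<in> borel_measurable (borel \<Otimes>\<^sub>M N)"
    by (simp add: dxy_def case_prod_unfold)
qed

lemma batch_avg_differentiable:
  assumes "\<And>j. j < b \<Longrightarrow> (\<lambda>(x, y). h x y (D j)) differentiable (at q)"
  shows "case_prod (batch_avg b h D) differentiable (at q)"
proof -
  have eq: "case_prod (batch_avg b h D) = (\<lambda>q. (1 / real b) *\<^sub>R (\<Sum>j<b. (\<lambda>(x, y). h x y (D j)) q))"
    by (auto simp: batch_avg_def fun_eq_iff)
  show ?thesis unfolding eq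
    by (intro differentiable_scaleR differentiable_const differentiable_sum ballI assms) simp_all
qed

lemma nabla_batch_avg:
  assumes "\<And>j q. j < b \<Longrightarrow> (\<lambda>(x, y). h x y (D j)) differentiable (at q)"
  shows "nabla (batch_avg b h D) x y = (1 / real b) *\<^sub>R (\<Sum>j<b. nabla (\<lambda>x y. h x y (D j)) x y)"
proof -
  have "(batch_avg b h D x has_derivative
      (\<lambda>v. (1 / real b) *\<^sub>R (\<Sum>j<b. inner (dy (\<lambda>x y. h x y (D j)) x y) v))) (at y)"
    unfolding batch_avg_def[abs_def] divide_inverse mult.commute[of _ "inverse _"]
    using dy_has_derivative[OF assms]
    by (auto intro!: derivative_eq_intros simp: sum_distrib_left divide_inverse)
  then have "dy (batch_avg b h D) x y = (1 / real b) *\<^sub>R (\<Sum>j<b. dy (\<lambda>x y. h x y (D j)) x y)"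
    unfolding dy_def by (intro grad_eqI) (simp add: inner_sum_left)
  moreover
  have "((\<lambda>x. batch_avg b h D x y) has_derivative
      (\<lambda>v. (1 / real b) *\<^sub>R (\<Sum>j<b. inner (dx (\<lambda>x y. h x y (D j)) x y) v))) (at x)"
    unfolding batch_avg_def[abs_def] divide_inverse mult.commute[of _ "inverse _"]
    using dx_has_derivative[OF assms]
    by (auto intro!: derivative_eq_intros simp: sum_distrib_left divide_inverse)
  then have "dx (batch_avg b h D) x y = (1 / real b) *\<^sub>R (\<Sum>j<b. dx (\<lambda>x y. h x y (D j)) x y)"
    unfolding dx_def by (intro grad_eqI) (simp add: inner_sum_left)
  ultimately show ?thesis by (simp add: nabla_def prod_eq_iff fst_sum snd_sum)
qed

lemma batch_avg_twice_differentiable: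
  assumes "\<And>j. j < b \<Longrightarrow> twice_differentiable (\<lambda>x y. h x y (D j))"
  shows "twice_differentiable (batch_avg b h D)"
  unfolding twice_differentiable_def
proof (intro conjI allI)
  fix q
  have 1: "\<And>j q. j < b \<Longrightarrow> (\<lambda>(x, y). h x y (D j)) differentiable (at q)"
    using twice_differentiableD(1)[OF assms] .
  then show "case_prod (batch_avg b h D) differentiable (at q)" by (rule batch_avg_differentiable)
  have eq: "case_prod (nabla (batch_avg b h D))
      = (\<lambda>q. (1 / real b) *\<^sub>R (\<Sum>j<b. case_prod (nabla (\<lambda>x y. h x y (D j))) q))"
    by (auto simp: nabla_batch_avg[of b h D, OF 1] fun_eq_iff)
  show "case_prod (nabla (batch_avg b h D)) differentiable (at q)"
    unfolding eq
    by (intro differentiable_scaleR differentiable_const differentiable_sum ballI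
        twice_differentiableD(2) assms) simp_all
qed

lemma batch_avg_measurable:
  assumes h: "(\<lambda>((x, y), s). h x y s) \<in> borel_measurable (borel \<Otimes>\<^sub>M P)"
  shows "(\<lambda>((x, y), D). batch_avg b h D x y) \<in> borel_measurable (borel \<Otimes>\<^sub>M batch_measure P b)"
proof -
  have "(\<lambda>u. case_prod h (fst u) (snd u j)) \<in> borel_measurable (borel \<Otimes>\<^sub>M batch_measure P b)"
    if "j < b" for j
  proof -
    have "(\<lambda>u. (fst u, snd u j)) \<in> borel \<Otimes>\<^sub>M batch_measure P b \<rightarrow>\<^sub>M borel \<Otimes>\<^sub>M P"
      unfolding batch_measure_def by measurable (simp add: that)
    from measurable_compose[OF this h] show ?thesis by (simp add: case_prod_unfold)
  qed
  then have "(\<lambda>u. (\<Sum>j<b. case_prod h (fst u) (snd u j)) / real b)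
      \<in> borel_measurable (borel \<Otimes>\<^sub>M batch_measure P b)"
    by (intro borel_measurable_divide borel_measurable_sum) auto
  then show ?thesis by (simp add: batch_avg_def case_prod_unfold)
qed

lemma space_batch_measure: "D \<in> space (batch_measure P b) \<Longrightarrow> j < b \<Longrightarrow> D j \<in> space P"
  by (auto simp: batch_measure_def space_PiM)

lemma prob_space_batch: "prob_space P \<Longrightarrow> prob_space (batch_measure P b)"
  unfolding batch_measure_def by (rule prob_space_PiM)

section \<open>Second moments of the batch errors\<close>

lemma inner_gram: "inner w (gram A *v w) = (norm (A *v w))\<^sup>2"
proof -
  have "inner w (gram A *v w) = inner ((A *v w) v* A) w"
    by (simp add: gram_def matrix_vector_mul_assoc[symmetric] inner_commute)
  then show ?thesis by (simp add: dot_lmul_matrix power2_norm_eq_inner)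
qed

text \<open>The variance hypotheses on second derivatives concern the mean of a Gram matrix. At a
  fixed \<open>w\<close> the quadratic form is linear in that matrix, so it commutes with the
  integral and becomes a mean square.\<close>

lemma gram_quadratic_integral:
  fixes F :: "'d \<Rightarrow> real^'n^'m"
  assumes "integrable Q (\<lambda>D. gram (F D))" "op_norm (LINT D|Q. gram (F D)) \<le> s"
  shows "integrable Q (\<lambda>D. (norm (F D *v w))\<^sup>2)"
    and "(LINT D|Q. (norm (F D *v w))\<^sup>2) \<le> s * (norm w)\<^sup>2"
proof -
  have bl: "bounded_linear (\<lambda>A::real^'n^'n. inner w (A *v w))"
    unfolding linear_conv_bounded_linear[symmetric]
    by (intro linearI) (simp_all add: matrix_vector_mult_add_rdistrib inner_add_right
        scaleR_matrix_vector_assoc[symmetric])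
  show "integrable Q (\<lambda>D. (norm (F D *v w))\<^sup>2)"
    using integrable_bounded_linear[OF bl assms(1)] by (simp add: inner_gram)
  have "(LINT D|Q. (norm (F D *v w))\<^sup>2) = inner w ((LINT D|Q. gram (F D)) *v w)"
    using integral_bounded_linear[OF bl assms(1)] by (simp add: inner_gram)
  also have "\<dots> \<le> norm w * (op_norm (LINT D|Q. gram (F D)) * norm w)"
    by (intro order_trans[OF norm_cauchy_schwarz] mult_left_mono op_norm_bound) simp
  also have "\<dots> \<le> norm w * (s * norm w)" by (intro mult_left_mono mult_right_mono assms) auto
  finally show "(LINT D|Q. (norm (F D *v w))\<^sup>2) \<le> s * (norm w)\<^sup>2" by (simp add: power2_eq_square mult_ac)
qed

text \<open>The cross term has mean 0. The conclusion is a nonnegative integral because it is fed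
  into Fubini's theorem in \<open>mean_le_fresh\<close>.\<close>

lemma (in prob_space) bias_variance:
  fixes a :: "'b::euclidean_space"
  assumes e: "has_bochner_integral M e 0" and e2: "integrable M (\<lambda>D. (norm (e D))\<^sup>2)"
    and s: "(LINT D|M. (norm (e D))\<^sup>2) \<le> s"
  shows "(\<integral>\<^sup>+D. ennreal ((norm (a + c *\<^sub>R e D))\<^sup>2) \<partial>M) \<le> ennreal ((norm a)\<^sup>2 + c\<^sup>2 * s)"
proof -
  have eq: "(norm (a + c *\<^sub>R e D))\<^sup>2 = (norm a)\<^sup>2 + 2 * c * inner a (e D) + c\<^sup>2 * (norm (e D))\<^sup>2" for D
    by (simp only: power2_norm_eq_inner)
      (simp add: inner_add_left inner_add_right inner_commute power2_eq_square)
  have i: "integrable M e" "integral\<^sup>L M e = 0" using e by (auto simp: has_bochner_integral_iff)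
  have int: "integrable M (\<lambda>D. (norm (a + c *\<^sub>R e D))\<^sup>2)" unfolding eq using i e2 by simp
  have "(LINT D|M. (norm (a + c *\<^sub>R e D))\<^sup>2) = (norm a)\<^sup>2 + c\<^sup>2 * (LINT D|M. (norm (e D))\<^sup>2)"
    unfolding eq using i e2 by (simp add: prob_space)
  also have "\<dots> \<le> (norm a)\<^sup>2 + c\<^sup>2 * s" by (intro add_left_mono mult_left_mono s) simp
  finally show ?thesis using int by (subst nn_integral_eq_integral) (auto intro: ennreal_leI)
qed

context stochastic_bilevel
begin

lemma prob_space_batch_P: "prob_space (batch_measure P b)"
  by (rule prob_space_batch) (rule P.prob_space_axioms)

lemma fh_batch_differentiable:
  "D \<in> space (batch_measure P b) \<Longrightarrow> case_prod (batch_avg b fh D) differentiable (at q)"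
  by (rule batch_avg_differentiable, rule fh_differentiable, rule space_batch_measure)

lemma gh_batch_twice_differentiable:
  "D \<in> space (batch_measure P b) \<Longrightarrow> twice_differentiable (batch_avg b gh D)"
  by (rule batch_avg_twice_differentiable, rule gh_twice_differentiable, rule space_batch_measure)

lemma batch_derivatives_measurable:
  "(\<lambda>((x, y), D). dx (batch_avg b fh D) x y) \<in> borel_measurable (borel \<Otimes>\<^sub>M batch_measure P b)"
  "(\<lambda>((x, y), D). dy (batch_avg b fh D) x y) \<in> borel_measurable (borel \<Otimes>\<^sub>M batch_measure P b)"
  "(\<lambda>((x, y), D). dy (batch_avg b gh D) x y) \<in> borel_measurable (borel \<Otimes>\<^sub>M batch_measure P b)"
  "(\<lambda>((x, y), D). dxy (batch_avg b gh D) x y) \<in> borel_measurable (borel \<Otimes>\<^sub>M batch_measure P b)"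
  "(\<lambda>((x, y), D). dyy (batch_avg b gh D) x y) \<in> borel_measurable (borel \<Otimes>\<^sub>M batch_measure P b)"
  by (intro dx_measurable dy_measurable dxy_measurable dyy_measurable
      batch_avg_measurable[OF fh_measurable] batch_avg_measurable[OF gh_measurable]
      fh_batch_differentiable gh_batch_twice_differentiable
      twice_differentiableD(1)[OF gh_batch_twice_differentiable] | assumption)+

lemma batch_nabla_f_error:
  assumes "1 \<le> b"
  shows "(\<integral>\<^sup>+D. ennreal ((norm (dx (batch_avg b fh D) x y - dx f x y))\<^sup>2
      + (norm (dy (batch_avg b fh D) x y - dy f x y))\<^sup>2) \<partial>batch_measure P b) \<le> ennreal ((sd_f p)\<^sup>2 / real b)"
proof -
  have "(norm (nabla (batch_avg b fh D) x y - nabla f x y))\<^sup>2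
    = (norm (dx (batch_avg b fh D) x y - dx f x y))\<^sup>2 + (norm (dy (batch_avg b fh D) x y - dy f x y))\<^sup>2" for D
    by (simp add: nabla_def norm_Pair)
  then show ?thesis
    using nabla_f_variance[OF assms, of x y]
    by (subst nn_integral_eq_integral) (auto intro: ennreal_leI)
qed

lemma batch_y_step_error:
  assumes "1 \<le> b"
  shows "(\<integral>\<^sup>+D. ennreal ((norm (y - (1 / Lg p) *\<^sub>R dy (batch_avg b gh D) x y - ystar g x))\<^sup>2) \<partial>batch_measure P b)
    \<le> ennreal ((1 - mug p / Lg p) * (norm (y - ystar g x))\<^sup>2 + (1 / Lg p)\<^sup>2 * ((sd_g p)\<^sup>2 / real b))"
proof -
  interpret B: prob_space "batch_measure P b" by (rule prob_space_batch_P)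
  let ?e = "\<lambda>D. dy (batch_avg b gh D) x y - dy g x y"
  let ?a = "y - (1 / Lg p) *\<^sub>R dy g x y - ystar g x"
  have "has_bochner_integral (batch_measure P b) ?e 0"
    using has_bochner_integral_diff[OF dy_g_unbiased[OF assms, of x y]
        has_bochner_integral_integrable[OF B.integrable_const[of "dy g x y"]]]
    by (simp add: B.prob_space)
  from B.bias_variance[OF this dy_g_variance[OF assms, of x y], of ?a "- 1 / Lg p"]
  have "(\<integral>\<^sup>+D. ennreal ((norm (?a + (- 1 / Lg p) *\<^sub>R ?e D))\<^sup>2) \<partial>batch_measure P b)
      \<le> ennreal ((norm ?a)\<^sup>2 + (1 / Lg p)\<^sup>2 * ((sd_g p)\<^sup>2 / real b))" by (simp add: power_divide)
  also have "(norm ?a)\<^sup>2 \<le> (1 - mug p / Lg p) * (norm (y - ystar g x))\<^sup>2"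
    using ssc.gradient_step_contraction[of y x "ystar g x"] by (simp add: dy_g_ystar)
  then have "ennreal ((norm ?a)\<^sup>2 + (1 / Lg p)\<^sup>2 * ((sd_g p)\<^sup>2 / real b))
      \<le> ennreal ((1 - mug p / Lg p) * (norm (y - ystar g x))\<^sup>2 + (1 / Lg p)\<^sup>2 * ((sd_g p)\<^sup>2 / real b))"
    by (intro ennreal_leI add_right_mono)
  finally show ?thesis by (simp add: algebra_simps)
qed

lemma batch_dxy_error:
  assumes "1 \<le> b"
  shows "(\<integral>\<^sup>+D. ennreal ((norm ((dxy (batch_avg b gh D) x y - dxy g x y) *v z))\<^sup>2) \<partial>batch_measure P b)
    \<le> ennreal ((sd_gxy p)\<^sup>2 / real b * (norm z)\<^sup>2)"
  using gram_quadratic_integral[OF dxy_g_variance[OF assms, of x y], of z]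
  by (subst nn_integral_eq_integral) (auto intro: ennreal_leI)

text \<open>The noise is multiplicative: it scales with \<open>norm z\<close> and splits into a part
  with the distance to the solution and a part with the solution. The hypothesis
  \<open>small\<close> keeps the first part within \<open>\<beta> * mug p / 2\<close>, the surplus
  left by \<open>hessian_step_contraction\<close>.\<close>

lemma batch_z_step_error:
  fixes \<beta> :: real
  defines "\<beta> \<equiv> 1 / (2 * Lg p)"
  assumes b: "1 \<le> b" and small: "(sd_gyy p)\<^sup>2 / real b \<le> mug p * Lg p / 2"
  shows "(\<integral>\<^sup>+D. ennreal ((norm (z - \<beta> *\<^sub>R (dyy (batch_avg b gh D) x y *v z + v) - zsol g x y v))\<^sup>2)
      \<partial>batch_measure P b)
    \<le> ennreal ((1 - \<beta> * mug p) * (norm (z - zsol g x y v))\<^sup>2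
        + 2 * \<beta>\<^sup>2 * ((sd_gyy p)\<^sup>2 / real b) * (norm (zsol g x y v))\<^sup>2)"
proof -
  interpret B: prob_space "batch_measure P b" by (rule prob_space_batch_P)
  let ?F = "\<lambda>D. dyy (batch_avg b gh D) x y - dyy g x y"
  let ?zv = "zsol g x y v"
  let ?a = "(z - ?zv) - \<beta> *\<^sub>R (dyy g x y *v (z - ?zv))"
  let ?s = "(sd_gyy p)\<^sup>2 / real b"
  have bl: "bounded_linear (\<lambda>A::real^'y^'y. A *v z)"
    unfolding linear_conv_bounded_linear[symmetric]
    by (intro linearI) (simp_all add: matrix_vector_mult_add_rdistrib scaleR_matrix_vector_assoc[symmetric])
  have "has_bochner_integral (batch_measure P b) (\<lambda>D. ?F D *v z) 0"
    using has_bochner_integral_bounded_linear[OF bl dyy_g_zero_mean[OF b, of x y]] by simp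
  from B.bias_variance[OF this gram_quadratic_integral[OF dyy_g_variance[OF b, of x y]], of ?a "- \<beta>"]
  have bv: "(\<integral>\<^sup>+D. ennreal ((norm (?a + (- \<beta>) *\<^sub>R (?F D *v z)))\<^sup>2) \<partial>batch_measure P b)
      \<le> ennreal ((norm ?a)\<^sup>2 + \<beta>\<^sup>2 * (?s * (norm z)\<^sup>2))" by simp
  have eq: "?a + (- \<beta>) *\<^sub>R (?F D *v z)
      = z - \<beta> *\<^sub>R (dyy (batch_avg b gh D) x y *v z + v) - ?zv" for D
    by (simp add: matrix_vector_mult_diff_rdistrib matrix_vector_mult_diff_distrib dyy_zsol
        scaleR_diff_right scaleR_add_right)
  have "(norm ?a)\<^sup>2 + \<beta>\<^sup>2 * (?s * (norm z)\<^sup>2)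
      \<le> (1 - \<beta> * mug p) * (norm (z - ?zv))\<^sup>2 + 2 * \<beta>\<^sup>2 * ?s * (norm ?zv)\<^sup>2"
  proof -
    have 1: "(norm ?a)\<^sup>2 \<le> (1 - 3 / 2 * \<beta> * mug p) * (norm (z - ?zv))\<^sup>2"
      unfolding \<beta>_def by (rule hessian_step_contraction)
    have "norm z \<le> norm (z - ?zv) + norm ?zv" by (metis diff_add_cancel norm_triangle_ineq)
    then have "(norm z)\<^sup>2 \<le> (norm (z - ?zv) + norm ?zv)\<^sup>2" by (simp add: power_mono)
    also have "\<dots> \<le> 2 * (norm (z - ?zv))\<^sup>2 + 2 * (norm ?zv)\<^sup>2"
      using sum_squares_bound[of "norm (z - ?zv)" "norm ?zv"] by (simp add: power2_sum)
    finally have "\<beta>\<^sup>2 * (?s * (norm z)\<^sup>2)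
        \<le> \<beta>\<^sup>2 * (?s * (2 * (norm (z - ?zv))\<^sup>2 + 2 * (norm ?zv)\<^sup>2))"
      by (intro mult_left_mono) auto
    also have "\<dots> = 2 * \<beta> * (\<beta> * ?s) * (norm (z - ?zv))\<^sup>2 + 2 * \<beta>\<^sup>2 * ?s * (norm ?zv)\<^sup>2"
      by (simp add: algebra_simps power2_eq_square)
    finally have 2: "\<beta>\<^sup>2 * (?s * (norm z)\<^sup>2)
        \<le> 2 * \<beta> * (\<beta> * ?s) * (norm (z - ?zv))\<^sup>2 + 2 * \<beta>\<^sup>2 * ?s * (norm ?zv)\<^sup>2" .
    have \<beta>: "0 < \<beta>" "\<beta> * (mug p * Lg p / 2) = mug p / 4" using Lg_pos by (simp_all add: \<beta>_def)
    have "\<beta> * ?s \<le> mug p / 4"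
      using mult_left_mono[OF small, of \<beta>] \<beta>(1) unfolding \<beta>(2) by simp
    then have 3: "2 * \<beta> * (\<beta> * ?s) * (norm (z - ?zv))\<^sup>2 \<le> 2 * \<beta> * (mug p / 4) * (norm (z - ?zv))\<^sup>2"
      using \<beta> by (intro mult_right_mono mult_left_mono) auto
    have 4: "(1 - 3 / 2 * \<beta> * mug p) * (norm (z - ?zv))\<^sup>2 + 2 * \<beta> * (mug p / 4) * (norm (z - ?zv))\<^sup>2
        = (1 - \<beta> * mug p) * (norm (z - ?zv))\<^sup>2" by (simp add: algebra_simps)
    then show ?thesis using 1 2 3 by linarith
  qed
  from order_trans[OF bv ennreal_leI[OF this]] show ?thesis unfolding eq .
qed

end

section \<open>Independence of fresh batches\<close>

text \<open>Integrability travels with the bound: the integral of a non-integrable function is 0, so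
  a bare inequality would say nothing.\<close>

definition mean_le :: "'w measure \<Rightarrow> ('w \<Rightarrow> real) \<Rightarrow> real \<Rightarrow> bool" where
  "mean_le M X r \<longleftrightarrow> integrable M X \<and> integral\<^sup>L M X \<le> r"

lemma mean_le_add: "mean_le M X r \<Longrightarrow> mean_le M Y s \<Longrightarrow> mean_le M (\<lambda>\<omega>. X \<omega> + Y \<omega>) (r + s)"
  by (auto simp: mean_le_def)

lemma mean_le_cmult: "mean_le M X r \<Longrightarrow> 0 \<le> c \<Longrightarrow> mean_le M (\<lambda>\<omega>. c * X \<omega>) (c * r)"
  by (auto simp: mean_le_def intro: mult_left_mono)

lemma mean_le_trans: "mean_le M X r \<Longrightarrow> r \<le> s \<Longrightarrow> mean_le M X s"
  by (auto simp: mean_le_def)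

lemma mean_le_dominated:
  assumes "mean_le M Y r" "X \<in> borel_measurable M" "\<And>\<omega>. \<omega> \<in> space M \<Longrightarrow> 0 \<le> X \<omega>"
    and "\<And>\<omega>. \<omega> \<in> space M \<Longrightarrow> X \<omega> \<le> Y \<omega>"
  shows "mean_le M X r"
proof -
  have "integrable M X"
  proof (rule Bochner_Integration.integrable_bound[OF _ assms(2) AE_I2])
    show "integrable M Y" using assms(1) by (simp add: mean_le_def)
    show "norm (X \<omega>) \<le> norm (Y \<omega>)" if "\<omega> \<in> space M" for \<omega>
      using assms(3,4)[OF that] by simp
  qed
  moreover from this have "integral\<^sup>L M X \<le> integral\<^sup>L M Y"
    using assms by (intro integral_mono) (auto simp: mean_le_def)
  ultimately show ?thesis using assms(1) by (simp add: mean_le_def)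
qed

lemma mean_le_nonneg:
  assumes "mean_le M X r" "\<And>\<omega>. 0 \<le> X \<omega>"
  shows "0 \<le> r"
proof -
  have "0 \<le> integral\<^sup>L M X" by (rule integral_nonneg_AE) (simp add: assms(2))
  then show ?thesis using assms(1) by (simp add: mean_le_def)
qed

lemma (in prob_space) mean_le_const: "c \<le> r \<Longrightarrow> mean_le M (\<lambda>_. c) r"
  by (simp add: mean_le_def prob_space)

lemma mean_le_nn_integralI:
  assumes "X \<in> borel_measurable M" "\<And>\<omega>. 0 \<le> X \<omega>" "(\<integral>\<^sup>+\<omega>. ennreal (X \<omega>) \<partial>M) \<le> ennreal r" "0 \<le> r"
  shows "mean_le M X r"
proof -
  have "integrable M X"
    using assms by (intro integrableI_bounded) (auto simp: le_less_trans[OF _ ennreal_less_top])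
  moreover from this have "ennreal (integral\<^sup>L M X) \<le> ennreal r"
    using assms by (simp add: nn_integral_eq_integral)
  ultimately show ?thesis using assms(4) by (simp add: mean_le_def)
qed

text \<open>The library's \<open>indep_var\<close> requires both variables to have the same type.\<close>

definition (in prob_space) indep_pair :: "'b measure \<Rightarrow> ('a \<Rightarrow> 'b) \<Rightarrow> 'c measure \<Rightarrow> ('a \<Rightarrow> 'c) \<Rightarrow> bool" where
  "indep_pair S X T Y \<longleftrightarrow> X \<in> M \<rightarrow>\<^sub>M S \<and> Y \<in> M \<rightarrow>\<^sub>M T \<and>
     (\<forall>A\<in>sets S. \<forall>B\<in>sets T. prob (X -` A \<inter> Y -` B \<inter> space M)
        = prob (X -` A \<inter> space M) * prob (Y -` B \<inter> space M))"

lemma (in prob_space) indep_pair_compose: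
  assumes "indep_pair S X T Y" "f \<in> S \<rightarrow>\<^sub>M S'" "g \<in> T \<rightarrow>\<^sub>M T'"
  shows "indep_pair S' (\<lambda>\<omega>. f (X \<omega>)) T' (\<lambda>\<omega>. g (Y \<omega>))"
  unfolding indep_pair_def
proof (intro conjI ballI)
  have X: "X \<in> M \<rightarrow>\<^sub>M S" and Y: "Y \<in> M \<rightarrow>\<^sub>M T" using assms by (simp_all add: indep_pair_def)
  show "(\<lambda>\<omega>. f (X \<omega>)) \<in> M \<rightarrow>\<^sub>M S'" "(\<lambda>\<omega>. g (Y \<omega>)) \<in> M \<rightarrow>\<^sub>M T'"
    using X Y assms by (auto intro: measurable_compose)
  fix A B assume "A \<in> sets S'" "B \<in> sets T'"
  then have "f -` A \<inter> space S \<in> sets S" "g -` B \<inter> space T \<in> sets T"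
    using assms by (auto intro: measurable_sets)
  then have "prob (X -` (f -` A \<inter> space S) \<inter> Y -` (g -` B \<inter> space T) \<inter> space M)
      = prob (X -` (f -` A \<inter> space S) \<inter> space M) * prob (Y -` (g -` B \<inter> space T) \<inter> space M)"
    using assms(1) unfolding indep_pair_def by blast
  moreover have "X -` (f -` A \<inter> space S) \<inter> Y -` (g -` B \<inter> space T) \<inter> space M
      = (\<lambda>\<omega>. f (X \<omega>)) -` A \<inter> (\<lambda>\<omega>. g (Y \<omega>)) -` B \<inter> space M"
    "X -` (f -` A \<inter> space S) \<inter> space M = (\<lambda>\<omega>. f (X \<omega>)) -` A \<inter> space M"
    "Y -` (g -` B \<inter> space T) \<inter> space M = (\<lambda>\<omega>. g (Y \<omega>)) -` B \<inter> space M"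
    using measurable_space[OF X] measurable_space[OF Y] by auto
  ultimately show "prob ((\<lambda>\<omega>. f (X \<omega>)) -` A \<inter> (\<lambda>\<omega>. g (Y \<omega>)) -` B \<inter> space M)
      = prob ((\<lambda>\<omega>. f (X \<omega>)) -` A \<inter> space M) * prob ((\<lambda>\<omega>. g (Y \<omega>)) -` B \<inter> space M)" by (simp only:)
qed

lemma (in prob_space) indep_pair_distr:
  assumes "indep_pair S X T Y"
  shows "distr M (S \<Otimes>\<^sub>M T) (\<lambda>\<omega>. (X \<omega>, Y \<omega>)) = distr M S X \<Otimes>\<^sub>M distr M T Y"
proof (rule pair_measure_eqI[symmetric])
  have X: "X \<in> M \<rightarrow>\<^sub>M S" and Y: "Y \<in> M \<rightarrow>\<^sub>M T" using assms by (simp_all add: indep_pair_def)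
  interpret X: prob_space "distr M S X" by (rule prob_space_distr[OF X])
  interpret Y: prob_space "distr M T Y" by (rule prob_space_distr[OF Y])
  show "sigma_finite_measure (distr M S X)" "sigma_finite_measure (distr M T Y)" by unfold_locales
  show "sets (distr M S X \<Otimes>\<^sub>M distr M T Y) = sets (distr M (S \<Otimes>\<^sub>M T) (\<lambda>\<omega>. (X \<omega>, Y \<omega>)))"
    by (simp cong: sets_pair_measure_cong)
  fix A B assume "A \<in> sets (distr M S X)" "B \<in> sets (distr M T Y)"
  then have AB: "A \<in> sets S" "B \<in> sets T" by simp_all
  have "(\<lambda>\<omega>. (X \<omega>, Y \<omega>)) -` (A \<times> B) \<inter> space M = X -` A \<inter> Y -` B \<inter> space M" by auto
  then show "emeasure (distr M S X) A * emeasure (distr M T Y) B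
      = emeasure (distr M (S \<Otimes>\<^sub>M T) (\<lambda>\<omega>. (X \<omega>, Y \<omega>))) (A \<times> B)"
    using AB assms measurable_Pair[OF X Y] X Y
    by (simp add: emeasure_distr indep_pair_def emeasure_eq_measure ennreal_mult)
qed

lemma (in prob_space) indep_pairI_distr:
  assumes X: "X \<in> M \<rightarrow>\<^sub>M S" and Y: "Y \<in> M \<rightarrow>\<^sub>M T"
    and eq: "\<And>A B. A \<in> sets S \<Longrightarrow> B \<in> sets T \<Longrightarrow>
      emeasure M (X -` A \<inter> Y -` B \<inter> space M) = emeasure (distr M S X) A * emeasure (distr M T Y) B"
  shows "indep_pair S X T Y"
  unfolding indep_pair_def
proof (intro conjI X Y ballI)
  fix A B assume AB: "A \<in> sets S" "B \<in> sets T"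
  from eq[OF this] AB X Y have "ennreal (prob (X -` A \<inter> Y -` B \<inter> space M))
      = ennreal (prob (X -` A \<inter> space M) * prob (Y -` B \<inter> space M))"
    by (simp add: emeasure_distr emeasure_eq_measure ennreal_mult)
  then show "prob (X -` A \<inter> Y -` B \<inter> space M) = prob (X -` A \<inter> space M) * prob (Y -` B \<inter> space M)"
    by simp
qed

section \<open>The past of a run and fresh batches\<close>

context amigo_randomness
begin

text \<open>The information in the initial point and the samples labelled by \<open>A\<close>. As it
  is pulled back along a single map, each of its events is the preimage of a set of joint values,
  which \<open>batch_indep\<close> exploits.\<close>

definition past :: "sample_label set \<Rightarrow> 'w measure" where
  "past A = vimage_algebra (space M) (\<lambda>\<omega>. (init \<omega>, \<lambda>l\<in>A. \<xi> l \<omega>)) (borel \<Otimes>\<^sub>M (\<Pi>\<^sub>M l\<in>A. P))"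

lemma sample_measurable: "\<xi> l \<in> M \<rightarrow>\<^sub>M P"
  using samples_indep by (simp add: indep_vars_def2)

lemma prob_space_P: "prob_space P"
  using prob_space_distr[OF sample_measurable] by (simp add: samples_distr)

lemma past_vars_measurable: "(\<lambda>\<omega>. (init \<omega>, \<lambda>l\<in>A. \<xi> l \<omega>)) \<in> M \<rightarrow>\<^sub>M borel \<Otimes>\<^sub>M (\<Pi>\<^sub>M l\<in>A. P)"
  by (intro measurable_Pair init_measurable measurable_restrict sample_measurable)

lemma space_past [simp]: "space (past A) = space M"
  by (simp add: past_def)

lemma past_vars_measurable_past:
  "(\<lambda>\<omega>. (init \<omega>, \<lambda>l\<in>A. \<xi> l \<omega>)) \<in> past A \<rightarrow>\<^sub>M borel \<Otimes>\<^sub>M (\<Pi>\<^sub>M l\<in>A. P)"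
  unfolding past_def by (rule measurable_vimage_algebra1) (use measurable_space[OF past_vars_measurable] in blast)

lemma init_past: "init \<in> past A \<rightarrow>\<^sub>M borel"
  using measurable_compose[OF past_vars_measurable_past measurable_fst] by simp

lemma sample_past: "l \<in> A \<Longrightarrow> \<xi> l \<in> past A \<rightarrow>\<^sub>M P"
  using measurable_compose[OF measurable_compose[OF past_vars_measurable_past measurable_snd]
      measurable_component_singleton[of l A]] by simp

text \<open>Minimality of a generated algebra. The comparison with larger label sets and the one
  with \<open>M\<close> are both instances.\<close>

lemma past_le:
  assumes "init \<in> N \<rightarrow>\<^sub>M borel" "\<And>l. l \<in> A \<Longrightarrow> \<xi> l \<in> N \<rightarrow>\<^sub>M P" "space N = space M"
    and "Y \<in> past A \<rightarrow>\<^sub>M N'"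
  shows "Y \<in> N \<rightarrow>\<^sub>M N'"
proof -
  have "(\<lambda>\<omega>. \<omega>) \<in> N \<rightarrow>\<^sub>M past A"
    unfolding past_def using assms(1-3)
    by (intro measurable_vimage_algebra2 measurable_Pair measurable_restrict) auto
  from measurable_compose[OF this assms(4)] show ?thesis by simp
qed

lemma past_mono: "A \<subseteq> B \<Longrightarrow> Y \<in> past A \<rightarrow>\<^sub>M N \<Longrightarrow> Y \<in> past B \<rightarrow>\<^sub>M N"
  by (rule past_le[of "past B" A]) (auto intro: init_past sample_past)

lemma past_measurable: "Y \<in> past A \<rightarrow>\<^sub>M N \<Longrightarrow> Y \<in> M \<rightarrow>\<^sub>M N"
  by (rule past_le[of M A]) (auto intro: init_measurable sample_measurable)

lemma init_indep_samples: "indep_pair borel init (\<Pi>\<^sub>M l\<in>UNIV. P) (\<lambda>\<omega> l. \<xi> l \<omega>)"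
  unfolding indep_pair_def
proof (intro conjI init_measurable ballI)
  let ?s = "\<lambda>\<omega> l. \<xi> l \<omega>"
  show "?s \<in> M \<rightarrow>\<^sub>M (\<Pi>\<^sub>M l\<in>UNIV. P)"
    using measurable_restrict[of UNIV \<xi> M "\<lambda>_. P"] sample_measurable by (simp add: restrict_def)
  fix A :: "((real^'x) \<times> (real^'y) \<times> (real^'y)) set"
    and B :: "(sample_label \<Rightarrow> 's) set"
  assume AB: "A \<in> sets borel" "B \<in> sets (\<Pi>\<^sub>M l\<in>UNIV. P)"
  have "init -` A \<inter> space M \<in> sets (vimage_algebra (space M) init borel)"
    "?s -` B \<inter> space M \<in> sets (vimage_algebra (space M) ?s (\<Pi>\<^sub>M l\<in>UNIV. P))"
    using AB by (auto intro: in_vimage_algebra)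
  with init_indep have "prob ((init -` A \<inter> space M) \<inter> (?s -` B \<inter> space M))
      = prob (init -` A \<inter> space M) * prob (?s -` B \<inter> space M)"
    unfolding indep_sets2_eq by blast
  moreover have "(init -` A \<inter> space M) \<inter> (?s -` B \<inter> space M) = init -` A \<inter> ?s -` B \<inter> space M" by blast
  ultimately show "prob (init -` A \<inter> ?s -` B \<inter> space M)
      = prob (init -` A \<inter> space M) * prob (?s -` B \<inter> space M)" by simp
qed

lemma init_indep_restrict:
  "indep_pair borel init ((\<Pi>\<^sub>M l\<in>A. P) \<Otimes>\<^sub>M (\<Pi>\<^sub>M l\<in>B. P)) (\<lambda>\<omega>. (\<lambda>l\<in>A. \<xi> l \<omega>, \<lambda>l\<in>B. \<xi> l \<omega>))"
proof -
  have "(\<lambda>s. (restrict s A, restrict s B))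
      \<in> (\<Pi>\<^sub>M l\<in>UNIV. P) \<rightarrow>\<^sub>M (\<Pi>\<^sub>M l\<in>A. P) \<Otimes>\<^sub>M (\<Pi>\<^sub>M l\<in>B. P)"
    by (intro measurable_Pair measurable_restrict_subset) auto
  from indep_pair_compose[OF init_indep_samples measurable_ident_sets[OF refl] this]
  show ?thesis by simp
qed

text \<open>Two independences are glued: the initial point against all samples, and disjoint
  families of samples against each other. Together they make the law of the triple a product. Events
  of the past need not be rectangles, so the measure is computed slice by slice over the initial
  value.\<close>

lemma past_vars_indep:
  assumes "A \<inter> B = {}"
  shows "indep_pair (borel \<Otimes>\<^sub>M (\<Pi>\<^sub>M l\<in>A. P)) (\<lambda>\<omega>. (init \<omega>, \<lambda>l\<in>A. \<xi> l \<omega>))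
    (\<Pi>\<^sub>M l\<in>B. P) (\<lambda>\<omega>. \<lambda>l\<in>B. \<xi> l \<omega>)"
proof (rule indep_pairI_distr[OF past_vars_measurable])
  let ?PA = "\<Pi>\<^sub>M l\<in>A. P" and ?PB = "\<Pi>\<^sub>M l\<in>B. P"
  let ?a = "\<lambda>\<omega>. \<lambda>l\<in>A. \<xi> l \<omega>" and ?b = "\<lambda>\<omega>. \<lambda>l\<in>B. \<xi> l \<omega>"
  have a: "?a \<in> M \<rightarrow>\<^sub>M ?PA" and b: "?b \<in> M \<rightarrow>\<^sub>M ?PB"
    by (intro measurable_restrict sample_measurable)+
  define Q QA QB where "Q = distr M borel init" and "QA = distr M ?PA ?a" and "QB = distr M ?PB ?b"
  interpret QA: prob_space QA unfolding QA_def by (rule prob_space_distr[OF a])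
  interpret QB: prob_space QB unfolding QB_def by (rule prob_space_distr[OF b])
  interpret Q: prob_space Q unfolding Q_def by (rule prob_space_distr[OF init_measurable])
  interpret QAB: pair_prob_space QA QB ..
  have sets_Q: "sets Q = sets borel" "sets QA = sets ?PA" "sets QB = sets ?PB"
    by (simp_all add: Q_def QA_def QB_def)
  have ab: "distr M (?PA \<Otimes>\<^sub>M ?PB) (\<lambda>\<omega>. (?a \<omega>, ?b \<omega>)) = QA \<Otimes>\<^sub>M QB"
    using indep_var_restrict[OF samples_indep assms] by (simp add: indep_var_distribution_eq QA_def QB_def)
  have iab: "distr M (borel \<Otimes>\<^sub>M (?PA \<Otimes>\<^sub>M ?PB)) (\<lambda>\<omega>. (init \<omega>, (?a \<omega>, ?b \<omega>))) = Q \<Otimes>\<^sub>M (QA \<Otimes>\<^sub>M QB)"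
    using indep_pair_distr[OF init_indep_restrict[of A B]] by (simp add: ab Q_def)
  have "indep_pair borel init ?PA ?a"
    using indep_pair_compose[OF init_indep_restrict[of A B] measurable_ident_sets[OF refl] measurable_fst]
    by simp
  then have ia: "distr M (borel \<Otimes>\<^sub>M ?PA) (\<lambda>\<omega>. (init \<omega>, ?a \<omega>)) = Q \<Otimes>\<^sub>M QA"
    using indep_pair_distr by (simp add: QA_def Q_def)
  show "?b \<in> M \<rightarrow>\<^sub>M ?PB" by (rule b)
  fix S :: "(((real^'x) \<times> (real^'y) \<times> (real^'y)) \<times> (sample_label \<Rightarrow> 's)) set" and R
  assume S': "S \<in> sets (borel \<Otimes>\<^sub>M ?PA)" and R': "R \<in> sets ?PB"
  have S: "S \<in> sets (Q \<Otimes>\<^sub>M QA)" using S' by (simp add: sets_Q cong: sets_pair_measure_cong)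
  have R: "R \<in> sets QB" using R' by (simp add: sets_Q)
  show "emeasure M ((\<lambda>\<omega>. (init \<omega>, ?a \<omega>)) -` S \<inter> ?b -` R \<inter> space M)
      = emeasure (distr M (borel \<Otimes>\<^sub>M ?PA) (\<lambda>\<omega>. (init \<omega>, ?a \<omega>))) S * emeasure (distr M ?PB ?b) R"
  proof -
    define C where "C = {u \<in> space (Q \<Otimes>\<^sub>M (QA \<Otimes>\<^sub>M QB)). (fst u, fst (snd u)) \<in> S \<and> snd (snd u) \<in> R}"
    have C: "C \<in> sets (Q \<Otimes>\<^sub>M (QA \<Otimes>\<^sub>M QB))"
      unfolding C_def using S R by measurable
    have sp: "space (Q \<Otimes>\<^sub>M (QA \<Otimes>\<^sub>M QB)) = space (borel \<Otimes>\<^sub>M (?PA \<Otimes>\<^sub>M ?PB))"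
      by (intro sets_eq_imp_space_eq) (simp add: sets_Q cong: sets_pair_measure_cong)
    have m2: "(\<lambda>\<omega>. (init \<omega>, (?a \<omega>, ?b \<omega>))) \<in> M \<rightarrow>\<^sub>M borel \<Otimes>\<^sub>M (?PA \<Otimes>\<^sub>M ?PB)"
      by (intro measurable_Pair init_measurable a b)
    have "(\<lambda>\<omega>. (init \<omega>, ?a \<omega>)) -` S \<inter> ?b -` R \<inter> space M
        = (\<lambda>\<omega>. (init \<omega>, (?a \<omega>, ?b \<omega>))) -` C \<inter> space M"
      using measurable_space[OF m2] unfolding C_def sp by auto
    then have "emeasure M ((\<lambda>\<omega>. (init \<omega>, ?a \<omega>)) -` S \<inter> ?b -` R \<inter> space M) = emeasure (Q \<Otimes>\<^sub>M (QA \<Otimes>\<^sub>M QB)) C"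
      unfolding iab[symmetric] using C
      by (subst emeasure_distr[OF m2]) (simp_all add: sets_Q cong: sets_pair_measure_cong)
    also have "\<dots> = (\<integral>\<^sup>+q. emeasure (QA \<Otimes>\<^sub>M QB) (Pair q -` C) \<partial>Q)"
      by (rule QAB.P.emeasure_pair_measure_alt[OF C])
    also have "\<dots> = (\<integral>\<^sup>+q. emeasure QA (Pair q -` S) * emeasure QB R \<partial>Q)"
    proof (rule nn_integral_cong)
      fix q assume q: "q \<in> space Q"
      \<comment> \<open>For a fixed initial value the slice is a rectangle, and the factor that
        belongs to \<open>R\<close> does not depend on that value.\<close>
      have "Pair q -` C = (Pair q -` S) \<times> R"
        using q sets.sets_into_space[OF S] sets.sets_into_space[OF R]
        by (auto simp: C_def space_pair_measure)
      moreover have "Pair q -` S \<in> sets QA" using sets_Pair1[OF S] .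
      ultimately show "emeasure (QA \<Otimes>\<^sub>M QB) (Pair q -` C) = emeasure QA (Pair q -` S) * emeasure QB R"
        using R by (simp add: QB.emeasure_pair_measure_Times)
    qed
    also have "\<dots> = emeasure (Q \<Otimes>\<^sub>M QA) S * emeasure QB R"
      using QA.measurable_emeasure_Pair[OF S]
      by (simp add: nn_integral_multc QA.emeasure_pair_measure_alt[OF S])
    finally show ?thesis unfolding ia QB_def .
  qed
qed

text \<open>Injective labels select distinct coordinates of the product law of all samples.\<close>

lemma batch_distr:
  assumes "1 \<le> b" "inj_on lab {..<b}"
  shows "distr M (batch_measure P b) (\<lambda>\<omega>. \<lambda>j\<in>{..<b}. \<xi> (lab j) \<omega>) = batch_measure P b"
proof -
  let ?s = "\<lambda>\<omega> l. \<xi> l \<omega>" and ?r = "\<lambda>s. \<lambda>j\<in>{..<b}. s (lab j)"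
  have all: "distr M (\<Pi>\<^sub>M l\<in>UNIV. P) ?s = (\<Pi>\<^sub>M l\<in>UNIV. P)"
    using indep_vars_iff_distr_eq_PiM[where I = UNIV and M' = "\<lambda>_. P" and X = \<xi>] samples_indep sample_measurable samples_distr
    by (simp add: restrict_def)
  have r: "?r \<in> (\<Pi>\<^sub>M l\<in>UNIV. P) \<rightarrow>\<^sub>M (\<Pi>\<^sub>M j\<in>{..<b}. P)"
    by (intro measurable_restrict measurable_component_singleton) simp
  have s: "?s \<in> M \<rightarrow>\<^sub>M (\<Pi>\<^sub>M l\<in>UNIV. P)" using init_indep_samples by (simp add: indep_pair_def)
  have "distr M (\<Pi>\<^sub>M j\<in>{..<b}. P) (\<lambda>\<omega>. \<lambda>j\<in>{..<b}. \<xi> (lab j) \<omega>)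
      = distr (\<Pi>\<^sub>M l\<in>UNIV. P) (\<Pi>\<^sub>M j\<in>{..<b}. P) ?r"
    using distr_distr[OF r s, unfolded all] by (simp add: comp_def)
  also have "\<dots> = (\<Pi>\<^sub>M j\<in>{..<b}. P)"
    by (rule distr_PiM_reindex[of UNIV "\<lambda>_. P" lab "{..<b}"]) (use assms prob_space_P in auto)
  finally show ?thesis by (simp add: batch_measure_def)
qed

lemma batch_indep:
  assumes X: "X \<in> past A \<rightarrow>\<^sub>M N" and lab: "lab ` {..<b} \<inter> A = {}"
  shows "indep_pair N X (batch_measure P b) (\<lambda>\<omega>. \<lambda>j\<in>{..<b}. \<xi> (lab j) \<omega>)"
proof -
  let ?B = "lab ` {..<b}"
  let ?U = "\<lambda>\<omega>. (init \<omega>, \<lambda>l\<in>A. \<xi> l \<omega>)" and ?V = "\<lambda>\<omega>. \<lambda>l\<in>?B. \<xi> l \<omega>"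
  have g: "(\<lambda>s. \<lambda>j\<in>{..<b}. s (lab j)) \<in> (\<Pi>\<^sub>M l\<in>?B. P) \<rightarrow>\<^sub>M batch_measure P b"
    unfolding batch_measure_def by (intro measurable_restrict measurable_component_singleton) auto
  have "?B \<inter> A = {}" by fact
  then have "A \<inter> ?B = {}" by blast
  from indep_pair_compose[OF past_vars_indep[OF this] measurable_ident_sets[OF refl] g]
  have ind: "indep_pair (borel \<Otimes>\<^sub>M (\<Pi>\<^sub>M l\<in>A. P)) ?U (batch_measure P b) (\<lambda>\<omega>. \<lambda>j\<in>{..<b}. \<xi> (lab j) \<omega>)"
    by (simp cong: restrict_cong)
  show ?thesis
    unfolding indep_pair_def
  proof (intro conjI ballI past_measurable[OF X])
    show "(\<lambda>\<omega>. \<lambda>j\<in>{..<b}. \<xi> (lab j) \<omega>) \<in> M \<rightarrow>\<^sub>M batch_measure P b"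
      using ind by (simp add: indep_pair_def)
    fix S R assume S: "S \<in> sets N" and R: "R \<in> sets (batch_measure P b)"
    have "X -` S \<inter> space M \<in> sets (past A)" using measurable_sets[OF X S] by simp
    then obtain C where C: "C \<in> sets (borel \<Otimes>\<^sub>M (\<Pi>\<^sub>M l\<in>A. P))" "X -` S \<inter> space M = ?U -` C \<inter> space M"
      unfolding past_def
      by (subst (asm) sets_vimage_algebra2) (use measurable_space[OF past_vars_measurable] in auto)
    have "X -` S \<inter> W \<inter> space M = ?U -` C \<inter> W \<inter> space M" for W using C(2) by blast
    then show "prob (X -` S \<inter> (\<lambda>\<omega>. \<lambda>j\<in>{..<b}. \<xi> (lab j) \<omega>) -` R \<inter> space M)
        = prob (X -` S \<inter> space M) * prob ((\<lambda>\<omega>. \<lambda>j\<in>{..<b}. \<xi> (lab j) \<omega>) -` R \<inter> space M)"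
      using ind C R by (simp add: indep_pair_def)
  qed
qed

text \<open>This does the work of conditioning on the past: the state \<open>X\<close> and the fresh
  batch have a product law, so a bound \<open>kernel\<close> valid for each fixed state may be
  integrated over the state. \<open>\<phi>_restrict\<close> bridges two encodings of a batch: the
  algorithm passes a function on all numbers, the measure lives on functions on
  \<open>{..<b}\<close>.\<close>

lemma mean_le_fresh:
  assumes X: "X \<in> past A \<rightarrow>\<^sub>M N"
    and b: "1 \<le> b" "inj_on lab {..<b}" and lab: "lab ` {..<b} \<inter> A = {}"
    and \<phi>: "(\<lambda>(x, D). \<phi> x D) \<in> borel_measurable (N \<Otimes>\<^sub>M batch_measure P b)" "\<And>x D. 0 \<le> \<phi> x D"
    and \<phi>_restrict: "\<And>x D. \<phi> x (restrict D {..<b}) = \<phi> x D"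
    and kernel: "\<And>x. (\<integral>\<^sup>+D. ennreal (\<phi> x D) \<partial>batch_measure P b) \<le> ennreal (\<psi> x)"
    and \<psi>: "\<And>x. 0 \<le> \<psi> x" "mean_le M (\<lambda>\<omega>. \<psi> (X \<omega>)) r"
  shows "mean_le M (\<lambda>\<omega>. \<phi> (X \<omega>) (\<lambda>j. \<xi> (lab j) \<omega>)) r"
proof -
  let ?BM = "batch_measure P b"
  interpret B: prob_space ?BM by (rule prob_space_batch[OF prob_space_P])
  let ?Y = "\<lambda>\<omega>. \<lambda>j\<in>{..<b}. \<xi> (lab j) \<omega>"
  have XM: "X \<in> M \<rightarrow>\<^sub>M N" by (rule past_measurable[OF X])
  have YM: "?Y \<in> M \<rightarrow>\<^sub>M ?BM"
    unfolding batch_measure_def by (intro measurable_restrict sample_measurable)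
  have joint: "distr M (N \<Otimes>\<^sub>M ?BM) (\<lambda>\<omega>. (X \<omega>, ?Y \<omega>)) = distr M N X \<Otimes>\<^sub>M ?BM"
    using indep_pair_distr[OF batch_indep[OF X lab]] by (simp add: batch_distr[OF b])
  have eq: "\<phi> (X \<omega>) (\<lambda>j. \<xi> (lab j) \<omega>) = (case (X \<omega>, ?Y \<omega>) of (x, D) \<Rightarrow> \<phi> x D)" for \<omega>
    using \<phi>_restrict[of "X \<omega>" "\<lambda>j. \<xi> (lab j) \<omega>"] by simp
  have [measurable]: "(\<lambda>(x, D). \<phi> x D) \<in> borel_measurable (N \<Otimes>\<^sub>M ?BM)" by fact
  have \<phi>': "(\<lambda>u. ennreal (case u of (x, D) \<Rightarrow> \<phi> x D)) \<in> borel_measurable (N \<Otimes>\<^sub>M ?BM)" by measurable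
  have "(\<integral>\<^sup>+\<omega>. ennreal (\<phi> (X \<omega>) (\<lambda>j. \<xi> (lab j) \<omega>)) \<partial>M)
      = (\<integral>\<^sup>+u. ennreal (case u of (x, D) \<Rightarrow> \<phi> x D) \<partial>(distr M N X \<Otimes>\<^sub>M ?BM))"
    unfolding eq joint[symmetric] by (rule nn_integral_distr[symmetric, OF measurable_Pair[OF XM YM]]) (use \<phi>' in simp)
  also have "\<dots> = (\<integral>\<^sup>+x. \<integral>\<^sup>+D. ennreal (\<phi> x D) \<partial>?BM \<partial>distr M N X)"
    using \<phi>' by (subst B.nn_integral_fst[symmetric]) (auto cong: measurable_cong_sets sets_pair_measure_cong)
  also have "\<dots> = (\<integral>\<^sup>+\<omega>. \<integral>\<^sup>+D. ennreal (\<phi> (X \<omega>) D) \<partial>?BM \<partial>M)"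
    using B.borel_measurable_nn_integral_fst[OF \<phi>'] by (intro nn_integral_distr XM) simp
  also have "\<dots> \<le> (\<integral>\<^sup>+\<omega>. ennreal (\<psi> (X \<omega>)) \<partial>M)" by (intro nn_integral_mono kernel)
  also have "\<dots> = ennreal (LINT \<omega>|M. \<psi> (X \<omega>))"
    using \<psi> by (intro nn_integral_eq_integral) (auto simp: mean_le_def)
  also have "\<dots> \<le> ennreal r" using \<psi>(2) by (simp add: mean_le_def ennreal_leI)
  finally show ?thesis
  proof (intro mean_le_nn_integralI)
    show "(\<lambda>\<omega>. \<phi> (X \<omega>) (\<lambda>j. \<xi> (lab j) \<omega>)) \<in> borel_measurable M"
      unfolding eq by (rule measurable_compose[OF measurable_Pair[OF XM YM]]) fact
    show "0 \<le> r" using mean_le_nonneg[OF \<psi>(2)] \<psi>(1) .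
  qed (use \<phi>(2) in auto)
qed

lemma past_batch:
  assumes X: "X \<in> past A \<rightarrow>\<^sub>M N" and lab: "\<And>j. j < b \<Longrightarrow> lab j \<in> A"
    and F: "(\<lambda>(x, D). F x D) \<in> N \<Otimes>\<^sub>M batch_measure P b \<rightarrow>\<^sub>M N'"
    and F_restrict: "\<And>x D. F x (restrict D {..<b}) = F x D"
  shows "(\<lambda>\<omega>. F (X \<omega>) (\<lambda>j. \<xi> (lab j) \<omega>)) \<in> past A \<rightarrow>\<^sub>M N'"
proof -
  have "(\<lambda>\<omega>. \<lambda>j\<in>{..<b}. \<xi> (lab j) \<omega>) \<in> past A \<rightarrow>\<^sub>M batch_measure P b"
    unfolding batch_measure_def by (intro measurable_restrict sample_past lab) simp
  from measurable_compose[OF measurable_Pair[OF X this] F] show ?thesis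
    using F_restrict[of _ "\<lambda>j. \<xi> (lab j) _"] by simp
qed

end

lemma batch_avg_restrict [simp]: "batch_avg b h (restrict D {..<b}) = batch_avg b h D"
  by (simp add: batch_avg_def fun_eq_iff)

section \<open>The iterates\<close>

definition var_g :: "bilevel_consts \<Rightarrow> batch_sizes \<Rightarrow> real" where
  "var_g p bs = (sd_g p)\<^sup>2 / real (size_g bs)"

definition var_f :: "bilevel_consts \<Rightarrow> batch_sizes \<Rightarrow> real" where
  "var_f p bs = (sd_f p)\<^sup>2 / real (size_f bs)"

fun outer_index :: "sample_label \<Rightarrow> nat" where
  "outer_index (Sample_g k t j) = k"
| "outer_index (Sample_f k j) = k"
| "outer_index (Sample_gyy k n j) = k"
| "outer_index (Sample_gxy k j) = k"

text \<open>The sets \<open>known\<close>, \<open>known_g\<close>, \<open>known_f\<close>,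
  \<open>known_gyy\<close> follow the order of sampling within an outer iteration and index the
  filtration \<open>past\<close>. They may contain labels that are never drawn, such as inner index
  0 or indices beyond \<open>T_choice p\<close>; what matters is that the batch drawn next is
  disjoint from them.\<close>

definition known :: "nat \<Rightarrow> sample_label set" where
  "known k = {l. outer_index l < k}"

definition known_g :: "nat \<Rightarrow> nat \<Rightarrow> sample_label set" where
  "known_g k t = known k \<union> {Sample_g k t' j | t' j. t' \<le> t}"

definition known_f :: "nat \<Rightarrow> sample_label set" where
  "known_f k = known k \<union> {Sample_g k t j | t j. True} \<union> {Sample_f k j | j. True}"

definition known_gyy :: "nat \<Rightarrow> nat \<Rightarrow> sample_label set" where
  "known_gyy k n = known_f k \<union> {Sample_gyy k n' j | n' j. n' \<le> n}"

lemmas known_defs = known_def known_g_def known_f_def known_gyy_def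

lemma known_subsets:
  "known k \<subseteq> known_g k t" "known_g k t \<subseteq> known_g k (Suc t)" "known_g k t \<subseteq> known_f k"
  "known_f k \<subseteq> known_gyy k n" "known_gyy k n \<subseteq> known_gyy k (Suc n)"
  "known_gyy k n \<subseteq> known (Suc k)"
  by (auto simp: known_defs)

lemma batch_avg_if [simp]: "batch_avg b h (\<lambda>j. if j < b then D j else d) = batch_avg b h D"
  by (simp add: batch_avg_def fun_eq_iff)

lemma norm_sq_add2: "(norm (a + b))\<^sup>2 \<le> 2 * (norm a)\<^sup>2 + 2 * (norm b)\<^sup>2"
  for a b :: "'a::real_normed_vector"
proof -
  have "(norm (a + b))\<^sup>2 \<le> (norm a + norm b)\<^sup>2" by (intro power_mono norm_triangle_ineq) simp
  also have "\<dots> \<le> 2 * (norm a)\<^sup>2 + 2 * (norm b)\<^sup>2"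
    using sum_squares_bound[of "norm a" "norm b"] by (simp add: power2_sum)
  finally show ?thesis .
qed

lemma norm_sq_add3: "(norm (a + b + c))\<^sup>2 \<le> 3 * (norm a)\<^sup>2 + 3 * (norm b)\<^sup>2 + 3 * (norm c)\<^sup>2"
  for a b c :: "'a::real_normed_vector"
proof -
  have "(norm (a + b + c))\<^sup>2 \<le> (norm a + norm b + norm c)\<^sup>2"
    by (intro power_mono order_trans[OF norm_triangle_ineq] add_right_mono norm_triangle_ineq) simp
  also have "\<dots> \<le> 3 * (norm a)\<^sup>2 + 3 * (norm b)\<^sup>2 + 3 * (norm c)\<^sup>2"
    using sum_squares_bound[of "norm a" "norm b"] sum_squares_bound[of "norm a" "norm c"]
      sum_squares_bound[of "norm b" "norm c"]
    by (simp add: power2_eq_square algebra_simps)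
  finally show ?thesis .
qed

text \<open>The last assumption makes the loop for \<open>z\<close> contract in mean square in spite
  of its multiplicative noise. In \<open>amigo_rates\<close> it is derived from the batch
  sizes.\<close>

locale amigo_process = stochastic_bilevel f g fh gh P p + amigo_randomness M P \<xi> init
  for f g :: "real^'x \<Rightarrow> real^'y \<Rightarrow> real"
    and fh gh :: "real^'x \<Rightarrow> real^'y \<Rightarrow> 's \<Rightarrow> real"
    and P :: "'s measure" and p :: bilevel_consts and M :: "'w measure"
    and \<xi> :: "sample_label \<Rightarrow> 'w \<Rightarrow> 's"
    and init :: "'w \<Rightarrow> (real^'x) \<times> (real^'y) \<times> (real^'y)" +
  fixes bs :: batch_sizes
  assumes sizes_pos: "1 \<le> size_g bs" "1 \<le> size_f bs" "1 \<le> size_gyy bs" "1 \<le> size_gxy bs"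
    and var_gyy_small: "var_gyy p bs \<le> mug p * Lg p / 2"
begin

definition xk :: "nat \<Rightarrow> 'w \<Rightarrow> real^'x" where
  "xk k \<omega> = fst (amigo_run fh gh p bs \<xi> init k \<omega>)"

definition yprev :: "nat \<Rightarrow> 'w \<Rightarrow> real^'y" where
  "yprev k \<omega> = fst (snd (amigo_run fh gh p bs \<xi> init k \<omega>))"

definition zprev :: "nat \<Rightarrow> 'w \<Rightarrow> real^'y" where
  "zprev k \<omega> = snd (snd (amigo_run fh gh p bs \<xi> init k \<omega>))"

definition y_it :: "nat \<Rightarrow> nat \<Rightarrow> 'w \<Rightarrow> real^'y" where
  "y_it k t \<omega> = y_inner (step_alpha p) (xk k \<omega>)
     (\<lambda>t. batch_avg (size_g bs) gh (\<lambda>j. \<xi> (Sample_g k t j) \<omega>)) (yprev k \<omega>) t"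

definition yk :: "nat \<Rightarrow> 'w \<Rightarrow> real^'y" where
  "yk k = y_it k (T_choice p)"

definition uk :: "nat \<Rightarrow> 'w \<Rightarrow> real^'x" where
  "uk k \<omega> = dx (batch_avg (size_f bs) fh (\<lambda>j. \<xi> (Sample_f k j) \<omega>)) (xk k \<omega>) (yk k \<omega>)"

definition vk :: "nat \<Rightarrow> 'w \<Rightarrow> real^'y" where
  "vk k \<omega> = dy (batch_avg (size_f bs) fh (\<lambda>j. \<xi> (Sample_f k j) \<omega>)) (xk k \<omega>) (yk k \<omega>)"

definition z_it :: "nat \<Rightarrow> nat \<Rightarrow> 'w \<Rightarrow> real^'y" where
  "z_it k n \<omega> = z_inner (step_beta p)
     (\<lambda>n. dyy (batch_avg (size_gyy bs) gh (\<lambda>j. \<xi> (Sample_gyy k n j) \<omega>)) (xk k \<omega>) (yk k \<omega>))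
     (vk k \<omega>) (zprev k \<omega>) n"

definition zk :: "nat \<Rightarrow> 'w \<Rightarrow> real^'y" where
  "zk k = z_it k (N_choice p bs)"

definition psik :: "nat \<Rightarrow> 'w \<Rightarrow> real^'x" where
  "psik k \<omega> = uk k \<omega>
     + dxy (batch_avg (size_gxy bs) gh (\<lambda>j. \<xi> (Sample_gxy k j) \<omega>)) (xk k \<omega>) (yk k \<omega>) *v zk k \<omega>"

lemma run_Suc:
  "xk (Suc k) \<omega> = xk k \<omega> - step_gamma p *\<^sub>R psik k \<omega>"
  "yprev (Suc k) \<omega> = yk k \<omega>" "zprev (Suc k) \<omega> = zk k \<omega>"
  by (simp_all add: xk_def yprev_def zprev_def y_it_def yk_def uk_def vk_def z_it_def zk_def psik_def
      amigo_run_def amigo_step_def Let_def case_prod_unfold)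

lemma y_it_simps:
  "y_it k 0 \<omega> = yprev k \<omega>"
  "y_it k (Suc t) \<omega> = y_it k t \<omega> - (1 / Lg p) *\<^sub>R
     dy (batch_avg (size_g bs) gh (\<lambda>j. \<xi> (Sample_g k (Suc t) j) \<omega>)) (xk k \<omega>) (y_it k t \<omega>)"
  by (simp_all add: y_it_def step_alpha_def)

lemma z_it_simps:
  "z_it k 0 \<omega> = zprev k \<omega>"
  "z_it k (Suc n) \<omega> = z_it k n \<omega> - (1 / (2 * Lg p)) *\<^sub>R
     (dyy (batch_avg (size_gyy bs) gh (\<lambda>j. \<xi> (Sample_gyy k (Suc n) j) \<omega>)) (xk k \<omega>) (yk k \<omega>) *v z_it k n \<omega> + vk k \<omega>)"
  by (simp_all add: z_it_def step_beta_def)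

lemma compose_state:
  fixes a :: "'q \<Rightarrow> 'a::euclidean_space" and b :: "'q \<Rightarrow> 'b::euclidean_space"
  assumes "(\<lambda>((x, y), D). F x y D) \<in> borel_measurable (borel \<Otimes>\<^sub>M N)"
    and "a \<in> borel_measurable Q" "b \<in> borel_measurable Q"
  shows "(\<lambda>u. F (a (fst u)) (b (fst u)) (snd u)) \<in> borel_measurable (Q \<Otimes>\<^sub>M N)"
proof -
  have "(\<lambda>u. ((a (fst u), b (fst u)), snd u)) \<in> Q \<Otimes>\<^sub>M N \<rightarrow>\<^sub>M borel \<Otimes>\<^sub>M N"
    by (intro measurable_Pair borel_measurable_Pair measurable_compose[OF measurable_fst assms(2)]
        measurable_compose[OF measurable_fst assms(3)] measurable_snd)
  from measurable_compose[OF this assms(1)] show ?thesis by simp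
qed

lemma past_derivatives:
  assumes x: "x \<in> borel_measurable (past A)" and y: "y \<in> borel_measurable (past A)"
    and lab: "\<And>j. j < b \<Longrightarrow> lab j \<in> A"
  shows "(\<lambda>\<omega>. dx (batch_avg b fh (\<lambda>j. \<xi> (lab j) \<omega>)) (x \<omega>) (y \<omega>)) \<in> borel_measurable (past A)"
    "(\<lambda>\<omega>. dy (batch_avg b fh (\<lambda>j. \<xi> (lab j) \<omega>)) (x \<omega>) (y \<omega>)) \<in> borel_measurable (past A)"
    "(\<lambda>\<omega>. dy (batch_avg b gh (\<lambda>j. \<xi> (lab j) \<omega>)) (x \<omega>) (y \<omega>)) \<in> borel_measurable (past A)"
    "(\<lambda>\<omega>. dxy (batch_avg b gh (\<lambda>j. \<xi> (lab j) \<omega>)) (x \<omega>) (y \<omega>)) \<in> borel_measurable (past A)"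
    "(\<lambda>\<omega>. dyy (batch_avg b gh (\<lambda>j. \<xi> (lab j) \<omega>)) (x \<omega>) (y \<omega>)) \<in> borel_measurable (past A)"
proof -
  have *: "(\<lambda>\<omega>. F (x \<omega>) (y \<omega>) (\<lambda>j. \<xi> (lab j) \<omega>)) \<in> borel_measurable (past A)"
    if "(\<lambda>((x, y), D). F x y D) \<in> borel_measurable (borel \<Otimes>\<^sub>M batch_measure P b)"
      "\<And>x y D. F x y (restrict D {..<b}) = F x y D"
    for F :: "real^'x \<Rightarrow> real^'y \<Rightarrow> (nat \<Rightarrow> 's) \<Rightarrow> 'c::topological_space"
    using past_batch[OF borel_measurable_Pair[OF x y] lab, where F = "\<lambda>q. F (fst q) (snd q)" and N' = borel] that
    by (simp add: case_prod_unfold)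
  note bd = batch_derivatives_measurable[of b]
  show "(\<lambda>\<omega>. dx (batch_avg b fh (\<lambda>j. \<xi> (lab j) \<omega>)) (x \<omega>) (y \<omega>)) \<in> borel_measurable (past A)"
    "(\<lambda>\<omega>. dy (batch_avg b fh (\<lambda>j. \<xi> (lab j) \<omega>)) (x \<omega>) (y \<omega>)) \<in> borel_measurable (past A)"
    "(\<lambda>\<omega>. dy (batch_avg b gh (\<lambda>j. \<xi> (lab j) \<omega>)) (x \<omega>) (y \<omega>)) \<in> borel_measurable (past A)"
    "(\<lambda>\<omega>. dxy (batch_avg b gh (\<lambda>j. \<xi> (lab j) \<omega>)) (x \<omega>) (y \<omega>)) \<in> borel_measurable (past A)"
    "(\<lambda>\<omega>. dyy (batch_avg b gh (\<lambda>j. \<xi> (lab j) \<omega>)) (x \<omega>) (y \<omega>)) \<in> borel_measurable (past A)"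
    using *[OF bd(1)] *[OF bd(2)] *[OF bd(3)] *[OF bd(4)] *[OF bd(5)] by simp_all
qed

lemma y_it_past:
  assumes x: "xk k \<in> borel_measurable (past (known k))" and y: "yprev k \<in> borel_measurable (past (known k))"
  shows "y_it k t \<in> borel_measurable (past (known_g k t))"
proof (induction t)
  case 0
  show ?case using past_mono[OF known_subsets(1) y] by (simp add: y_it_simps cong: measurable_cong)
next
  case (Suc t)
  have "(\<lambda>\<omega>. y_it k (Suc t) \<omega>) \<in> borel_measurable (past (known_g k (Suc t)))"
    unfolding y_it_simps
    by (intro borel_measurable_diff borel_measurable_scaleR borel_measurable_const past_derivatives(3)
        past_mono[OF known_subsets(2) Suc] past_mono[OF known_subsets(1) x])
      (auto simp: known_g_def)
  then show ?case by simp
qed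

lemma z_it_past:
  assumes x: "xk k \<in> borel_measurable (past (known_f k))" and y: "yk k \<in> borel_measurable (past (known_f k))"
    and v: "vk k \<in> borel_measurable (past (known_f k))" and z: "zprev k \<in> borel_measurable (past (known_f k))"
  shows "z_it k n \<in> borel_measurable (past (known_gyy k n))"
proof (induction n)
  case 0
  show ?case using past_mono[OF known_subsets(4) z] by (simp add: z_it_simps cong: measurable_cong)
next
  case (Suc n)
  have "(\<lambda>\<omega>. z_it k (Suc n) \<omega>) \<in> borel_measurable (past (known_gyy k (Suc n)))"
    unfolding z_it_simps
    by (intro borel_measurable_diff borel_measurable_scaleR borel_measurable_const borel_measurable_add
        borel_measurable_matrix_vector past_derivatives(5)
        past_mono[OF known_subsets(5) Suc] past_mono[OF known_subsets(4) x] past_mono[OF known_subsets(4) y]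
        past_mono[OF known_subsets(4) v])
      (auto simp: known_gyy_def)
  then show ?case by simp
qed

lemma uv_past:
  assumes x: "xk k \<in> borel_measurable (past (known_f k))" and y: "yk k \<in> borel_measurable (past (known_f k))"
  shows "uk k \<in> borel_measurable (past (known_f k))" "vk k \<in> borel_measurable (past (known_f k))"
  using past_derivatives(1,2)[OF x y, of "size_f bs" "Sample_f k"]
  by (simp_all add: uk_def[abs_def] vk_def[abs_def] known_f_def)

text \<open>Adaptedness of the iterates. A single induction treats the three components, since the
  new \<open>x\<close> and \<open>z\<close> draw on all of the old ones.\<close>

lemma state_past:
  "xk k \<in> borel_measurable (past (known k)) \<and> yprev k \<in> borel_measurable (past (known k))
    \<and> zprev k \<in> borel_measurable (past (known k))"
proof (induction k)
  case 0
  have "(\<lambda>\<omega>. fst (init \<omega>)) \<in> borel_measurable (past (known 0))"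
    "(\<lambda>\<omega>. fst (snd (init \<omega>))) \<in> borel_measurable (past (known 0))"
    "(\<lambda>\<omega>. snd (snd (init \<omega>))) \<in> borel_measurable (past (known 0))"
    by (intro borel_measurable_fst_borel borel_measurable_snd_borel init_past)+
  then show ?case by (simp add: xk_def[abs_def] yprev_def[abs_def] zprev_def[abs_def] amigo_run_def)
next
  case (Suc k)
  then have x: "xk k \<in> borel_measurable (past (known k))" and yp: "yprev k \<in> borel_measurable (past (known k))"
    and zp: "zprev k \<in> borel_measurable (past (known k))" by simp_all
  have kf: "known k \<subseteq> known_f k" using known_subsets(1,3) by blast
  have ky: "yk k \<in> borel_measurable (past (known_f k))"
    unfolding yk_def by (rule past_mono[OF known_subsets(3) y_it_past[OF x yp]])
  have xf: "xk k \<in> borel_measurable (past (known_f k))" by (rule past_mono[OF kf x])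
  have zf: "zprev k \<in> borel_measurable (past (known_f k))" by (rule past_mono[OF kf zp])
  note uv = uv_past[OF xf ky]
  have fS: "known_f k \<subseteq> known (Suc k)" using known_subsets(4,6) by blast
  have zk: "zk k \<in> borel_measurable (past (known (Suc k)))"
    unfolding zk_def by (rule past_mono[OF known_subsets(6) z_it_past[OF xf ky uv(2) zf]])
  have "(\<lambda>\<omega>. xk (Suc k) \<omega>) \<in> borel_measurable (past (known (Suc k)))"
    unfolding run_Suc psik_def
    by (intro borel_measurable_diff borel_measurable_scaleR borel_measurable_const borel_measurable_add
        borel_measurable_matrix_vector past_derivatives(4) zk
        past_mono[OF fS xf] past_mono[OF fS ky] past_mono[OF fS uv(1)])
      (auto simp: known_def)
  moreover have "yprev (Suc k) = yk k" "zprev (Suc k) = zk k" by (simp_all add: run_Suc fun_eq_iff)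
  ultimately show ?case using zk past_mono[OF fS ky] by simp
qed

lemma
  shows xk_known_g: "xk k \<in> borel_measurable (past (known_g k t))"
    and y_it_known_g: "y_it k t \<in> borel_measurable (past (known_g k t))"
    and xk_known_f: "xk k \<in> borel_measurable (past (known_f k))"
    and yk_known_f: "yk k \<in> borel_measurable (past (known_f k))"
    and uk_known_f: "uk k \<in> borel_measurable (past (known_f k))"
    and vk_known_f: "vk k \<in> borel_measurable (past (known_f k))"
    and z_it_known_gyy: "z_it k n \<in> borel_measurable (past (known_gyy k n))"
proof -
  have x: "xk k \<in> borel_measurable (past (known k))" and yp: "yprev k \<in> borel_measurable (past (known k))"
    and zp: "zprev k \<in> borel_measurable (past (known k))" using state_past by simp_all
  have kf: "known k \<subseteq> known_f k" using known_subsets(1,3) by blast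
  show "xk k \<in> borel_measurable (past (known_g k t))" by (rule past_mono[OF known_subsets(1) x])
  show "y_it k t \<in> borel_measurable (past (known_g k t))" by (rule y_it_past[OF x yp])
  show yf: "yk k \<in> borel_measurable (past (known_f k))"
    unfolding yk_def by (rule past_mono[OF known_subsets(3) y_it_past[OF x yp]])
  show xf: "xk k \<in> borel_measurable (past (known_f k))" by (rule past_mono[OF kf x])
  show "uk k \<in> borel_measurable (past (known_f k))" and vf: "vk k \<in> borel_measurable (past (known_f k))"
    by (rule uv_past[OF xf yf])+
  show "z_it k n \<in> borel_measurable (past (known_gyy k n))"
    by (rule z_it_past[OF xf yf vf past_mono[OF kf zp]])
qed

lemma fst_snd_measurable:
  "(fst :: 'a::euclidean_space \<times> 'b::euclidean_space \<Rightarrow> 'a) \<in> borel_measurable borel"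
  "(snd :: 'a::euclidean_space \<times> 'b::euclidean_space \<Rightarrow> 'b) \<in> borel_measurable borel"
  by (intro borel_measurable_continuous_onI continuous_intros)+

lemma ystar_measurable [measurable]: "ystar g \<in> borel_measurable borel"
  by (rule borel_measurable_continuous_onI[OF continuous_ystar])

lemma zsol_measurable:
  assumes "x \<in> borel_measurable N" "y \<in> borel_measurable N" "v \<in> borel_measurable N"
  shows "(\<lambda>\<omega>. zsol g (x \<omega>) (y \<omega>) (v \<omega>)) \<in> borel_measurable N"
  using measurable_compose[OF borel_measurable_Pair[OF assms(1) borel_measurable_Pair[OF assms(2,3)]]
      borel_measurable_continuous_onI[OF continuous_zsol]] by simp

lemma zstar_measurable:
  assumes "x \<in> borel_measurable N" "y \<in> borel_measurable N"
  shows "(\<lambda>\<omega>. zstar f g (x \<omega>) (y \<omega>)) \<in> borel_measurable N"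
  using measurable_compose[OF borel_measurable_Pair[OF assms]
      borel_measurable_continuous_onI[OF continuous_zstar]] by simp

lemma grad_outer_measurable [measurable]: "grad (outer_obj f g) \<in> borel_measurable borel"
  by (rule borel_measurable_continuous_onI[OF continuous_grad_outer])

lemma outer_measurable [measurable]: "outer_obj f g \<in> borel_measurable borel"
  by (rule borel_measurable_continuous_onI[OF continuous_outer])

lemma process_measurable [measurable]:
  "xk k \<in> borel_measurable M" "y_it k t \<in> borel_measurable M" "yk k \<in> borel_measurable M"
  "uk k \<in> borel_measurable M" "vk k \<in> borel_measurable M" "z_it k n \<in> borel_measurable M"
  "zk k \<in> borel_measurable M" "yprev k \<in> borel_measurable M" "zprev k \<in> borel_measurable M"
  using xk_known_f y_it_known_g yk_known_f uk_known_f vk_known_f z_it_known_gyy state_past past_measurable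
  unfolding zk_def by blast+

section \<open>Mean square errors of the inner loops and of the estimated derivatives\<close>

lemma mean_y_step:
  assumes "mean_le M (\<lambda>\<omega>. (norm (y_it k t \<omega> - ystar g (xk k \<omega>)))\<^sup>2) r"
  shows "mean_le M (\<lambda>\<omega>. (norm (y_it k (Suc t) \<omega> - ystar g (xk k \<omega>)))\<^sup>2)
    ((1 - mug p / Lg p) * r + (1 / Lg p)\<^sup>2 * var_g p bs)"
proof -
  let ?b = "size_g bs"
  let ?\<phi> = "\<lambda>(q :: (real^'x) \<times> (real^'y)) D. (norm (snd q - (1 / Lg p) *\<^sub>R dy (batch_avg ?b gh D) (fst q) (snd q) - ystar g (fst q)))\<^sup>2"
  let ?\<psi> = "\<lambda>q :: (real^'x) \<times> (real^'y). (1 - mug p / Lg p) * (norm (snd q - ystar g (fst q)))\<^sup>2 + (1 / Lg p)\<^sup>2 * var_g p bs"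
  have ge: "0 \<le> 1 - mug p / Lg p" using ssc.m_le_L Lg_pos by simp
  have "mean_le M (\<lambda>\<omega>. ?\<phi> (xk k \<omega>, y_it k t \<omega>) (\<lambda>j. \<xi> (Sample_g k (Suc t) j) \<omega>))
    ((1 - mug p / Lg p) * r + (1 / Lg p)\<^sup>2 * var_g p bs)"
  proof (rule mean_le_fresh[where A = "known_g k t" and \<psi> = ?\<psi> and b = ?b and N = borel])
    show "(\<lambda>\<omega>. (xk k \<omega>, y_it k t \<omega>)) \<in> borel_measurable (past (known_g k t))"
      by (intro borel_measurable_Pair xk_known_g y_it_known_g)
    show "1 \<le> ?b" by (rule sizes_pos)
    show "inj_on (Sample_g k (Suc t)) {..<?b}" by (auto simp: inj_on_def)
    show "Sample_g k (Suc t) ` {..<?b} \<inter> known_g k t = {}" by (auto simp: known_defs)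
    note [measurable] = fst_snd_measurable compose_state[OF batch_derivatives_measurable(3)[of ?b] fst_snd_measurable]
    show "(\<lambda>(q, D). ?\<phi> q D) \<in> borel_measurable (borel \<Otimes>\<^sub>M batch_measure P ?b)"
      unfolding case_prod_unfold by measurable
    show "(\<integral>\<^sup>+D. ennreal (?\<phi> q D) \<partial>batch_measure P ?b) \<le> ennreal (?\<psi> q)" for q
      using batch_y_step_error[OF sizes_pos(1)] by (simp add: var_g_def)
    show "0 \<le> ?\<psi> q" for q using ge by (simp add: var_g_def)
    show "mean_le M (\<lambda>\<omega>. ?\<psi> (xk k \<omega>, y_it k t \<omega>)) ((1 - mug p / Lg p) * r + (1 / Lg p)\<^sup>2 * var_g p bs)"
      using mean_le_add[OF mean_le_cmult[OF assms ge] mean_le_const[OF order_refl]] by simp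
  qed simp_all
  then show ?thesis by (simp add: y_it_simps)
qed

text \<open>The additive term is the fixed point of the noise recursion in
  \<open>mean_y_step\<close>: summing the geometric series turns \<open>(1 / Lg p)\<^sup>2\<close>
  into \<open>1 / (Lg p * mug p)\<close>.\<close>

lemma mean_y_it:
  assumes "mean_le M (\<lambda>\<omega>. (norm (yprev k \<omega> - ystar g (xk k \<omega>)))\<^sup>2) r"
  shows "mean_le M (\<lambda>\<omega>. (norm (y_it k t \<omega> - ystar g (xk k \<omega>)))\<^sup>2)
    ((1 - mug p / Lg p) ^ t * r + var_g p bs / (Lg p * mug p))"
proof (induction t)
  case 0
  have "0 \<le> var_g p bs / (Lg p * mug p)" using Lg_pos consts_pos by (simp add: var_g_def)
  then show ?case using mean_le_trans[OF assms] by (simp add: y_it_simps)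
next
  case (Suc t)
  have "(1 - mug p / Lg p) * ((1 - mug p / Lg p) ^ t * r + var_g p bs / (Lg p * mug p))
      + (1 / Lg p)\<^sup>2 * var_g p bs = (1 - mug p / Lg p) ^ Suc t * r + var_g p bs / (Lg p * mug p)"
    using Lg_pos consts_pos by (simp add: power2_eq_square field_simps)
  then show ?case using mean_y_step[OF Suc] by simp
qed

text \<open>The relevant past contains the samples of the loop for \<open>y\<close> but none of the
  \<open>f\<close> batch, so \<open>known_f k\<close> would be too large. Both partial gradients
  share one batch and one variance bound, hence their errors are kept in one sum.\<close>

lemma mean_uv:
  "mean_le M (\<lambda>\<omega>. (norm (uk k \<omega> - dx f (xk k \<omega>) (yk k \<omega>)))\<^sup>2 + (norm (vk k \<omega> - dy f (xk k \<omega>) (yk k \<omega>)))\<^sup>2) (var_f p bs)"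
proof -
  let ?b = "size_f bs" and ?A = "known k \<union> {Sample_g k t j | t j. True}"
  let ?\<phi> = "\<lambda>(q :: (real^'x) \<times> (real^'y)) D. (norm (dx (batch_avg ?b fh D) (fst q) (snd q) - dx f (fst q) (snd q)))\<^sup>2
      + (norm (dy (batch_avg ?b fh D) (fst q) (snd q) - dy f (fst q) (snd q)))\<^sup>2"
  have "mean_le M (\<lambda>\<omega>. ?\<phi> (xk k \<omega>, yk k \<omega>) (\<lambda>j. \<xi> (Sample_f k j) \<omega>)) (var_f p bs)"
  proof (rule mean_le_fresh[where A = ?A and \<psi> = "\<lambda>_. var_f p bs" and b = ?b and N = borel
        and X = "\<lambda>\<omega>. (xk k \<omega>, yk k \<omega>)" and \<phi> = ?\<phi> and lab = "Sample_f k"])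
    have sub: "known_g k t \<subseteq> ?A" for t by (auto simp: known_defs)
    show "(\<lambda>\<omega>. (xk k \<omega>, yk k \<omega>)) \<in> borel_measurable (past ?A)"
      unfolding yk_def by (intro borel_measurable_Pair past_mono[OF sub xk_known_g] past_mono[OF sub y_it_known_g])
    show "1 \<le> ?b" by (rule sizes_pos)
    show "inj_on (Sample_f k) {..<?b}" by (auto simp: inj_on_def)
    show "Sample_f k ` {..<?b} \<inter> ?A = {}" by (auto simp: known_defs)
    have "continuous_on UNIV (\<lambda>q :: (real^'x) \<times> (real^'y). nabla f (fst q) (snd q))"
      using lipschitz_on_continuous_on[OF f_smooth] by (simp add: case_prod_unfold)
    note nabla = borel_measurable_continuous_onI[OF this]
    have [measurable]: "(\<lambda>q. dx f (fst q) (snd q)) \<in> borel_measurable borel"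
      "(\<lambda>q. dy f (fst q) (snd q)) \<in> borel_measurable borel"
      using borel_measurable_fst_borel[OF nabla] borel_measurable_snd_borel[OF nabla] by (simp_all add: nabla_def)
    note [measurable] = compose_state[OF batch_derivatives_measurable(1)[of ?b] fst_snd_measurable]
      compose_state[OF batch_derivatives_measurable(2)[of ?b] fst_snd_measurable]
    show "(\<lambda>(q, D). ?\<phi> q D) \<in> borel_measurable (borel \<Otimes>\<^sub>M batch_measure P ?b)"
      unfolding case_prod_unfold by measurable
    show "(\<integral>\<^sup>+D. ennreal (?\<phi> q D) \<partial>batch_measure P ?b) \<le> ennreal (var_f p bs)" for q
      using batch_nabla_f_error[OF sizes_pos(2)] by (simp add: var_f_def)
    show "mean_le M (\<lambda>\<omega>. var_f p bs) (var_f p bs)" by (rule mean_le_const[OF order_refl])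
  qed (simp_all add: var_f_def)
  then show ?thesis by (simp add: uk_def vk_def)
qed

text \<open>The target of the loop for \<open>z\<close> in iteration \<open>k\<close>. All inner
  steps reuse the same sampled \<open>vk k\<close>, so its error is not averaged out and the target
  itself is random.\<close>

definition zv :: "nat \<Rightarrow> 'w \<Rightarrow> real^'y" where
  "zv k \<omega> = zsol g (xk k \<omega>) (yk k \<omega>) (vk k \<omega>)"

lemma mean_z_step:
  fixes \<beta> :: real
  defines "\<beta> \<equiv> 1 / (2 * Lg p)"
  assumes r: "mean_le M (\<lambda>\<omega>. (norm (z_it k n \<omega> - zv k \<omega>))\<^sup>2) r"
    and s: "mean_le M (\<lambda>\<omega>. (norm (zv k \<omega>))\<^sup>2) s"
  shows "mean_le M (\<lambda>\<omega>. (norm (z_it k (Suc n) \<omega> - zv k \<omega>))\<^sup>2)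
    ((1 - \<beta> * mug p) * r + 2 * \<beta>\<^sup>2 * var_gyy p bs * s)"
proof -
  let ?b = "size_gyy bs"
  let ?\<phi> = "\<lambda>(q :: ((real^'x) \<times> (real^'y)) \<times> (real^'y) \<times> (real^'y)) D. (norm (snd (snd q)
      - \<beta> *\<^sub>R (dyy (batch_avg ?b gh D) (fst (fst q)) (snd (fst q)) *v snd (snd q) + fst (snd q))
      - zsol g (fst (fst q)) (snd (fst q)) (fst (snd q))))\<^sup>2"
  let ?\<psi> = "\<lambda>q :: ((real^'x) \<times> (real^'y)) \<times> (real^'y) \<times> (real^'y). (1 - \<beta> * mug p) * (norm (snd (snd q) - zsol g (fst (fst q)) (snd (fst q)) (fst (snd q))))\<^sup>2
      + 2 * \<beta>\<^sup>2 * var_gyy p bs * (norm (zsol g (fst (fst q)) (snd (fst q)) (fst (snd q))))\<^sup>2"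
  have v0: "0 \<le> var_gyy p bs" by (simp add: var_gyy_def)
  have ge: "0 \<le> 1 - \<beta> * mug p" using ssc.m_le_L Lg_pos by (simp add: \<beta>_def field_simps)
  have "mean_le M (\<lambda>\<omega>. ?\<phi> ((xk k \<omega>, yk k \<omega>), vk k \<omega>, z_it k n \<omega>) (\<lambda>j. \<xi> (Sample_gyy k (Suc n) j) \<omega>))
    ((1 - \<beta> * mug p) * r + 2 * \<beta>\<^sup>2 * var_gyy p bs * s)"
  proof (rule mean_le_fresh[where A = "known_gyy k n" and \<psi> = ?\<psi> and b = ?b and N = borel])
    show "(\<lambda>\<omega>. ((xk k \<omega>, yk k \<omega>), vk k \<omega>, z_it k n \<omega>)) \<in> borel_measurable (past (known_gyy k n))"
      by (intro borel_measurable_Pair past_mono[OF known_subsets(4) xk_known_f] z_it_known_gyy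
          past_mono[OF known_subsets(4) yk_known_f] past_mono[OF known_subsets(4) vk_known_f])
    show "1 \<le> ?b" by (rule sizes_pos)
    show "inj_on (Sample_gyy k (Suc n)) {..<?b}" by (auto simp: inj_on_def)
    show "Sample_gyy k (Suc n) ` {..<?b} \<inter> known_gyy k n = {}" by (auto simp: known_defs)
    have state [measurable]: "(\<lambda>q :: ((real^'x) \<times> (real^'y)) \<times> (real^'y) \<times> (real^'y). fst (fst q)) \<in> borel_measurable borel"
      "(\<lambda>q :: ((real^'x) \<times> (real^'y)) \<times> (real^'y) \<times> (real^'y). snd (fst q)) \<in> borel_measurable borel"
      "(\<lambda>q :: ((real^'x) \<times> (real^'y)) \<times> (real^'y) \<times> (real^'y). fst (snd q)) \<in> borel_measurable borel"
      "(\<lambda>q :: ((real^'x) \<times> (real^'y)) \<times> (real^'y) \<times> (real^'y). snd (snd q)) \<in> borel_measurable borel"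
      by (intro borel_measurable_fst_borel borel_measurable_snd_borel measurable_ident_sets refl)+
    note [measurable] = compose_state[OF batch_derivatives_measurable(5)[of ?b] state(1,2)]
      zsol_measurable[OF state(1-3)]
    show "(\<lambda>(q, D). ?\<phi> q D) \<in> borel_measurable (borel \<Otimes>\<^sub>M batch_measure P ?b)"
      unfolding case_prod_unfold by measurable
    show "(\<integral>\<^sup>+D. ennreal (?\<phi> q D) \<partial>batch_measure P ?b) \<le> ennreal (?\<psi> q)" for q
      using batch_z_step_error[OF sizes_pos(3)] var_gyy_small by (simp add: var_gyy_def \<beta>_def)
    show "0 \<le> ?\<psi> q" for q using ge v0 by simp
    have "mean_le M (\<lambda>\<omega>. (1 - \<beta> * mug p) * (norm (z_it k n \<omega> - zv k \<omega>))\<^sup>2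
        + 2 * \<beta>\<^sup>2 * var_gyy p bs * (norm (zv k \<omega>))\<^sup>2) ((1 - \<beta> * mug p) * r + 2 * \<beta>\<^sup>2 * var_gyy p bs * s)"
      using v0 by (intro mean_le_add mean_le_cmult r s ge) simp
    then show "mean_le M (\<lambda>\<omega>. ?\<psi> ((xk k \<omega>, yk k \<omega>), vk k \<omega>, z_it k n \<omega>))
        ((1 - \<beta> * mug p) * r + 2 * \<beta>\<^sup>2 * var_gyy p bs * s)" by (simp add: zv_def)
  qed simp_all
  then show ?thesis by (simp add: z_it_simps zv_def \<beta>_def)
qed

text \<open>As for \<open>y\<close>, the additive term is a fixed point of the recursion. It is
  proportional to the mean square of the target because the Hessian noise is multiplicative.\<close>

lemma mean_z_it:
  fixes \<beta> :: real
  defines "\<beta> \<equiv> 1 / (2 * Lg p)"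
  assumes r: "mean_le M (\<lambda>\<omega>. (norm (zprev k \<omega> - zv k \<omega>))\<^sup>2) r"
    and s: "mean_le M (\<lambda>\<omega>. (norm (zv k \<omega>))\<^sup>2) s"
  shows "mean_le M (\<lambda>\<omega>. (norm (z_it k n \<omega> - zv k \<omega>))\<^sup>2)
    ((1 - \<beta> * mug p) ^ n * r + 2 * \<beta> * var_gyy p bs / mug p * s)"
proof (induction n)
  case 0
  have "0 \<le> 2 * \<beta> * var_gyy p bs / mug p * s"
    using Lg_pos consts_pos mean_le_nonneg[OF s] by (simp add: var_gyy_def \<beta>_def)
  then show ?case using mean_le_trans[OF r] by (simp add: z_it_simps)
next
  case (Suc n)
  have "(1 - \<beta> * mug p) * ((1 - \<beta> * mug p) ^ n * r + 2 * \<beta> * var_gyy p bs / mug p * s)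
      + 2 * \<beta>\<^sup>2 * var_gyy p bs * s = (1 - \<beta> * mug p) ^ Suc n * r + 2 * \<beta> * var_gyy p bs / mug p * s"
    using consts_pos by (simp add: power2_eq_square field_simps)
  then show ?case using mean_z_step[OF Suc[unfolded \<beta>_def] s] by (simp add: \<beta>_def)
qed

text \<open>The Jacobian batch is independent of \<open>zk\<close>, which is settled before, so its
  error acts on a vector that can be held fixed and scales with the second moment of that
  vector.\<close>

lemma mean_dxy:
  assumes r: "mean_le M (\<lambda>\<omega>. (norm (zk k \<omega>))\<^sup>2) r"
  shows "mean_le M (\<lambda>\<omega>. (norm (psik k \<omega> - uk k \<omega> - dxy g (xk k \<omega>) (yk k \<omega>) *v zk k \<omega>))\<^sup>2) (var_gxy p bs * r)"
proof -
  let ?b = "size_gxy bs" and ?A = "known_gyy k (N_choice p bs)"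
  let ?\<phi> = "\<lambda>(q :: ((real^'x) \<times> (real^'y)) \<times> (real^'y)) D.
      (norm ((dxy (batch_avg ?b gh D) (fst (fst q)) (snd (fst q)) - dxy g (fst (fst q)) (snd (fst q))) *v snd q))\<^sup>2"
  let ?\<psi> = "\<lambda>q :: ((real^'x) \<times> (real^'y)) \<times> (real^'y). var_gxy p bs * (norm (snd q))\<^sup>2"
  have "mean_le M (\<lambda>\<omega>. ?\<phi> ((xk k \<omega>, yk k \<omega>), zk k \<omega>) (\<lambda>j. \<xi> (Sample_gxy k j) \<omega>)) (var_gxy p bs * r)"
  proof (rule mean_le_fresh[where A = ?A and \<psi> = ?\<psi> and b = ?b and N = borel])
    show "(\<lambda>\<omega>. ((xk k \<omega>, yk k \<omega>), zk k \<omega>)) \<in> borel_measurable (past ?A)"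
      unfolding zk_def by (intro borel_measurable_Pair past_mono[OF known_subsets(4) xk_known_f] z_it_known_gyy
          past_mono[OF known_subsets(4) yk_known_f])
    show "1 \<le> ?b" by (rule sizes_pos)
    show "inj_on (Sample_gxy k) {..<?b}" by (auto simp: inj_on_def)
    show "Sample_gxy k ` {..<?b} \<inter> ?A = {}" by (auto simp: known_defs)
    have state [measurable]: "(\<lambda>q :: ((real^'x) \<times> (real^'y)) \<times> (real^'y). fst (fst q)) \<in> borel_measurable borel"
      "(\<lambda>q :: ((real^'x) \<times> (real^'y)) \<times> (real^'y). snd (fst q)) \<in> borel_measurable borel"
      "(\<lambda>q :: ((real^'x) \<times> (real^'y)) \<times> (real^'y). snd q) \<in> borel_measurable borel"
      by (intro borel_measurable_fst_borel borel_measurable_snd_borel measurable_ident_sets refl)+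
    have "case_prod g \<in> borel_measurable borel"
      using g_differentiable differentiable_imp_continuous_within
      by (metis borel_measurable_continuous_onI continuous_at_imp_continuous_on)
    from measurable_compose[OF measurable_fst this]
    have "(\<lambda>((x, y), D). g x y) \<in> borel_measurable (borel \<Otimes>\<^sub>M batch_measure P ?b)"
      by (simp add: case_prod_unfold)
    note [measurable] = compose_state[OF batch_derivatives_measurable(4)[of ?b] state(1,2)]
      compose_state[OF dxy_measurable[of "\<lambda>_. g", OF this g_twice_differentiable] state(1,2)]
    show "(\<lambda>(q, D). ?\<phi> q D) \<in> borel_measurable (borel \<Otimes>\<^sub>M batch_measure P ?b)"
      unfolding case_prod_unfold by measurable
    show "(\<integral>\<^sup>+D. ennreal (?\<phi> q D) \<partial>batch_measure P ?b) \<le> ennreal (?\<psi> q)" for q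
      using batch_dxy_error[OF sizes_pos(4)] by (simp add: var_gxy_def)
    show "0 \<le> ?\<psi> q" for q by (simp add: var_gxy_def)
    show "mean_le M (\<lambda>\<omega>. ?\<psi> ((xk k \<omega>, yk k \<omega>), zk k \<omega>)) (var_gxy p bs * r)"
      using mean_le_cmult[OF r, of "var_gxy p bs"] by (simp add: var_gxy_def)
  qed simp_all
  then show ?thesis by (simp add: psik_def matrix_vector_mult_diff_rdistrib)
qed

end

section \<open>One outer iteration in expectation\<close>

lemma norm_sq_add4:
  "(norm (a + b + c + d))\<^sup>2 \<le> 4 * (norm a)\<^sup>2 + 4 * (norm b)\<^sup>2 + 4 * (norm c)\<^sup>2 + 4 * (norm d)\<^sup>2"
  for a b c d :: "'a::real_normed_vector"
  using norm_sq_add2[of "a + b" "c + d"] norm_sq_add2[of a b] norm_sq_add2[of c d]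
  by (simp add: add.assoc)

lemma norm_le_sq: "norm a \<le> b \<Longrightarrow> (norm a)\<^sup>2 \<le> b\<^sup>2"
  by (simp add: power_mono)

context amigo_process
begin

definition ery :: "nat \<Rightarrow> 'w \<Rightarrow> real" where
  "ery k \<omega> = (norm (yprev k \<omega> - ystar g (xk k \<omega>)))\<^sup>2"

text \<open>The reference is \<open>zstar\<close> at the exact \<open>ystar\<close> and not at
  \<open>yk\<close>: it depends on \<open>x\<close> alone, so between iterations it moves only with
  \<open>x\<close>.\<close>

definition erz :: "nat \<Rightarrow> 'w \<Rightarrow> real" where
  "erz k \<omega> = (norm (zprev k \<omega> - zstar f g (xk k \<omega>) (ystar g (xk k \<omega>))))\<^sup>2"

definition grad_sq :: "nat \<Rightarrow> 'w \<Rightarrow> real" where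
  "grad_sq k \<omega> = (norm (grad (outer_obj f g) (xk k \<omega>)))\<^sup>2"

definition rho_y :: real where
  "rho_y = (1 - mug p / Lg p) ^ T_choice p"

definition rho_z :: real where
  "rho_z = (1 - mug p / (2 * Lg p)) ^ N_choice p bs"

definition noise_y :: real where
  "noise_y = var_g p bs / (Lg p * mug p)"

text \<open>The first factor is \<open>2 * \<beta> * var_gyy p bs / mug p\<close> of
  \<open>mean_z_it\<close> for \<open>\<beta> = 1 / (2 * Lg p)\<close>; the second is the bound of
  \<open>mean_zv\<close>.\<close>

definition noise_z :: real where
  "noise_z = var_gyy p bs / (Lg p * mug p) * ((2 * (Bf p)\<^sup>2 + 2 * var_f p bs) / (mug p)\<^sup>2)"

text \<open>A bound for the mean square distance of \<open>zk\<close> to \<open>zstar\<close> at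
  \<open>(xk, yk)\<close>, given bounds \<open>ey\<close> for the error of \<open>yk\<close> and
  \<open>w\<close> for \<open>erz\<close>. The factors 3 and 2 come from splitting a square into
  three terms before the loop and into two after it.\<close>

definition zeta :: "real \<Rightarrow> real \<Rightarrow> real" where
  "zeta ey w = 2 * (rho_z * (3 * w + 3 * (L_z p)\<^sup>2 * ey + 3 * (var_f p bs / (mug p)\<^sup>2)) + noise_z)
     + 2 * (var_f p bs / (mug p)\<^sup>2)"

text \<open>A bound for the mean square error of \<open>psik\<close>. The four summands belong to
  the Jacobian batch, the \<open>f\<close> batch, the error of \<open>zk\<close> and the error of
  \<open>yk\<close>, in this order.\<close>

definition mse :: "real \<Rightarrow> real \<Rightarrow> real" where
  "mse ey w = 4 * (var_gxy p bs * (2 * zeta ey w + 2 * (Bf p / mug p)\<^sup>2)) + 4 * var_f p bs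
     + 4 * ((Lg' p)\<^sup>2 * zeta ey w) + 4 * ((L_psi p)\<^sup>2 * ey)"

text \<open>The estimate is read off from two successive points, so its measurability follows from
  that of \<open>xk\<close>.\<close>

lemma psik_eq: "psik k \<omega> = L_outer p *\<^sub>R (xk k \<omega> - xk (Suc k) \<omega>)"
  using L_outer_pos by (simp add: run_Suc step_gamma_def)

lemma solution_measurable [measurable]:
  "zv k \<in> borel_measurable M"
  "(\<lambda>\<omega>. zstar f g (xk k \<omega>) (yk k \<omega>)) \<in> borel_measurable M"
  "(\<lambda>\<omega>. zstar f g (xk k \<omega>) (ystar g (xk k \<omega>))) \<in> borel_measurable M"
  "psik k \<in> borel_measurable M"
  "ery k \<in> borel_measurable M" "erz k \<in> borel_measurable M" "grad_sq k \<in> borel_measurable M"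
proof -
  have [measurable]: "(\<lambda>\<omega>. ystar g (xk k \<omega>)) \<in> borel_measurable M" by measurable
  show "zv k \<in> borel_measurable M"
    unfolding zv_def[abs_def] by (intro zsol_measurable) measurable
  show "(\<lambda>\<omega>. zstar f g (xk k \<omega>) (yk k \<omega>)) \<in> borel_measurable M"
    by (intro zstar_measurable) measurable
  show [measurable]: "(\<lambda>\<omega>. zstar f g (xk k \<omega>) (ystar g (xk k \<omega>))) \<in> borel_measurable M"
    by (intro zstar_measurable) measurable
  show "psik k \<in> borel_measurable M" unfolding psik_eq[abs_def] by measurable
  show "ery k \<in> borel_measurable M" "erz k \<in> borel_measurable M" "grad_sq k \<in> borel_measurable M"
    unfolding ery_def[abs_def] erz_def[abs_def] grad_sq_def[abs_def] by measurable
qed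

lemma mean_yk:
  assumes "mean_le M (ery k) r"
  shows "mean_le M (\<lambda>\<omega>. (norm (yk k \<omega> - ystar g (xk k \<omega>)))\<^sup>2) (rho_y * r + noise_y)"
  using mean_y_it[of k r "T_choice p"] assms by (simp add: ery_def[abs_def] yk_def rho_y_def noise_y_def)

lemma mean_v: "mean_le M (\<lambda>\<omega>. (norm (vk k \<omega> - dy f (xk k \<omega>) (yk k \<omega>)))\<^sup>2
    + (norm (uk k \<omega> - dx f (xk k \<omega>) (yk k \<omega>)))\<^sup>2) (var_f p bs)"
  using mean_uv[of k] by (simp add: add.commute)

lemma mean_zv: "mean_le M (\<lambda>\<omega>. (norm (zv k \<omega>))\<^sup>2) ((2 * (Bf p)\<^sup>2 + 2 * var_f p bs) / (mug p)\<^sup>2)"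
proof -
  let ?e = "\<lambda>\<omega>. (norm (vk k \<omega> - dy f (xk k \<omega>) (yk k \<omega>)))\<^sup>2 + (norm (uk k \<omega> - dx f (xk k \<omega>) (yk k \<omega>)))\<^sup>2"
  have "mean_le M (\<lambda>\<omega>. 1 / (mug p)\<^sup>2 * (2 * (Bf p)\<^sup>2 + 2 * ?e \<omega>)) (1 / (mug p)\<^sup>2 * (2 * (Bf p)\<^sup>2 + 2 * var_f p bs))"
    by (intro mean_le_cmult mean_le_add mean_v mean_le_const) auto
  then have "mean_le M (\<lambda>\<omega>. (norm (zv k \<omega>))\<^sup>2) (1 / (mug p)\<^sup>2 * (2 * (Bf p)\<^sup>2 + 2 * var_f p bs))"
  proof (rule mean_le_dominated)
    show "(\<lambda>\<omega>. (norm (zv k \<omega>))\<^sup>2) \<in> borel_measurable M" by measurable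
    fix \<omega>
    let ?v = "vk k \<omega>" and ?d = "dy f (xk k \<omega>) (yk k \<omega>)"
    have "(norm (zv k \<omega>))\<^sup>2 \<le> (norm ?v / mug p)\<^sup>2" unfolding zv_def by (rule norm_le_sq[OF norm_zsol])
    also have "\<dots> = (norm (?d + (?v - ?d)))\<^sup>2 / (mug p)\<^sup>2" by (simp add: power_divide)
    also have "\<dots> \<le> (2 * (norm ?d)\<^sup>2 + 2 * (norm (?v - ?d))\<^sup>2) / (mug p)\<^sup>2"
      by (intro divide_right_mono norm_sq_add2) simp
    also have "\<dots> \<le> (2 * (Bf p)\<^sup>2 + 2 * ?e \<omega>) / (mug p)\<^sup>2"
      using norm_le_sq[OF dy_f_bounded[of "xk k \<omega>" "yk k \<omega>"]] by (intro divide_right_mono add_mono) auto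
    finally show "(norm (zv k \<omega>))\<^sup>2 \<le> 1 / (mug p)\<^sup>2 * (2 * (Bf p)\<^sup>2 + 2 * ?e \<omega>)" by simp
  qed simp
  then show ?thesis by simp
qed

text \<open>The error of \<open>uk\<close> is added on the right only to match the joint bound
  \<open>mean_v\<close>.\<close>

lemma norm_zv_zstar:
  "(norm (zstar f g (xk k \<omega>) (yk k \<omega>) - zv k \<omega>))\<^sup>2
    \<le> 1 / (mug p)\<^sup>2 * ((norm (vk k \<omega> - dy f (xk k \<omega>) (yk k \<omega>)))\<^sup>2 + (norm (uk k \<omega> - dx f (xk k \<omega>) (yk k \<omega>)))\<^sup>2)"
proof -
  let ?v = "vk k \<omega>" and ?d = "dy f (xk k \<omega>) (yk k \<omega>)"
  have "(norm (zstar f g (xk k \<omega>) (yk k \<omega>) - zv k \<omega>))\<^sup>2 \<le> (norm (?d - ?v) / mug p)\<^sup>2"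
    unfolding zv_def zstar_eq_zsol by (rule norm_le_sq[OF zsol_diff])
  also have "\<dots> = 1 / (mug p)\<^sup>2 * (norm (?v - ?d))\<^sup>2" by (simp add: power_divide norm_minus_commute)
  also have "\<dots> \<le> 1 / (mug p)\<^sup>2 * ((norm (?v - ?d))\<^sup>2 + (norm (uk k \<omega> - dx f (xk k \<omega>) (yk k \<omega>)))\<^sup>2)"
    by (intro mult_left_mono) auto
  finally show ?thesis .
qed

text \<open>The path from \<open>zprev\<close> to \<open>zv\<close> leads over \<open>zstar\<close>
  at the exact \<open>ystar\<close> and over \<open>zstar\<close> at \<open>yk\<close>; its legs are
  \<open>erz\<close>, the error of \<open>yk\<close> and the sampling error of
  \<open>vk\<close>.\<close>

lemma mean_zprev_zv:
  assumes ey: "mean_le M (\<lambda>\<omega>. (norm (yk k \<omega> - ystar g (xk k \<omega>)))\<^sup>2) ey" and w: "mean_le M (erz k) w"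
  shows "mean_le M (\<lambda>\<omega>. (norm (zprev k \<omega> - zv k \<omega>))\<^sup>2)
    (3 * w + 3 * (L_z p)\<^sup>2 * ey + 3 * (var_f p bs / (mug p)\<^sup>2))"
proof (rule mean_le_dominated)
  let ?e = "\<lambda>\<omega>. (norm (vk k \<omega> - dy f (xk k \<omega>) (yk k \<omega>)))\<^sup>2 + (norm (uk k \<omega> - dx f (xk k \<omega>) (yk k \<omega>)))\<^sup>2"
  have "mean_le M (\<lambda>\<omega>. 3 * erz k \<omega> + 3 * (L_z p)\<^sup>2 * (norm (yk k \<omega> - ystar g (xk k \<omega>)))\<^sup>2
        + 3 * (1 / (mug p)\<^sup>2 * ?e \<omega>))
     (3 * w + 3 * (L_z p)\<^sup>2 * ey + 3 * (1 / (mug p)\<^sup>2 * var_f p bs))"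
    by (intro mean_le_cmult mean_le_add mean_v ey w) auto
  then show "mean_le M (\<lambda>\<omega>. 3 * erz k \<omega> + 3 * (L_z p)\<^sup>2 * (norm (yk k \<omega> - ystar g (xk k \<omega>)))\<^sup>2
        + 3 * (1 / (mug p)\<^sup>2 * ?e \<omega>))
     (3 * w + 3 * (L_z p)\<^sup>2 * ey + 3 * (var_f p bs / (mug p)\<^sup>2))" by simp
  show "(\<lambda>\<omega>. (norm (zprev k \<omega> - zv k \<omega>))\<^sup>2) \<in> borel_measurable M" by measurable
  fix \<omega>
  let ?Z = "zstar f g (xk k \<omega>) (ystar g (xk k \<omega>))" and ?z = "zstar f g (xk k \<omega>) (yk k \<omega>)"
  have "(norm (zprev k \<omega> - zv k \<omega>))\<^sup>2 = (norm ((zprev k \<omega> - ?Z) + (?Z - ?z) + (?z - zv k \<omega>)))\<^sup>2" by simp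
  also have "\<dots> \<le> 3 * (norm (zprev k \<omega> - ?Z))\<^sup>2 + 3 * (norm (?Z - ?z))\<^sup>2 + 3 * (norm (?z - zv k \<omega>))\<^sup>2"
    by (rule norm_sq_add3)
  also have "\<dots> \<le> 3 * erz k \<omega> + 3 * (L_z p)\<^sup>2 * (norm (yk k \<omega> - ystar g (xk k \<omega>)))\<^sup>2
        + 3 * (1 / (mug p)\<^sup>2 * ?e \<omega>)"
  proof (intro add_mono mult_left_mono norm_zv_zstar)
    have "norm (?Z - ?z) \<le> L_z p * norm (yk k \<omega> - ystar g (xk k \<omega>))"
      using zstar_lipschitz[of "xk k \<omega>" "ystar g (xk k \<omega>)" "xk k \<omega>" "yk k \<omega>"]
      by (simp add: dist_norm norm_Pair norm_minus_commute)
    from norm_le_sq[OF this]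
    show "3 * (norm (?Z - ?z))\<^sup>2 \<le> 3 * (L_z p)\<^sup>2 * (norm (yk k \<omega> - ystar g (xk k \<omega>)))\<^sup>2"
      by (simp add: power_mult_distrib)
  qed (simp_all add: erz_def)
  finally show "(norm (zprev k \<omega> - zv k \<omega>))\<^sup>2 \<le> 3 * erz k \<omega>
      + 3 * (L_z p)\<^sup>2 * (norm (yk k \<omega> - ystar g (xk k \<omega>)))\<^sup>2 + 3 * (1 / (mug p)\<^sup>2 * ?e \<omega>)" .
qed simp

lemma mean_zk:
  assumes ey: "mean_le M (\<lambda>\<omega>. (norm (yk k \<omega> - ystar g (xk k \<omega>)))\<^sup>2) ey" and w: "mean_le M (erz k) w"
  shows "mean_le M (\<lambda>\<omega>. (norm (zk k \<omega> - zstar f g (xk k \<omega>) (yk k \<omega>)))\<^sup>2) (zeta ey w)"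
proof (rule mean_le_dominated)
  let ?e = "\<lambda>\<omega>. (norm (vk k \<omega> - dy f (xk k \<omega>) (yk k \<omega>)))\<^sup>2 + (norm (uk k \<omega> - dx f (xk k \<omega>) (yk k \<omega>)))\<^sup>2"
  have "mean_le M (\<lambda>\<omega>. (norm (zk k \<omega> - zv k \<omega>))\<^sup>2)
      (rho_z * (3 * w + 3 * (L_z p)\<^sup>2 * ey + 3 * (var_f p bs / (mug p)\<^sup>2)) + noise_z)"
    using mean_z_it[OF mean_zprev_zv[OF ey w] mean_zv, of "N_choice p bs"] Lg_pos
    by (simp add: zk_def rho_z_def noise_z_def)
  then have "mean_le M (\<lambda>\<omega>. 2 * (norm (zk k \<omega> - zv k \<omega>))\<^sup>2 + 2 * (1 / (mug p)\<^sup>2 * ?e \<omega>))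
      (2 * (rho_z * (3 * w + 3 * (L_z p)\<^sup>2 * ey + 3 * (var_f p bs / (mug p)\<^sup>2)) + noise_z)
        + 2 * (1 / (mug p)\<^sup>2 * var_f p bs))"
    by (intro mean_le_cmult mean_le_add mean_v) auto
  then show "mean_le M (\<lambda>\<omega>. 2 * (norm (zk k \<omega> - zv k \<omega>))\<^sup>2 + 2 * (1 / (mug p)\<^sup>2 * ?e \<omega>)) (zeta ey w)"
    by (simp add: zeta_def)
  show "(\<lambda>\<omega>. (norm (zk k \<omega> - zstar f g (xk k \<omega>) (yk k \<omega>)))\<^sup>2) \<in> borel_measurable M" by measurable
  fix \<omega>
  let ?z = "zstar f g (xk k \<omega>) (yk k \<omega>)"
  have "(norm (zk k \<omega> - ?z))\<^sup>2 \<le> 2 * (norm (zk k \<omega> - zv k \<omega>))\<^sup>2 + 2 * (norm (?z - zv k \<omega>))\<^sup>2"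
    using norm_sq_add2[of "zk k \<omega> - zv k \<omega>" "zv k \<omega> - ?z"] by (simp add: norm_minus_commute)
  also have "\<dots> \<le> 2 * (norm (zk k \<omega> - zv k \<omega>))\<^sup>2 + 2 * (1 / (mug p)\<^sup>2 * ?e \<omega>)"
    by (intro add_left_mono mult_left_mono norm_zv_zstar) simp
  finally show "(norm (zk k \<omega> - ?z))\<^sup>2 \<le> 2 * (norm (zk k \<omega> - zv k \<omega>))\<^sup>2 + 2 * (1 / (mug p)\<^sup>2 * ?e \<omega>)" .
qed simp

lemma mean_psik:
  assumes ey: "mean_le M (\<lambda>\<omega>. (norm (yk k \<omega> - ystar g (xk k \<omega>)))\<^sup>2) ey" and w: "mean_le M (erz k) w"
  shows "mean_le M (\<lambda>\<omega>. (norm (psik k \<omega> - grad (outer_obj f g) (xk k \<omega>)))\<^sup>2) (mse ey w)"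
proof (rule mean_le_dominated)
  let ?e = "\<lambda>\<omega>. (norm (vk k \<omega> - dy f (xk k \<omega>) (yk k \<omega>)))\<^sup>2 + (norm (uk k \<omega> - dx f (xk k \<omega>) (yk k \<omega>)))\<^sup>2"
  let ?ez = "\<lambda>\<omega>. (norm (zk k \<omega> - zstar f g (xk k \<omega>) (yk k \<omega>)))\<^sup>2"
  let ?ey = "\<lambda>\<omega>. (norm (yk k \<omega> - ystar g (xk k \<omega>)))\<^sup>2"
  let ?F = "\<lambda>\<omega>. psik k \<omega> - uk k \<omega> - dxy g (xk k \<omega>) (yk k \<omega>) *v zk k \<omega>"
  \<comment> \<open>The Jacobian noise multiplies \<open>zk\<close>, whose second moment is
    controlled through its distance to the bounded vector \<open>zstar\<close>.\<close>
  have "mean_le M (\<lambda>\<omega>. (norm (zk k \<omega>))\<^sup>2) (2 * zeta ey w + 2 * (Bf p / mug p)\<^sup>2)"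
  proof (rule mean_le_dominated)
    show "mean_le M (\<lambda>\<omega>. 2 * ?ez \<omega> + 2 * (Bf p / mug p)\<^sup>2) (2 * zeta ey w + 2 * (Bf p / mug p)\<^sup>2)"
      by (intro mean_le_cmult mean_le_add mean_zk[OF ey w] mean_le_const) auto
    show "(\<lambda>\<omega>. (norm (zk k \<omega>))\<^sup>2) \<in> borel_measurable M" by measurable
    fix \<omega>
    show "(norm (zk k \<omega>))\<^sup>2 \<le> 2 * ?ez \<omega> + 2 * (Bf p / mug p)\<^sup>2"
      using norm_sq_add2[of "zk k \<omega> - zstar f g (xk k \<omega>) (yk k \<omega>)" "zstar f g (xk k \<omega>) (yk k \<omega>)"]
        norm_le_sq[OF norm_zstar[of "xk k \<omega>" "yk k \<omega>"]] by simp
  qed simp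
  from mean_dxy[OF this]
  have "mean_le M (\<lambda>\<omega>. 4 * (norm (?F \<omega>))\<^sup>2 + 4 * ?e \<omega> + 4 * ((Lg' p)\<^sup>2 * ?ez \<omega>) + 4 * ((L_psi p)\<^sup>2 * ?ey \<omega>))
    (mse ey w)"
    unfolding mse_def by (intro mean_le_cmult mean_le_add mean_v mean_zk[OF ey w] ey) auto
  then show "mean_le M (\<lambda>\<omega>. 4 * (norm (?F \<omega>))\<^sup>2 + 4 * ?e \<omega> + 4 * ((Lg' p)\<^sup>2 * ?ez \<omega>)
      + 4 * ((L_psi p)\<^sup>2 * ?ey \<omega>)) (mse ey w)" .
  show "(\<lambda>\<omega>. (norm (psik k \<omega> - grad (outer_obj f g) (xk k \<omega>)))\<^sup>2) \<in> borel_measurable M" by measurable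
  fix \<omega>
  let ?x = "xk k \<omega>" and ?y = "yk k \<omega>"
  let ?a = "uk k \<omega> - dx f ?x ?y" and ?b = "dxy g ?x ?y *v (zk k \<omega> - zstar f g ?x ?y)"
  let ?c = "psi f g ?x ?y - psi f g ?x (ystar g ?x)"
  have eq: "psik k \<omega> - grad (outer_obj f g) ?x = ?F \<omega> + ?a + ?b + ?c"
    unfolding grad_outer psi_def[of f g ?x ?y] by (simp add: matrix_vector_mult_diff_distrib)
  have "(norm (psik k \<omega> - grad (outer_obj f g) ?x))\<^sup>2
      \<le> 4 * (norm (?F \<omega>))\<^sup>2 + 4 * (norm ?a)\<^sup>2 + 4 * (norm ?b)\<^sup>2 + 4 * (norm ?c)\<^sup>2"
    unfolding eq by (rule norm_sq_add4)
  also have "\<dots> \<le> 4 * (norm (?F \<omega>))\<^sup>2 + 4 * ?e \<omega> + 4 * ((Lg' p)\<^sup>2 * ?ez \<omega>) + 4 * ((L_psi p)\<^sup>2 * ?ey \<omega>)"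
  proof (intro add_mono mult_left_mono)
    show "(norm ?a)\<^sup>2 \<le> ?e \<omega>" by simp
    show "(norm ?b)\<^sup>2 \<le> (Lg' p)\<^sup>2 * ?ez \<omega>"
      using norm_le_sq[OF norm_dxy[of ?x ?y "zk k \<omega> - zstar f g ?x ?y"]] by (simp add: power_mult_distrib)
    have "norm ?c \<le> L_psi p * norm (?y - ystar g ?x)"
      using psi_lipschitz[of ?x ?y ?x "ystar g ?x"] by (simp add: dist_norm norm_Pair)
    from norm_le_sq[OF this] show "(norm ?c)\<^sup>2 \<le> (L_psi p)\<^sup>2 * ?ey \<omega>" by (simp add: power_mult_distrib)
  qed simp_all
  finally show "(norm (psik k \<omega> - grad (outer_obj f g) ?x))\<^sup>2
      \<le> 4 * (norm (?F \<omega>))\<^sup>2 + 4 * ?e \<omega> + 4 * ((Lg' p)\<^sup>2 * ?ez \<omega>) + 4 * ((L_psi p)\<^sup>2 * ?ey \<omega>)" .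
qed simp

lemma grad_sq_integrable:
  assumes bdd: "bdd_below (range (outer_obj f g))"
    and int: "integrable M (\<lambda>\<omega>. outer_obj f g (xk k \<omega>))"
  shows "integrable M (grad_sq k)"
proof -
  have "mean_le M (\<lambda>\<omega>. 2 * L_outer p * (outer_obj f g (xk k \<omega>) - outer_inf f g))
      (LINT \<omega>|M. 2 * L_outer p * (outer_obj f g (xk k \<omega>) - outer_inf f g))"
    using int by (simp add: mean_le_def)
  then have "mean_le M (grad_sq k) (LINT \<omega>|M. 2 * L_outer p * (outer_obj f g (xk k \<omega>) - outer_inf f g))"
    by (rule mean_le_dominated) (use norm_grad_outer_le[OF bdd] in \<open>auto simp: grad_sq_def\<close>)
  then show ?thesis by (simp add: mean_le_def)
qed

text \<open>Both targets move with \<open>x\<close>, and the squared move is at most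
  \<open>2 / (L_outer p)\<^sup>2\<close> times the squared gradient plus the squared error of
  \<open>psik\<close>. In this way the gradient enters the recursions of \<open>ery\<close> and
  \<open>erz\<close> and couples them to the descent.\<close>

lemma outer_iteration:
  assumes bdd: "bdd_below (range (outer_obj f g))"
    and int: "integrable M (\<lambda>\<omega>. outer_obj f g (xk k \<omega>))"
    and e: "mean_le M (ery k) e" and w: "mean_le M (erz k) w"
  defines "ey \<equiv> rho_y * e + noise_y" and "G \<equiv> (LINT \<omega>|M. grad_sq k \<omega>)"
  shows "mean_le M (ery (Suc k)) (2 * ey + 4 * (L_y p)\<^sup>2 / (L_outer p)\<^sup>2 * (G + mse ey w))" (is ?yy)
    and "mean_le M (erz (Suc k)) (3 * zeta ey w + 3 * (L_z p)\<^sup>2 * ey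
       + 6 * (L_z p)\<^sup>2 * (1 + L_y p)\<^sup>2 / (L_outer p)\<^sup>2 * (G + mse ey w))" (is ?zz)
    and "integrable M (\<lambda>\<omega>. outer_obj f g (xk (Suc k) \<omega>))" (is ?int)
    and "(LINT \<omega>|M. outer_obj f g (xk (Suc k) \<omega>)) \<le> (LINT \<omega>|M. outer_obj f g (xk k \<omega>))
       - G / (2 * L_outer p) + mse ey w / (2 * L_outer p)" (is ?descent)
proof -
  let ?ey = "\<lambda>\<omega>. (norm (yk k \<omega> - ystar g (xk k \<omega>)))\<^sup>2"
  let ?ez = "\<lambda>\<omega>. (norm (zk k \<omega> - zstar f g (xk k \<omega>) (yk k \<omega>)))\<^sup>2"
  let ?D = "\<lambda>\<omega>. (norm (psik k \<omega> - grad (outer_obj f g) (xk k \<omega>)))\<^sup>2"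
  have ey: "mean_le M ?ey ey" unfolding ey_def by (rule mean_yk[OF e])
  note ez = mean_zk[OF ey w] and D = mean_psik[OF ey w]
  have Gint: "integrable M (grad_sq k)" by (rule grad_sq_integrable[OF bdd int])
  then have G: "mean_le M (grad_sq k) G" by (simp add: mean_le_def G_def)
  have dx: "(norm (xk (Suc k) \<omega> - xk k \<omega>))\<^sup>2 \<le> 2 / (L_outer p)\<^sup>2 * (grad_sq k \<omega> + ?D \<omega>)" for \<omega>
  proof -
    have "(norm (xk (Suc k) \<omega> - xk k \<omega>))\<^sup>2 = 1 / (L_outer p)\<^sup>2 * (norm (psik k \<omega>))\<^sup>2"
      by (simp add: run_Suc step_gamma_def power_divide)
    also have "\<dots> \<le> 1 / (L_outer p)\<^sup>2 * (2 * grad_sq k \<omega> + 2 * ?D \<omega>)"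
      using norm_sq_add2[of "grad (outer_obj f g) (xk k \<omega>)" "psik k \<omega> - grad (outer_obj f g) (xk k \<omega>)"]
      by (intro mult_left_mono) (auto simp: grad_sq_def)
    finally show ?thesis by (simp add: add_divide_distrib algebra_simps)
  qed
  have scale_y: "2 * (L_y p)\<^sup>2 * (2 / (L_outer p)\<^sup>2 * t) = 4 * (L_y p)\<^sup>2 / (L_outer p)\<^sup>2 * t"
    and scale_z: "3 * ((L_z p)\<^sup>2 * (1 + L_y p)\<^sup>2) * (2 / (L_outer p)\<^sup>2 * t)
      = 6 * (L_z p)\<^sup>2 * (1 + L_y p)\<^sup>2 / (L_outer p)\<^sup>2 * t" for t
    by simp_all
  show ?yy
  proof (rule mean_le_dominated)
    have "mean_le M (\<lambda>\<omega>. 2 * ?ey \<omega> + 2 * (L_y p)\<^sup>2 * (2 / (L_outer p)\<^sup>2 * (grad_sq k \<omega> + ?D \<omega>)))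
      (2 * ey + 2 * (L_y p)\<^sup>2 * (2 / (L_outer p)\<^sup>2 * (G + mse ey w)))"
      by (intro mean_le_cmult mean_le_add ey G D) auto
    then show "mean_le M (\<lambda>\<omega>. 2 * ?ey \<omega> + 2 * (L_y p)\<^sup>2 * (2 / (L_outer p)\<^sup>2 * (grad_sq k \<omega> + ?D \<omega>)))
      (2 * ey + 4 * (L_y p)\<^sup>2 / (L_outer p)\<^sup>2 * (G + mse ey w))"
      unfolding scale_y .
    show "ery (Suc k) \<in> borel_measurable M" by measurable
    fix \<omega>
    let ?x = "xk k \<omega>" and ?x' = "xk (Suc k) \<omega>"
    have "ery (Suc k) \<omega> \<le> 2 * ?ey \<omega> + 2 * (norm (ystar g ?x' - ystar g ?x))\<^sup>2"
      using norm_sq_add2[of "yk k \<omega> - ystar g ?x" "ystar g ?x - ystar g ?x'"]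
      by (simp add: ery_def run_Suc norm_minus_commute)
    also have "\<dots> \<le> 2 * ?ey \<omega> + 2 * ((L_y p)\<^sup>2 * (norm (?x' - ?x))\<^sup>2)"
      using norm_le_sq[OF ystar_lipschitz[of ?x' ?x]]
      by (intro add_left_mono mult_left_mono) (auto simp: power_mult_distrib)
    also have "\<dots> \<le> 2 * ?ey \<omega> + 2 * ((L_y p)\<^sup>2 * (2 / (L_outer p)\<^sup>2 * (grad_sq k \<omega> + ?D \<omega>)))"
      by (intro add_left_mono mult_left_mono dx) auto
    finally show "ery (Suc k) \<omega> \<le> 2 * ?ey \<omega> + 2 * (L_y p)\<^sup>2 * (2 / (L_outer p)\<^sup>2 * (grad_sq k \<omega> + ?D \<omega>))"
      by (simp only: mult.assoc)
  qed (simp add: ery_def)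
  show ?zz
  proof (rule mean_le_dominated)
    let ?C = "(L_z p)\<^sup>2 * (1 + L_y p)\<^sup>2"
    have "mean_le M (\<lambda>\<omega>. 3 * ?ez \<omega> + 3 * (L_z p)\<^sup>2 * ?ey \<omega> + 3 * ?C * (2 / (L_outer p)\<^sup>2 * (grad_sq k \<omega> + ?D \<omega>)))
      (3 * zeta ey w + 3 * (L_z p)\<^sup>2 * ey + 3 * ?C * (2 / (L_outer p)\<^sup>2 * (G + mse ey w)))"
      by (intro mean_le_cmult mean_le_add ey ez G D) auto
    then show "mean_le M (\<lambda>\<omega>. 3 * ?ez \<omega> + 3 * (L_z p)\<^sup>2 * ?ey \<omega> + 3 * ?C * (2 / (L_outer p)\<^sup>2 * (grad_sq k \<omega> + ?D \<omega>)))
      (3 * zeta ey w + 3 * (L_z p)\<^sup>2 * ey + 6 * (L_z p)\<^sup>2 * (1 + L_y p)\<^sup>2 / (L_outer p)\<^sup>2 * (G + mse ey w))"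
      unfolding scale_z .
    show "erz (Suc k) \<in> borel_measurable M" by measurable
    fix \<omega>
    let ?x = "xk k \<omega>" and ?x' = "xk (Suc k) \<omega>"
    let ?z = "zstar f g ?x (yk k \<omega>)" and ?Z = "zstar f g ?x (ystar g ?x)" and ?Z' = "zstar f g ?x' (ystar g ?x')"
    have "erz (Suc k) \<omega> = (norm ((zk k \<omega> - ?z) + (?z - ?Z) + (?Z - ?Z')))\<^sup>2" by (simp add: erz_def run_Suc)
    also have "\<dots> \<le> 3 * ?ez \<omega> + 3 * (norm (?z - ?Z))\<^sup>2 + 3 * (norm (?Z - ?Z'))\<^sup>2" by (rule norm_sq_add3)
    also have "\<dots> \<le> 3 * ?ez \<omega> + 3 * ((L_z p)\<^sup>2 * ?ey \<omega>) + 3 * (?C * (norm (?x' - ?x))\<^sup>2)"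
    proof (intro add_mono mult_left_mono order_refl)
      have "norm (?z - ?Z) \<le> L_z p * norm (yk k \<omega> - ystar g ?x)"
        using zstar_lipschitz[of ?x "yk k \<omega>" ?x "ystar g ?x"] by (simp add: dist_norm norm_Pair)
      from norm_le_sq[OF this] show "(norm (?z - ?Z))\<^sup>2 \<le> (L_z p)\<^sup>2 * ?ey \<omega>" by (simp add: power_mult_distrib)
      show "(norm (?Z - ?Z'))\<^sup>2 \<le> ?C * (norm (?x' - ?x))\<^sup>2"
        using norm_le_sq[OF zstar_ystar_lipschitz[of ?x ?x']] by (simp add: power_mult_distrib norm_minus_commute)
    qed simp_all
    also have "\<dots> \<le> 3 * ?ez \<omega> + 3 * ((L_z p)\<^sup>2 * ?ey \<omega>) + 3 * (?C * (2 / (L_outer p)\<^sup>2 * (grad_sq k \<omega> + ?D \<omega>)))"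
      by (intro add_left_mono mult_left_mono dx) auto
    finally show "erz (Suc k) \<omega> \<le> 3 * ?ez \<omega> + 3 * (L_z p)\<^sup>2 * ?ey \<omega>
        + 3 * ?C * (2 / (L_outer p)\<^sup>2 * (grad_sq k \<omega> + ?D \<omega>))" by (simp only: mult.assoc)
  qed (simp add: erz_def)
  have Dint: "integrable M ?D" using D by (simp add: mean_le_def)
  let ?R = "\<lambda>\<omega>. outer_obj f g (xk k \<omega>) - grad_sq k \<omega> / (2 * L_outer p) + ?D \<omega> / (2 * L_outer p)"
  have le: "outer_obj f g (xk (Suc k) \<omega>) \<le> ?R \<omega>" for \<omega>
    using outer_step[of "xk k \<omega>" "psik k \<omega>"] by (simp add: run_Suc step_gamma_def grad_sq_def)
  have ge: "outer_inf f g \<le> outer_obj f g (xk (Suc k) \<omega>)" for \<omega>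
    unfolding outer_inf_def by (rule cINF_lower[OF bdd]) simp
  have Rint: "integrable M ?R" using int Gint Dint by simp
  \<comment> \<open>The objective at the new point is squeezed between the infimum and the
    integrable descent bound.\<close>
  show oint: ?int
  proof (rule Bochner_Integration.integrable_bound)
    show "integrable M (\<lambda>\<omega>. \<bar>?R \<omega>\<bar> + \<bar>outer_inf f g\<bar>)" using Rint by simp
    show "(\<lambda>\<omega>. outer_obj f g (xk (Suc k) \<omega>)) \<in> borel_measurable M" by measurable
    show "AE \<omega> in M. norm (outer_obj f g (xk (Suc k) \<omega>)) \<le> norm (\<bar>?R \<omega>\<bar> + \<bar>outer_inf f g\<bar>)"
    proof (rule AE_I2)
      fix \<omega>
      show "norm (outer_obj f g (xk (Suc k) \<omega>)) \<le> norm (\<bar>?R \<omega>\<bar> + \<bar>outer_inf f g\<bar>)"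
        using le[of \<omega>] ge[of \<omega>] unfolding real_norm_def by linarith
    qed
  qed
  have "(LINT \<omega>|M. outer_obj f g (xk (Suc k) \<omega>)) \<le> (LINT \<omega>|M. ?R \<omega>)"
    by (intro integral_mono oint Rint le)
  also have "\<dots> = (LINT \<omega>|M. outer_obj f g (xk k \<omega>)) - G / (2 * L_outer p) + (LINT \<omega>|M. ?D \<omega>) / (2 * L_outer p)"
    using int Gint Dint by (simp add: G_def)
  also have "\<dots> \<le> (LINT \<omega>|M. outer_obj f g (xk k \<omega>)) - G / (2 * L_outer p) + mse ey w / (2 * L_outer p)"
    using D L_outer_pos by (intro add_left_mono divide_right_mono) (auto simp: mean_le_def)
  finally show ?descent .
qed

end

section \<open>A Lyapunov function\<close>

text \<open>Pure arithmetic, organised as a budget. The conditions on \<open>a\<close> and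
  \<open>b\<close> let the move of each target cost at most \<open>(G + D) / (8 * L)\<close>, so of
  the descent \<open>G / (2 * L)\<close> one half survives, and \<open>D\<close> is charged with
  \<open>3 / (4 * L)\<close> in total. What \<open>D\<close> and the two recursions then charge per
  unit of \<open>e\<close> and \<open>w\<close> is brought back to \<open>a\<close> and
  \<open>b\<close> by \<open>contr_y\<close> and \<open>contr_z\<close>; the rest is additive
  noise.\<close>

lemma lyapunov_step:
  fixes L Ly Lz Lp Lx lam a b e w ey z D G e' w' Ob Ob' sxy sf t nz Bm rz ry sg :: real
  assumes pos: "0 < L" "0 < lam" "0 \<le> e" "0 \<le> w" "0 \<le> sg" "0 \<le> sxy" "0 \<le> t" "0 \<le> nz"
    and rate: "0 \<le> rz" "rz \<le> 1" "0 \<le> ry"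
    and L: "L = lam * (1 + Ly)\<^sup>2" and Lp: "lam * L \<le> Lp\<^sup>2"
    and a: "0 \<le> a" "32 * (a * Ly\<^sup>2) \<le> L" and b: "0 \<le> b" "48 * (b * Lz\<^sup>2) \<le> lam"
    and contr_y: "ry * (4 * Lp\<^sup>2 / L + 2 * a) \<le> a"
    and contr_z: "6 * rz * (3 / L * (Lx\<^sup>2 + 2 * sxy) + 3 * b) \<le> b"
    and ey: "ey = ry * e + sg"
    and z: "z = 2 * (rz * (3 * w + 3 * Lz\<^sup>2 * ey + 3 * t) + nz) + 2 * t"
    and D: "D = 4 * (sxy * (2 * z + 2 * Bm\<^sup>2)) + 4 * sf + 4 * (Lx\<^sup>2 * z) + 4 * (Lp\<^sup>2 * ey)"
    and e': "e' \<le> 2 * ey + 4 * Ly\<^sup>2 / L\<^sup>2 * (G + D)"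
    and w': "w' \<le> 3 * z + 3 * Lz\<^sup>2 * ey + 6 * Lz\<^sup>2 * (1 + Ly)\<^sup>2 / L\<^sup>2 * (G + D)"
    and Ob': "Ob' \<le> Ob - G / (2 * L) + D / (2 * L)"
    and GD: "0 \<le> G" "0 \<le> D"
  shows "Ob' + a * e' + b * w' + G / (4 * L) \<le> Ob + a * e + b * w
    + ((4 * Lp\<^sup>2 / L + 2 * a) * sg + 3 / L * (sf + 2 * sxy * Bm\<^sup>2)
       + (3 / L * (Lx\<^sup>2 + 2 * sxy) + 3 * b) * (8 * t + 2 * nz))"
proof -
  \<comment> \<open>The total price of the error \<open>z\<close>: \<open>3 / (4 * L)\<close> times
    its coefficient in \<open>D\<close>, plus \<open>3 * b\<close> from the recursion of
    \<open>w'\<close>.\<close>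
  define Q where "Q = 3 / L * (Lx\<^sup>2 + 2 * sxy) + 3 * b"
  have Q0: "0 \<le> Q" using pos b by (simp add: Q_def)
  have ey0: "0 \<le> ey" using pos rate by (simp add: ey)
  have "a * (4 * Ly\<^sup>2 / L\<^sup>2) = 32 * (a * Ly\<^sup>2) / (8 * L\<^sup>2)" by simp
  also have "\<dots> \<le> L / (8 * L\<^sup>2)" using a by (intro divide_right_mono) auto
  finally have c1: "a * (4 * Ly\<^sup>2 / L\<^sup>2) \<le> 1 / (8 * L)" using pos by (simp add: power2_eq_square)
  have "b * (6 * Lz\<^sup>2 * (1 + Ly)\<^sup>2 / L\<^sup>2) = 48 * (b * Lz\<^sup>2) * (1 + Ly)\<^sup>2 / (8 * L\<^sup>2)" by simp
  also have "\<dots> \<le> lam * (1 + Ly)\<^sup>2 / (8 * L\<^sup>2)" using b by (intro divide_right_mono mult_right_mono) auto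
  finally have c2: "b * (6 * Lz\<^sup>2 * (1 + Ly)\<^sup>2 / L\<^sup>2) \<le> 1 / (8 * L)"
    using pos unfolding L[symmetric] by (simp add: power2_eq_square)
  have "a * e' \<le> a * (2 * ey + 4 * Ly\<^sup>2 / L\<^sup>2 * (G + D))" using a e' by (intro mult_left_mono)
  also have "\<dots> = 2 * a * ey + a * (4 * Ly\<^sup>2 / L\<^sup>2) * (G + D)" by (simp add: algebra_simps)
  also have "\<dots> \<le> 2 * a * ey + 1 / (8 * L) * (G + D)" using GD by (intro add_left_mono mult_right_mono c1) simp
  finally have s1: "a * e' \<le> 2 * a * ey + 1 / (8 * L) * (G + D)" .
  have "b * w' \<le> b * (3 * z + 3 * Lz\<^sup>2 * ey + 6 * Lz\<^sup>2 * (1 + Ly)\<^sup>2 / L\<^sup>2 * (G + D))"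
    using b w' by (intro mult_left_mono)
  also have "\<dots> = 3 * b * z + 3 * (b * Lz\<^sup>2) * ey + b * (6 * Lz\<^sup>2 * (1 + Ly)\<^sup>2 / L\<^sup>2) * (G + D)"
    by (simp add: algebra_simps)
  also have "\<dots> \<le> 3 * b * z + 3 * (b * Lz\<^sup>2) * ey + 1 / (8 * L) * (G + D)"
    using GD by (intro add_left_mono mult_right_mono c2) simp
  finally have s2: "b * w' \<le> 3 * b * z + 3 * (b * Lz\<^sup>2) * ey + 1 / (8 * L) * (G + D)" .
  have "1 / (8 * L) * (G + D) = G / (8 * L) + D / (8 * L)" by (simp add: add_divide_distrib)
  moreover have "G / (2 * L) = 4 * (G / (8 * L))" "G / (4 * L) = 2 * (G / (8 * L))" "D / (2 * L) = 4 * (D / (8 * L))"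
    "3 * D / (4 * L) = 6 * (D / (8 * L))"
    by simp_all
  ultimately have "Ob' + a * e' + b * w' + G / (4 * L)
      \<le> Ob + 3 * D / (4 * L) + 2 * a * ey + 3 * b * z + 3 * (b * Lz\<^sup>2) * ey"
    using s1 s2 Ob' by linarith
  also have "3 * D / (4 * L) = 3 / L * (Lx\<^sup>2 + 2 * sxy) * z + 3 / L * (sf + 2 * sxy * Bm\<^sup>2) + 3 * Lp\<^sup>2 / L * ey"
    using pos by (simp add: D field_simps)
  finally have main: "Ob' + a * e' + b * w' + G / (4 * L)
      \<le> Ob + Q * z + 3 / L * (sf + 2 * sxy * Bm\<^sup>2) + 3 * Lp\<^sup>2 / L * ey + 2 * a * ey + 3 * (b * Lz\<^sup>2) * ey"
    by (simp add: Q_def algebra_simps)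
  have "Q * z = 6 * rz * Q * (w + Lz\<^sup>2 * ey) + rz * (6 * Q * t) + Q * (2 * nz + 2 * t)"
    by (simp add: z algebra_simps)
  also have "\<dots> \<le> b * (w + Lz\<^sup>2 * ey) + 1 * (6 * Q * t) + Q * (2 * nz + 2 * t)"
    using contr_z pos ey0 rate Q0 unfolding Q_def[symmetric] by (intro add_mono mult_right_mono) auto
  also have "\<dots> = b * w + (b * Lz\<^sup>2) * ey + Q * (8 * t + 2 * nz)" by (simp add: algebra_simps)
  finally have Qz: "Q * z \<le> b * w + (b * Lz\<^sup>2) * ey + Q * (8 * t + 2 * nz)" .
  \<comment> \<open>The error \<open>ey\<close> is charged with \<open>b * Lz\<^sup>2\<close> four
    times, three times by \<open>w'\<close> and once by \<open>z\<close>. Together this is at most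
    one more \<open>Lp\<^sup>2 / L\<close>, which explains the 4 in \<open>contr_y\<close>.\<close>
  have "4 * (b * Lz\<^sup>2) \<le> lam" using b pos by simp
  also have "\<dots> \<le> Lp\<^sup>2 / L" using Lp pos by (simp add: field_simps)
  finally have "4 * (b * Lz\<^sup>2) * ey \<le> Lp\<^sup>2 / L * ey" using ey0 by (rule mult_right_mono)
  moreover have "(4 * Lp\<^sup>2 / L + 2 * a) * ey = 4 * (Lp\<^sup>2 / L * ey) + 2 * a * ey"
    "3 * Lp\<^sup>2 / L * ey = 3 * (Lp\<^sup>2 / L * ey)"
    "4 * (b * Lz\<^sup>2) * ey = 3 * (b * Lz\<^sup>2) * ey + (b * Lz\<^sup>2) * ey"
    by (simp_all add: algebra_simps)
  ultimately have "3 * Lp\<^sup>2 / L * ey + 2 * a * ey + 3 * (b * Lz\<^sup>2) * ey + (b * Lz\<^sup>2) * ey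
      \<le> (4 * Lp\<^sup>2 / L + 2 * a) * ey"
    by linarith
  also have "\<dots> = ry * (4 * Lp\<^sup>2 / L + 2 * a) * e + (4 * Lp\<^sup>2 / L + 2 * a) * sg"
    by (simp only: ey distrib_left distrib_right mult_ac)
  also have "\<dots> \<le> a * e + (4 * Lp\<^sup>2 / L + 2 * a) * sg" using contr_y pos by (intro add_right_mono mult_right_mono)
  finally show ?thesis using main Qz unfolding Q_def[symmetric] by linarith
qed

lemma one_minus_power_le_exp:
  fixes x r :: real
  assumes "0 \<le> x" "x \<le> 1" "r \<le> real n * x"
  shows "(1 - x) ^ n \<le> exp (- r)"
proof -
  have "(1 - x) ^ n \<le> exp (- x) ^ n" using assms exp_ge_add_one_self[of "- x"] by (intro power_mono) auto
  also have "\<dots> = exp (- (real n * x))" by (simp add: exp_of_nat_mult[symmetric])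
  also have "\<dots> \<le> exp (- r)" using assms by simp
  finally show ?thesis .
qed

lemma exp_minus_ln: "0 < x \<Longrightarrow> exp (- ln x) = 1 / x" for x :: real
  by (simp add: exp_minus divide_inverse)

lemma inverse_square_le: "4 \<le> x \<Longrightarrow> 1 / x * (1 / x) \<le> 1 / (4 * x)" for x :: real
proof -
  assume x: "4 \<le> x"
  then have "4 * x \<le> x * x" by (intro mult_right_mono) auto
  then have "1 / (x * x) \<le> 1 / (4 * x)" using x by (intro divide_left_mono) auto
  then show "1 / x * (1 / x) \<le> 1 / (4 * x)" by simp
qed

lemma nat_floor_plus_one_ge: "x \<le> real (nat \<lfloor>x\<rfloor> + 1)"
  by linarith

text \<open>The two weights are the largest values that the move conditions of
  \<open>lyapunov_step\<close> admit, capped at 1 so that the initial Lyapunov value stays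
  comparable to the initial gap.\<close>

definition weight_y :: "bilevel_consts \<Rightarrow> real" where
  "weight_y p = min 1 (L_outer p / (32 * (L_y p)\<^sup>2))"

definition weight_z :: "bilevel_consts \<Rightarrow> real" where
  "weight_z p = min 1 (lam p / (48 * (L_z p)\<^sup>2))"

abbreviation C_max :: "bilevel_consts \<Rightarrow> real" where
  "C_max p \<equiv> max (C1 p) (max (C2 p) (C3 p))"

abbreviation C_max' :: "bilevel_consts \<Rightarrow> batch_sizes \<Rightarrow> real" where
  "C_max' p bs \<equiv> max (C1' p bs) (max (C2' p) (C3' p bs))"

section \<open>Contraction of the inner loops for the chosen numbers of steps\<close>

context amigo_process
begin

lemma lam_L_outer_le: "lam p * L_outer p \<le> (L_psi p)\<^sup>2"
proof -
  have "lam p * L_outer p = (lam p * (1 + L_y p))\<^sup>2"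
    using consts_pos by (simp add: L_outer_eq power2_eq_square)
  also have "\<dots> \<le> (L_psi p)\<^sup>2" using L_psi_ge lam_pos L_y_pos by (intro power_mono) auto
  finally show ?thesis .
qed

lemma weight_y_bounds: "0 < weight_y p" "weight_y p \<le> 1" "32 * (weight_y p * (L_y p)\<^sup>2) \<le> L_outer p"
proof -
  show "0 < weight_y p" "weight_y p \<le> 1" using L_outer_pos L_y_pos by (auto simp: weight_y_def)
  have "weight_y p * (32 * (L_y p)\<^sup>2) \<le> L_outer p / (32 * (L_y p)\<^sup>2) * (32 * (L_y p)\<^sup>2)"
    by (intro mult_right_mono) (auto simp: weight_y_def)
  then show "32 * (weight_y p * (L_y p)\<^sup>2) \<le> L_outer p" using L_y_pos by (simp add: mult_ac)
qed

lemma weight_z_bounds: "0 < weight_z p" "weight_z p \<le> 1" "48 * (weight_z p * (L_z p)\<^sup>2) \<le> lam p"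
proof -
  show "0 < weight_z p" "weight_z p \<le> 1" using lam_pos L_z_pos by (auto simp: weight_z_def)
  have "weight_z p * (48 * (L_z p)\<^sup>2) \<le> lam p / (48 * (L_z p)\<^sup>2) * (48 * (L_z p)\<^sup>2)"
    by (intro mult_right_mono) (auto simp: weight_z_def)
  then show "48 * (weight_z p * (L_z p)\<^sup>2) \<le> lam p" using L_z_pos by (simp add: mult_ac)
qed

text \<open>\<open>C1\<close> contains twice a logarithm: half of the exponent pays for the drift
  coefficient of \<open>y\<close>, the whole of it supplies an absolute constant.\<close>

lemma exp_C1: "exp (- (C1 p / 2)) \<le> 1 / (6 + 24 * (L_psi p)\<^sup>2 / L_outer p)" "exp (- C1 p) \<le> 1 / 36"
proof -
  let ?A = "6 + 24 * (L_psi p)\<^sup>2 / L_outer p"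
  have A: "6 \<le> ?A" using L_outer_pos by simp
  have "exp (- (C1 p / 2)) \<le> exp (- ln ?A)" by (simp add: C1_def eta0_def)
  also have "\<dots> = 1 / ?A" by (rule exp_minus_ln) (use A in linarith)
  finally show 1: "exp (- (C1 p / 2)) \<le> 1 / ?A" .
  have "exp (- C1 p) = (exp (- (C1 p / 2)))\<^sup>2" by (simp add: power2_eq_square exp_add[symmetric])
  also have "\<dots> \<le> (1 / 6)\<^sup>2"
    using A by (intro power_mono order_trans[OF 1] divide_left_mono) auto
  finally show "exp (- C1 p) \<le> 1 / 36" by (simp add: power2_eq_square)
qed

text \<open>With \<open>eta0 p = L_outer p\<close> and \<open>zeta0 p = 2 * L_outer p\<close> the
  maximum in \<open>C2\<close> is \<open>16 * L_outer p\<close>, whence the 64. The value is at most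
  \<open>weight_y p\<close>.\<close>

lemma exp_C2: "exp (- (C2 p / 2)) = 1 / (1 + 64 * (L_y p)\<^sup>2 / L_outer p)"
proof -
  have "4 * (L_y p)\<^sup>2 / (L_outer p)\<^sup>2 * max (L_outer p) (8 * (2 * L_outer p)) = 64 * (L_y p)\<^sup>2 / L_outer p"
    using L_outer_pos by (simp add: max_def power2_eq_square)
  then have "exp (- (C2 p / 2)) = exp (- ln (1 + 64 * (L_y p)\<^sup>2 / L_outer p))"
    by (simp add: C2_def eta0_def zeta0_def)
  also have "0 < 1 + 64 * (L_y p)\<^sup>2 / L_outer p" using L_outer_pos by (intro add_pos_nonneg) auto
  then have "exp (- ln (1 + 64 * (L_y p)\<^sup>2 / L_outer p)) = 1 / (1 + 64 * (L_y p)\<^sup>2 / L_outer p)"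
    by (rule exp_minus_ln)
  finally show ?thesis .
qed

text \<open>With \<open>A\<close> the argument of the logarithm, twice the logarithm gives two
  factors \<open>1 / A\<close>. One is weakened to \<open>1 / 4\<close>; the other will cancel the
  drift coefficient of \<open>z\<close>, which is at most \<open>A / 4\<close>.\<close>

lemma exp_C1': "exp (- C1' p bs) \<le> 1 / (4 * (4 + 12 / L_outer p * (2 * (L_psi p)\<^sup>2 + var_x p bs)))"
proof -
  define A where "A = 4 + 12 / L_outer p * (2 * (L_psi p)\<^sup>2 + var_x p bs)"
  have "0 \<le> var_x p bs" by (simp add: var_x_def var_gxy_def var_gyy_def)
  then have "0 \<le> 12 / L_outer p * (2 * (L_psi p)\<^sup>2 + var_x p bs)"
    using L_outer_pos by (intro mult_nonneg_nonneg add_nonneg_nonneg) auto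
  then have A: "4 \<le> A" by (simp add: A_def)
  have "exp (- C1' p bs) = exp (- (1 + 2 * ln A))" by (simp only: C1'_def eta0_def A_def)
  also have "\<dots> \<le> exp (- ln A) * exp (- ln A)" by (simp add: exp_add[symmetric] del: exp_minus)
  also have "exp (- ln A) = 1 / A" by (rule exp_minus_ln) (use A in linarith)
  also have "1 / A * (1 / A) \<le> 1 / (4 * A)" by (rule inverse_square_le[OF A])
  finally show ?thesis unfolding A_def .
qed

lemma exp_C2': "exp (- (C2' p / 2)) = 1 / (1 + 2 * (L_z p)\<^sup>2 / (L_y p)\<^sup>2 * (1 + 16 * (L_y p)\<^sup>2))"
proof -
  define A where "A = 1 + 2 * (L_z p)\<^sup>2 / (L_y p)\<^sup>2 * (1 + 16 * (L_y p)\<^sup>2)"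
  have "0 < A" unfolding A_def by (intro add_pos_nonneg) auto
  moreover have "C2' p / 2 = ln A" by (simp only: C2'_def A_def)
  ultimately have "exp (- (C2' p / 2)) = 1 / A" by (simp only: exp_minus_ln)
  then show ?thesis unfolding A_def .
qed

lemma C_nonneg: "0 \<le> C1 p" "0 \<le> C2 p" "0 \<le> C1' p bs" "0 \<le> C2' p"
proof -
  have v: "0 \<le> var_x p bs" by (simp add: var_x_def var_gxy_def var_gyy_def)
  have "1 \<le> 6 + 24 * (L_psi p)\<^sup>2 / eta0 p" using L_outer_pos by (simp add: eta0_def add_increasing2)
  then show "0 \<le> C1 p" unfolding C1_def using ln_ge_zero by fastforce
  have "1 \<le> 1 + 4 * (L_y p)\<^sup>2 / (L_outer p)\<^sup>2 * max (eta0 p) (8 * zeta0 p)"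
    using L_outer_pos by (simp add: eta0_def zeta0_def max_def)
  then show "0 \<le> C2 p" unfolding C2_def using ln_ge_zero by fastforce
  have "1 \<le> 4 + 12 / eta0 p * (2 * (L_psi p)\<^sup>2 + var_x p bs)"
    using L_outer_pos v by (simp add: eta0_def add_increasing2)
  then show "0 \<le> C1' p bs" unfolding C1'_def using ln_ge_zero by fastforce
  have "1 \<le> 1 + 2 * (L_z p)\<^sup>2 / (L_y p)\<^sup>2 * (1 + 16 * (L_y p)\<^sup>2)" by simp
  then show "0 \<le> C2' p" unfolding C2'_def using ln_ge_zero by fastforce
qed

text \<open>The spending plan for the exponents. The loop for \<open>y\<close> owns one copy of
  \<open>C_max\<close>, the loop for \<open>z\<close> two copies of both maxima because of the
  factor 2 in \<open>N_choice\<close>. Halves of \<open>C1\<close> and \<open>C2\<close> can be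
  spent side by side since each is at most half the maximum.\<close>

lemma C_sum_le:
  "C1 p + (C2 p / 2 + C2' p / 2) + C1' p bs \<le> 2 * (C_max p + C_max' p bs)"
  "C1 p / 2 + C2 p / 2 \<le> C_max p"
proof -
  define X X' where "X = C_max p" and "X' = C_max' p bs"
  have le: "C1 p \<le> X" "C2 p \<le> X" "C1' p bs \<le> X'" "C2' p \<le> X'" by (simp_all add: X_def X'_def)
  have nn: "0 \<le> X" "0 \<le> X'" using le C_nonneg by linarith+
  have "C1 p + (C2 p / 2 + C2' p / 2) + C1' p bs \<le> X + (X / 2 + X' / 2) + X'"
    by (intro add_mono divide_right_mono le) simp_all
  also have "\<dots> \<le> 2 * (X + X')" using nn by simp
  finally have "C1 p + (C2 p / 2 + C2' p / 2) + C1' p bs \<le> 2 * (X + X')" .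
  moreover have "C1 p / 2 + C2 p / 2 \<le> X" using le by linarith
  ultimately show "C1 p + (C2 p / 2 + C2' p / 2) + C1' p bs \<le> 2 * (C_max p + C_max' p bs)"
    "C1 p / 2 + C2 p / 2 \<le> C_max p" by (simp_all only: X_def X'_def)
qed

lemma rho_y_bounds: "0 \<le> rho_y" "rho_y \<le> exp (- C_max p)"
proof -
  have x: "0 \<le> mug p / Lg p" "mug p / Lg p \<le> 1" using consts_pos Lg_pos ssc.m_le_L by auto
  then show "0 \<le> rho_y" by (simp add: rho_y_def)
  have "1 / step_alpha p * (1 / mug p) * C_max p \<le> real (T_choice p)"
    unfolding T_choice_def by (rule nat_floor_plus_one_ge)
  then have "(1 / step_alpha p * (1 / mug p) * C_max p) * (mug p / Lg p) \<le> real (T_choice p) * (mug p / Lg p)"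
    using x by (intro mult_right_mono)
  moreover have "(1 / step_alpha p * (1 / mug p) * C_max p) * (mug p / Lg p) = C_max p"
    using consts_pos Lg_pos by (simp add: step_alpha_def)
  ultimately show "rho_y \<le> exp (- C_max p)"
    unfolding rho_y_def using x by (intro one_minus_power_le_exp) simp_all
qed

lemma rho_z_bounds: "0 \<le> rho_z" "rho_z \<le> 1" "rho_z \<le> exp (- (2 * (C_max p + C_max' p bs)))"
proof -
  have x: "0 \<le> mug p / (2 * Lg p)" "mug p / (2 * Lg p) \<le> 1" using consts_pos Lg_pos ssc.m_le_L by auto
  then show "0 \<le> rho_z" "rho_z \<le> 1" by (simp_all add: rho_z_def power_le_one)
  let ?N = "2 * (1 / step_beta p) * (1 / mug p) * (C_max p + C_max' p bs)"
  have "?N \<le> real (N_choice p bs)" unfolding N_choice_def by (rule nat_floor_plus_one_ge)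
  then have "?N * (mug p / (2 * Lg p)) \<le> real (N_choice p bs) * (mug p / (2 * Lg p))"
    using x by (intro mult_right_mono)
  moreover have "?N * (mug p / (2 * Lg p)) = 2 * (C_max p + C_max' p bs)"
    using consts_pos Lg_pos by (simp add: step_beta_def)
  ultimately show "rho_z \<le> exp (- (2 * (C_max p + C_max' p bs)))"
    unfolding rho_z_def using x by (intro one_minus_power_le_exp) simp_all
qed

text \<open>The squares hidden in \<open>C1\<close> and \<open>C2\<close> allow to spend half of each exponent: one factor absorbs the
  drift, the other one the Lyapunov weight.\<close>

lemma contraction_y: "rho_y * (4 * (L_psi p)\<^sup>2 / L_outer p + 2 * weight_y p) \<le> weight_y p"
proof -
  let ?A = "6 + 24 * (L_psi p)\<^sup>2 / L_outer p" and ?R = "1 + 64 * (L_y p)\<^sup>2 / L_outer p"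
  have A: "6 \<le> ?A" and R: "1 \<le> ?R" using L_outer_pos by simp_all
  have "rho_y \<le> exp (- (C1 p / 2 + C2 p / 2))"
  proof (rule order_trans[OF rho_y_bounds(2)])
    show "exp (- C_max p) \<le> exp (- (C1 p / 2 + C2 p / 2))" using C_sum_le(2) by simp
  qed
  also have "\<dots> = exp (- (C1 p / 2)) * exp (- (C2 p / 2))" by (simp add: exp_add[symmetric])
  also have "\<dots> \<le> 1 / ?A * (1 / ?R)" unfolding exp_C2 by (intro mult_right_mono exp_C1) (use R in auto)
  finally have r: "rho_y \<le> 1 / ?A * (1 / ?R)" .
  \<comment> \<open>The factor from \<open>C2\<close> is at most the weight, whichever entry attains
    the minimum in \<open>weight_y\<close>. The drift then costs \<open>weight_y p / 6\<close>, and
    the term \<open>2 * weight_y p\<close> costs another \<open>weight_y p / 18\<close>.\<close>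
  have "L_outer p / (64 * (L_y p)\<^sup>2) \<le> L_outer p / (32 * (L_y p)\<^sup>2)"
    using L_outer_pos L_y_pos by (intro divide_left_mono) auto
  moreover have "1 / ?R \<le> 1 / (64 * (L_y p)\<^sup>2 / L_outer p)"
    using L_outer_pos L_y_pos by (intro frac_le) auto
  ultimately have R1: "1 / ?R \<le> weight_y p" using R by (simp add: weight_y_def)
  have "rho_y * (4 * (L_psi p)\<^sup>2 / L_outer p) \<le> 1 / ?A * (1 / ?R) * (?A / 6)"
    using L_outer_pos A R by (intro mult_mono r) (auto simp: add_divide_distrib)
  also have "\<dots> = 1 / ?R / 6" using A by simp
  also have "\<dots> \<le> weight_y p / 6" by (intro divide_right_mono R1) simp
  finally have 1: "rho_y * (4 * (L_psi p)\<^sup>2 / L_outer p) \<le> weight_y p / 6" .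
  have "rho_y \<le> exp (- C1 p)" by (rule order_trans[OF rho_y_bounds(2)]) simp
  then have "rho_y * (2 * weight_y p) \<le> 1 / 36 * (2 * weight_y p)"
    using exp_C1(2) weight_y_bounds by (intro mult_right_mono) auto
  with 1 show ?thesis using weight_y_bounds(1) unfolding distrib_left by linarith
qed

text \<open>\<open>C1'\<close> cancels the drift coefficient, \<open>C1\<close> supplies the
  constant \<open>1 / 36\<close>, and the factors from \<open>C2\<close> and \<open>C2'\<close>
  together come down to \<open>weight_z\<close>.\<close>

lemma contraction_z:
  "6 * rho_z * (3 / L_outer p * ((Lg' p)\<^sup>2 + 2 * var_gxy p bs) + 3 * weight_z p) \<le> weight_z p"
proof -
  let ?A = "4 + 12 / L_outer p * (2 * (L_psi p)\<^sup>2 + var_x p bs)"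
  let ?R = "1 + 64 * (L_y p)\<^sup>2 / L_outer p"
  let ?R' = "1 + 2 * (L_z p)\<^sup>2 / (L_y p)\<^sup>2 * (1 + 16 * (L_y p)\<^sup>2)"
  have v: "0 \<le> var_gxy p bs" "0 \<le> var_gyy p bs" by (simp_all add: var_gxy_def var_gyy_def)
  then have vx: "2 * var_gxy p bs \<le> var_x p bs" by (simp add: var_x_def)
  have A: "4 \<le> ?A" and R: "1 \<le> ?R" and R': "1 \<le> ?R'" using L_outer_pos v vx by simp_all
  have R'2: "?R' = 1 + 2 * (L_z p)\<^sup>2 / (L_y p)\<^sup>2 + 32 * (L_z p)\<^sup>2" using L_y_pos by (simp add: field_simps)
  have "C1 p + (C2 p / 2 + C2' p / 2) + C1' p bs \<le> 2 * (C_max p + C_max' p bs)"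
    by (rule C_sum_le(1))
  then have "rho_z \<le> exp (- (C1 p + (C2 p / 2 + C2' p / 2) + C1' p bs))"
    by (intro order_trans[OF rho_z_bounds(3)]) simp
  also have "\<dots> = exp (- C1 p) * (exp (- (C2 p / 2)) * exp (- (C2' p / 2))) * exp (- C1' p bs)"
    by (simp add: exp_add[symmetric] algebra_simps)
  also have "\<dots> \<le> 1 / 36 * (exp (- (C2 p / 2)) * exp (- (C2' p / 2))) * (1 / (4 * ?A))"
    by (intro mult_mono exp_C1(2) exp_C1' order_refl mult_nonneg_nonneg) auto
  also have "\<dots> = 1 / 36 * (1 / (?R * ?R')) * (1 / (4 * ?A))" by (simp add: exp_C2 exp_C2')
  finally have r: "rho_z \<le> 1 / 36 * (1 / (?R * ?R')) * (1 / (4 * ?A))" .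
  have RR: "1 / (?R * ?R') \<le> 2 * weight_z p"
  proof -
    \<comment> \<open>For \<open>1 \<le> L_y p\<close> one has
      \<open>L_outer p \<le> 4 * lam p * (L_y p)\<^sup>2\<close>, so \<open>?R\<close> beats
      \<open>1 / lam p\<close> and \<open>?R'\<close> supplies \<open>32 * (L_z p)\<^sup>2\<close>.
      Otherwise \<open>L_outer p \<le> 4 * lam p\<close>, and the summands of \<open>?R\<close> and
      \<open>?R'\<close> are multiplied in which \<open>(L_y p)\<^sup>2\<close> cancels.\<close>
    have key: "32 * (L_z p)\<^sup>2 \<le> lam p * (?R * ?R')"
    proof (cases "1 \<le> L_y p")
      case True
      then have "(1 + L_y p)\<^sup>2 \<le> (2 * L_y p)\<^sup>2" using L_y_pos by (intro power_mono) auto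
      then have "L_outer p \<le> lam p * (4 * (L_y p)\<^sup>2)"
        using lam_pos consts_pos by (simp add: L_outer_eq power_mult_distrib)
      then have "1 \<le> lam p * (64 * (L_y p)\<^sup>2 / L_outer p)" using L_outer_pos lam_pos by (simp add: field_simps)
      also have "\<dots> \<le> lam p * ?R" using lam_pos by (intro mult_left_mono) auto
      finally have "1 * (32 * (L_z p)\<^sup>2) \<le> lam p * ?R * ?R'"
        unfolding R'2 using lam_pos R by (intro mult_mono) auto
      then show ?thesis by (simp add: mult.assoc)
    next
      case False
      then have "(1 + L_y p)\<^sup>2 \<le> 2\<^sup>2" using L_y_pos by (intro power_mono) auto
      then have L: "L_outer p \<le> lam p * 4" using lam_pos consts_pos by (simp add: L_outer_eq)
      have "32 * (L_z p)\<^sup>2 * L_outer p \<le> 32 * (L_z p)\<^sup>2 * (lam p * 4)" using L by (intro mult_left_mono) auto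
      then have "32 * (L_z p)\<^sup>2 \<le> lam p * (64 * (L_y p)\<^sup>2 / L_outer p * (2 * (L_z p)\<^sup>2 / (L_y p)\<^sup>2))"
        using L_outer_pos L_y_pos by (simp add: field_simps)
      also have "\<dots> \<le> lam p * (?R * ?R')"
        unfolding R'2 using lam_pos R L_outer_pos by (intro mult_left_mono mult_mono) auto
      finally show ?thesis .
    qed
    have "1 / (?R * ?R') \<le> lam p / (32 * (L_z p)\<^sup>2)"
      using key L_z_pos mult_pos_pos[of ?R ?R'] R R' by (simp add: divide_simps mult_ac)
    also have "\<dots> \<le> lam p / (24 * (L_z p)\<^sup>2)" using lam_pos L_z_pos by (intro frac_le) auto
    also have "\<dots> = 2 * (lam p / (48 * (L_z p)\<^sup>2))" by simp
    finally have "1 / (?R * ?R') \<le> 2 * (lam p / (48 * (L_z p)\<^sup>2))" .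
    moreover have "1 * 1 \<le> ?R * ?R'" using R R' by (intro mult_mono) auto
    then have "1 / (?R * ?R') \<le> 2" by (simp add: divide_simps)
    ultimately show ?thesis by (simp add: weight_z_def)
  qed
  have "(Lg' p)\<^sup>2 \<le> (L_psi p)\<^sup>2" using L_psi_ge consts_pos by (intro power_mono) auto
  also have "\<dots> \<le> 2 * (L_psi p)\<^sup>2" by simp
  finally have Lg2: "(Lg' p)\<^sup>2 \<le> 2 * (L_psi p)\<^sup>2" .
  have "3 / L_outer p * ((Lg' p)\<^sup>2 + 2 * var_gxy p bs) \<le> 3 / L_outer p * (2 * (L_psi p)\<^sup>2 + var_x p bs)"
    using L_outer_pos by (intro mult_left_mono add_mono vx Lg2) auto
  also have "\<dots> \<le> ?A / 4" by simp
  finally have "3 / L_outer p * ((Lg' p)\<^sup>2 + 2 * var_gxy p bs) \<le> ?A / 4" .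
  from mult_mono[OF r this order_trans[OF rho_z_bounds(1) r]]
  have "rho_z * (3 / L_outer p * ((Lg' p)\<^sup>2 + 2 * var_gxy p bs))
      \<le> 1 / 36 * (1 / (?R * ?R')) * (1 / (4 * ?A)) * (?A / 4)"
    using L_outer_pos v by simp
  also have "\<dots> = 1 / 576 * (1 / (?R * ?R'))"
  proof -
    have "1 / 36 * x * (1 / (4 * y)) * (y / 4) = 1 / 576 * x" if "0 < y" for x y :: real
      using that by simp
    then show ?thesis using A by (meson less_le_trans zero_less_numeral)
  qed
  also have "\<dots> \<le> 1 / 576 * (2 * weight_z p)" by (intro mult_left_mono RR) simp
  finally have 1: "rho_z * (3 / L_outer p * ((Lg' p)\<^sup>2 + 2 * var_gxy p bs)) \<le> 1 / 576 * (2 * weight_z p)" .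
  have "C1 p \<le> 2 * (C_max p + C_max' p bs)" using C_sum_le(1) C_nonneg by linarith
  then have "rho_z \<le> exp (- C1 p)" by (intro order_trans[OF rho_z_bounds(3)]) simp
  then have "rho_z * (3 * weight_z p) \<le> 1 / 36 * (3 * weight_z p)"
    using exp_C1(2) weight_z_bounds by (intro mult_right_mono) auto
  with 1 show ?thesis using weight_z_bounds(1) unfolding distrib_left by linarith
qed

section \<open>Telescoping and the initial Lyapunov value\<close>

definition drift_noise :: real where
  "drift_noise = (4 * (L_psi p)\<^sup>2 / L_outer p + 2 * weight_y p) * noise_y
     + 3 / L_outer p * (var_f p bs + 2 * var_gxy p bs * (Bf p / mug p)\<^sup>2)
     + (3 / L_outer p * ((Lg' p)\<^sup>2 + 2 * var_gxy p bs) + 3 * weight_z p)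
         * (8 * (var_f p bs / (mug p)\<^sup>2) + 2 * noise_z)"

lemma noise_nonneg: "0 \<le> noise_y" "0 \<le> noise_z" "0 \<le> var_f p bs" "0 \<le> var_gxy p bs"
  using Lg_pos consts_pos by (simp_all add: noise_y_def noise_z_def var_f_def var_g_def var_gyy_def var_gxy_def)

text \<open>Integrability is carried through the induction because \<open>outer_iteration\<close>
  presupposes it at the current point.\<close>

lemma lyapunov_telescope:
  assumes bdd: "bdd_below (range (outer_obj f g))"
    and int: "integrable M (\<lambda>\<omega>. outer_obj f g (xk 0 \<omega>))" "integrable M (ery 0)" "integrable M (erz 0)"
  shows "integrable M (\<lambda>\<omega>. outer_obj f g (xk k \<omega>)) \<and> integrable M (ery k) \<and> integrable M (erz k)
    \<and> (LINT \<omega>|M. outer_obj f g (xk k \<omega>)) + weight_y p * (LINT \<omega>|M. ery k \<omega>) + weight_z p * (LINT \<omega>|M. erz k \<omega>)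
       + (\<Sum>i<k. LINT \<omega>|M. grad_sq i \<omega>) / (4 * L_outer p)
      \<le> (LINT \<omega>|M. outer_obj f g (xk 0 \<omega>)) + weight_y p * (LINT \<omega>|M. ery 0 \<omega>) + weight_z p * (LINT \<omega>|M. erz 0 \<omega>)
       + real k * drift_noise"
proof (induction k)
  case 0
  show ?case using int by simp
next
  case (Suc k)
  define e w where "e = (LINT \<omega>|M. ery k \<omega>)" and "w = (LINT \<omega>|M. erz k \<omega>)"
  have e: "mean_le M (ery k) e" and w: "mean_le M (erz k) w"
    using Suc by (simp_all add: mean_le_def e_def w_def)
  have oint: "integrable M (\<lambda>\<omega>. outer_obj f g (xk k \<omega>))" using Suc by simp
  note step = outer_iteration[OF bdd oint e w]
  let ?ey = "rho_y * e + noise_y"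
  have "mean_le M (\<lambda>\<omega>. (norm (yk k \<omega> - ystar g (xk k \<omega>)))\<^sup>2) ?ey" by (rule mean_yk[OF e])
  from mean_psik[OF this w] have D0: "0 \<le> mse ?ey w" by (rule mean_le_nonneg) simp
  have "(LINT \<omega>|M. outer_obj f g (xk (Suc k) \<omega>)) + weight_y p * (LINT \<omega>|M. ery (Suc k) \<omega>)
      + weight_z p * (LINT \<omega>|M. erz (Suc k) \<omega>) + (LINT \<omega>|M. grad_sq k \<omega>) / (4 * L_outer p)
    \<le> (LINT \<omega>|M. outer_obj f g (xk k \<omega>)) + weight_y p * e + weight_z p * w + drift_noise"
    unfolding drift_noise_def
  proof (rule lyapunov_step[where D = "mse ?ey w" and z = "zeta ?ey w" and ey = ?ey and rz = rho_z and ry = rho_y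
        and Lz = "L_z p" and Ly = "L_y p" and lam = "lam p"])
    show "0 < L_outer p" by (rule L_outer_pos)
    show "0 < lam p" by (rule lam_pos)
    show "0 \<le> e" by (rule mean_le_nonneg[OF e]) (simp add: ery_def)
    show "0 \<le> w" by (rule mean_le_nonneg[OF w]) (simp add: erz_def)
    show "0 \<le> noise_y" "0 \<le> noise_z" "0 \<le> var_gxy p bs" by (rule noise_nonneg)+
    show "0 \<le> var_f p bs / (mug p)\<^sup>2" using noise_nonneg(3) by simp
    show "0 \<le> rho_z" "rho_z \<le> 1" "0 \<le> rho_y" by (rule rho_z_bounds rho_y_bounds)+
    show "lam p * L_outer p \<le> (L_psi p)\<^sup>2" by (rule lam_L_outer_le)
    show "0 \<le> weight_y p" "0 \<le> weight_z p" using weight_y_bounds(1) weight_z_bounds(1) by linarith+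
    show "32 * (weight_y p * (L_y p)\<^sup>2) \<le> L_outer p" by (rule weight_y_bounds)
    show "48 * (weight_z p * (L_z p)\<^sup>2) \<le> lam p" by (rule weight_z_bounds)
    show "rho_y * (4 * (L_psi p)\<^sup>2 / L_outer p + 2 * weight_y p) \<le> weight_y p" by (rule contraction_y)
    show "6 * rho_z * (3 / L_outer p * ((Lg' p)\<^sup>2 + 2 * var_gxy p bs) + 3 * weight_z p) \<le> weight_z p"
      by (rule contraction_z)
    show "zeta ?ey w = 2 * (rho_z * (3 * w + 3 * (L_z p)\<^sup>2 * ?ey + 3 * (var_f p bs / (mug p)\<^sup>2)) + noise_z)
      + 2 * (var_f p bs / (mug p)\<^sup>2)" by (rule zeta_def)
    show "mse ?ey w = 4 * (var_gxy p bs * (2 * zeta ?ey w + 2 * (Bf p / mug p)\<^sup>2)) + 4 * var_f p bs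
      + 4 * ((Lg' p)\<^sup>2 * zeta ?ey w) + 4 * ((L_psi p)\<^sup>2 * ?ey)" by (rule mse_def)
    show "L_outer p = lam p * (1 + L_y p)\<^sup>2" using consts_pos by (simp add: L_outer_eq)
    show "(LINT \<omega>|M. ery (Suc k) \<omega>) \<le> 2 * ?ey + 4 * (L_y p)\<^sup>2 / (L_outer p)\<^sup>2 * ((LINT \<omega>|M. grad_sq k \<omega>) + mse ?ey w)"
      using step(1) unfolding mean_le_def by (rule conjunct2)
    show "(LINT \<omega>|M. erz (Suc k) \<omega>) \<le> 3 * zeta ?ey w + 3 * (L_z p)\<^sup>2 * ?ey
       + 6 * (L_z p)\<^sup>2 * (1 + L_y p)\<^sup>2 / (L_outer p)\<^sup>2 * ((LINT \<omega>|M. grad_sq k \<omega>) + mse ?ey w)"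
      using step(2) unfolding mean_le_def by (rule conjunct2)
    show "0 \<le> (LINT \<omega>|M. grad_sq k \<omega>)" by (rule integral_nonneg_AE) (simp add: grad_sq_def)
    show "0 \<le> mse ?ey w" by (rule D0)
    show "(LINT \<omega>|M. outer_obj f g (xk (Suc k) \<omega>)) \<le> (LINT \<omega>|M. outer_obj f g (xk k \<omega>))
       - (LINT \<omega>|M. grad_sq k \<omega>) / (2 * L_outer p) + mse ?ey w / (2 * L_outer p)" by (rule step(4))
  qed (rule refl)
  moreover have "integrable M (ery (Suc k))" "integrable M (erz (Suc k))"
    using step(1,2) by (simp_all add: mean_le_def)
  moreover have "(\<Sum>i<Suc k. LINT \<omega>|M. grad_sq i \<omega>) / (4 * L_outer p)
      = (\<Sum>i<k. LINT \<omega>|M. grad_sq i \<omega>) / (4 * L_outer p) + (LINT \<omega>|M. grad_sq k \<omega>) / (4 * L_outer p)"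
    by (simp add: add_divide_distrib)
  moreover have "real (Suc k) * drift_noise = real k * drift_noise + drift_noise" by (simp add: algebra_simps)
  ultimately show ?case
    using Suc step(3) unfolding e_def w_def by linarith
qed

text \<open>\<open>zstar\<close> is bounded by \<open>Bf p / mug p\<close>, so a second moment of
  the initial \<open>z\<close> controls the distance to either reference point.\<close>

lemma erz_0_integrable:
  assumes "integrable M (\<lambda>\<omega>. (norm (zprev 0 \<omega>))\<^sup>2)"
  shows "integrable M (erz 0)" "integrable M (\<lambda>\<omega>. (norm (zprev 0 \<omega> - zstar f g (xk 0 \<omega>) (yk 0 \<omega>)))\<^sup>2)"
proof -
  define r where "r = (LINT \<omega>|M. (norm (zprev 0 \<omega>))\<^sup>2)"
  have "mean_le M (\<lambda>\<omega>. 2 * (norm (zprev 0 \<omega>))\<^sup>2 + 2 * (Bf p / mug p)\<^sup>2) (2 * r + 2 * (Bf p / mug p)\<^sup>2)"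
    using assms by (intro mean_le_add mean_le_cmult mean_le_const) (auto simp: mean_le_def r_def)
  note dom = mean_le_dominated[OF this]
  have le: "(norm (zprev 0 \<omega> - zstar f g x y))\<^sup>2 \<le> 2 * (norm (zprev 0 \<omega>))\<^sup>2 + 2 * (Bf p / mug p)\<^sup>2" for \<omega> x y
    using norm_sq_add2[of "zprev 0 \<omega>" "- zstar f g x y"] norm_le_sq[OF norm_zstar[of x y]] by simp
  have "mean_le M (erz 0) (2 * r + 2 * (Bf p / mug p)\<^sup>2)"
    by (rule dom) (use le in \<open>auto simp: erz_def\<close>)
  then show "integrable M (erz 0)" by (simp add: mean_le_def)
  have "mean_le M (\<lambda>\<omega>. (norm (zprev 0 \<omega> - zstar f g (xk 0 \<omega>) (yk 0 \<omega>)))\<^sup>2) (2 * r + 2 * (Bf p / mug p)\<^sup>2)"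
    by (rule dom) (use le in auto)
  then show "integrable M (\<lambda>\<omega>. (norm (zprev 0 \<omega> - zstar f g (xk 0 \<omega>) (yk 0 \<omega>)))\<^sup>2)" by (simp add: mean_le_def)
qed

text \<open>The initial gap refers to \<open>zstar\<close> at the \<open>y\<close> produced by the
  first inner loop, whereas \<open>erz\<close> refers to the exact \<open>ystar\<close>; the change
  of reference costs the error of \<open>yk 0\<close>.\<close>

lemma initial_erz:
  assumes e: "mean_le M (ery 0) e"
    and z: "integrable M (\<lambda>\<omega>. (norm (zprev 0 \<omega> - zstar f g (xk 0 \<omega>) (yk 0 \<omega>)))\<^sup>2)"
  shows "mean_le M (erz 0) (2 * (LINT \<omega>|M. (norm (zprev 0 \<omega> - zstar f g (xk 0 \<omega>) (yk 0 \<omega>)))\<^sup>2)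
    + 2 * ((L_z p)\<^sup>2 * (rho_y * e + noise_y)))"
proof (rule mean_le_dominated)
  show "mean_le M (\<lambda>\<omega>. 2 * (norm (zprev 0 \<omega> - zstar f g (xk 0 \<omega>) (yk 0 \<omega>)))\<^sup>2
      + 2 * ((L_z p)\<^sup>2 * (norm (yk 0 \<omega> - ystar g (xk 0 \<omega>)))\<^sup>2))
    (2 * (LINT \<omega>|M. (norm (zprev 0 \<omega> - zstar f g (xk 0 \<omega>) (yk 0 \<omega>)))\<^sup>2)
    + 2 * ((L_z p)\<^sup>2 * (rho_y * e + noise_y)))"
    by (intro mean_le_add mean_le_cmult mean_yk[OF e]) (use z in \<open>auto simp: mean_le_def\<close>)
  show "erz 0 \<in> borel_measurable M" by measurable
  fix \<omega>
  let ?z = "zstar f g (xk 0 \<omega>) (yk 0 \<omega>)" and ?Z = "zstar f g (xk 0 \<omega>) (ystar g (xk 0 \<omega>))"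
  have "norm (?z - ?Z) \<le> L_z p * norm (yk 0 \<omega> - ystar g (xk 0 \<omega>))"
    using zstar_lipschitz[of "xk 0 \<omega>" "yk 0 \<omega>" "xk 0 \<omega>" "ystar g (xk 0 \<omega>)"] by (simp add: dist_norm norm_Pair)
  from norm_le_sq[OF this] have "(norm (?z - ?Z))\<^sup>2 \<le> (L_z p)\<^sup>2 * (norm (yk 0 \<omega> - ystar g (xk 0 \<omega>)))\<^sup>2"
    by (simp add: power_mult_distrib)
  then show "erz 0 \<omega> \<le> 2 * (norm (zprev 0 \<omega> - ?z))\<^sup>2 + 2 * ((L_z p)\<^sup>2 * (norm (yk 0 \<omega> - ystar g (xk 0 \<omega>)))\<^sup>2)"
    using norm_sq_add2[of "zprev 0 \<omega> - ?z" "?z - ?Z"] by (simp add: erz_def)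
qed (simp add: erz_def)

lemma initial_gap_eq:
  "initial_gap M f g fh gh p bs \<xi> init = (LINT \<omega>|M. outer_obj f g (xk 0 \<omega>) - outer_inf f g)
     + (LINT \<omega>|M. ery 0 \<omega>) + (LINT \<omega>|M. (norm (zprev 0 \<omega> - zstar f g (xk 0 \<omega>) (yk 0 \<omega>)))\<^sup>2)"
proof -
  have "fst (snd (amigo_run fh gh p bs \<xi> init 1 \<omega>)) = yk 0 \<omega>" for \<omega>
    using run_Suc(2)[of 0 \<omega>] by (simp add: yprev_def)
  moreover have "amigo_run fh gh p bs \<xi> init 0 \<omega> = init \<omega>" for \<omega> by (simp add: amigo_run_def)
  ultimately show ?thesis
    by (simp add: initial_gap_def Let_def xk_def yprev_def zprev_def ery_def)
qed

text \<open>The initial Lyapunov value is at most twice the gap, whence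
  \<open>8 * L_outer p\<close>. The change of reference in \<open>initial_erz\<close> leaves the
  extra term with \<open>lam p * noise_y\<close>, which does not grow with \<open>k\<close>.\<close>

lemma gradient_sum_bound:
  assumes bdd: "bdd_below (range (outer_obj f g))"
    and int: "integrable M (\<lambda>\<omega>. outer_obj f g (xk 0 \<omega>))" "integrable M (ery 0)"
      "integrable M (\<lambda>\<omega>. (norm (zprev 0 \<omega>))\<^sup>2)"
  shows "integrable M (grad_sq i)"
    and "(\<Sum>i<k. LINT \<omega>|M. grad_sq i \<omega>) \<le> 8 * L_outer p * initial_gap M f g fh gh p bs \<xi> init
       + 4 * L_outer p * lam p * noise_y + 4 * L_outer p * (real k * drift_noise)"
    and "0 \<le> initial_gap M f g fh gh p bs \<xi> init"
proof -
  note z = erz_0_integrable[OF int(3)]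
  note tel = lyapunov_telescope[OF bdd int(1,2) z(1)]
  show "integrable M (grad_sq i)" using grad_sq_integrable[OF bdd] tel by blast
  define e0 w0 z0 o0 where "e0 = (LINT \<omega>|M. ery 0 \<omega>)" and "w0 = (LINT \<omega>|M. erz 0 \<omega>)"
    and "z0 = (LINT \<omega>|M. (norm (zprev 0 \<omega> - zstar f g (xk 0 \<omega>) (yk 0 \<omega>)))\<^sup>2)"
    and "o0 = (LINT \<omega>|M. outer_obj f g (xk 0 \<omega>)) - outer_inf f g"
  have e: "mean_le M (ery 0) e0" using int by (simp add: mean_le_def e0_def)
  have inf: "outer_inf f g \<le> outer_obj f g x" for x
    unfolding outer_inf_def by (rule cINF_lower[OF bdd]) simp
  have inf_le: "outer_inf f g \<le> (LINT \<omega>|M. outer_obj f g (xk k \<omega>))" for k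
  proof -
    have "(LINT \<omega>|M. outer_inf f g) \<le> (LINT \<omega>|M. outer_obj f g (xk k \<omega>))"
      by (intro integral_mono inf) (use tel in auto)
    then show ?thesis by (simp add: prob_space)
  qed
  have gap: "initial_gap M f g fh gh p bs \<xi> init = o0 + e0 + z0"
    using int by (simp add: initial_gap_eq o0_def e0_def z0_def prob_space)
  have nn: "0 \<le> e0" "0 \<le> z0" "0 \<le> o0"
    using inf_le[of 0] by (auto simp: e0_def z0_def o0_def ery_def intro: integral_nonneg_AE)
  then show "0 \<le> initial_gap M f g fh gh p bs \<xi> init" by (simp add: gap)
  have w0: "w0 \<le> 2 * z0 + 2 * ((L_z p)\<^sup>2 * (rho_y * e0 + noise_y))"
    using initial_erz[OF e z(2)] by (simp add: mean_le_def w0_def z0_def)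
  have r0: "0 \<le> rho_y * e0 + noise_y" using nn rho_y_bounds noise_nonneg by simp
  have "weight_z p * w0 \<le> weight_z p * (2 * z0) + 2 * (weight_z p * (L_z p)\<^sup>2) * (rho_y * e0 + noise_y)"
    using mult_left_mono[OF w0, of "weight_z p"] weight_z_bounds by (simp add: algebra_simps)
  also have "\<dots> \<le> 1 * (2 * z0) + lam p * (rho_y * e0 + noise_y)"
    using weight_z_bounds nn r0 lam_pos by (intro add_mono mult_right_mono) auto
  also have "lam p * (rho_y * e0 + noise_y) = (rho_y * lam p) * e0 + lam p * noise_y" by (simp add: algebra_simps)
  \<comment> \<open>\<open>rho_y\<close> absorbs \<open>lam p\<close>: the drift coefficient in
    \<open>contraction_y\<close> dominates \<open>lam p\<close>, and
    \<open>weight_y p \<le> 1\<close>.\<close>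
  also have "(rho_y * lam p) * e0 \<le> 1 * e0"
  proof (rule mult_right_mono[OF _ nn(1)])
    have "lam p \<le> (L_psi p)\<^sup>2 / L_outer p" using lam_L_outer_le L_outer_pos by (simp add: field_simps)
    also have "\<dots> \<le> 4 * (L_psi p)\<^sup>2 / L_outer p + 2 * weight_y p"
      using L_outer_pos weight_y_bounds by (intro add_increasing2 divide_right_mono) auto
    finally have "rho_y * lam p \<le> rho_y * (4 * (L_psi p)\<^sup>2 / L_outer p + 2 * weight_y p)"
      using rho_y_bounds by (intro mult_left_mono)
    then show "rho_y * lam p \<le> 1" using contraction_y weight_y_bounds by simp
  qed
  finally have bw: "weight_z p * w0 \<le> 2 * z0 + (e0 + lam p * noise_y)" by simp
  have ae: "weight_y p * e0 \<le> e0" using weight_y_bounds nn by (simp add: mult_left_le_one_le)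
  have ek: "0 \<le> weight_y p * (LINT \<omega>|M. ery k \<omega>)" "0 \<le> weight_z p * (LINT \<omega>|M. erz k \<omega>)"
    using weight_y_bounds weight_z_bounds by (auto simp: ery_def erz_def intro!: mult_nonneg_nonneg integral_nonneg_AE)
  have "(\<Sum>i<k. LINT \<omega>|M. grad_sq i \<omega>) / (4 * L_outer p)
      \<le> o0 + weight_y p * e0 + weight_z p * w0 + real k * drift_noise"
    using tel[of k] inf_le[of k] ek by (simp add: o0_def e0_def w0_def)
  also have "\<dots> \<le> 2 * (o0 + e0 + z0) + lam p * noise_y + real k * drift_noise"
    using bw ae nn by simp
  finally have "(\<Sum>i<k. LINT \<omega>|M. grad_sq i \<omega>)
      \<le> (2 * (o0 + e0 + z0) + lam p * noise_y + real k * drift_noise) * (4 * L_outer p)"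
    using L_outer_pos by (simp add: pos_divide_le_eq)
  then show "(\<Sum>i<k. LINT \<omega>|M. grad_sq i \<omega>) \<le> 8 * L_outer p * initial_gap M f g fh gh p bs \<xi> init
       + 4 * L_outer p * lam p * noise_y + 4 * L_outer p * (real k * drift_noise)"
    unfolding gap by (simp add: algebra_simps)
qed

end

section \<open>The constants\<close>

lemma power_mult_mono:
  fixes m \<kappa> :: real
  assumes "1 \<le> m" "1 \<le> \<kappa>" "i \<le> j" "k \<le> l"
  shows "m ^ i * \<kappa> ^ k \<le> m ^ j * \<kappa> ^ l"
  using assms by (intro mult_mono power_increasing) auto

lemma nat_floor_plus_one_le: "x \<le> y \<Longrightarrow> 0 \<le> y \<Longrightarrow> real (nat \<lfloor>x\<rfloor> + 1) \<le> y + 1"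
  by linarith

text \<open>Only the dependence on \<open>\<kappa>\<close> has to be logarithmic, so the constant
  part is bounded crudely by \<open>ln q \<le> q - 1\<close>; the lower bound on \<open>q\<close>
  makes \<open>14 \<le> 3 * q\<close>.\<close>

lemma ln_le_of_power_bound:
  fixes W q \<kappa> :: real
  assumes "0 < W" "W \<le> q * \<kappa> ^ 7" "15 \<le> q" "1 \<le> \<kappa>"
  shows "1 + 2 * ln W \<le> 3 * q * (1 + ln \<kappa>)"
proof -
  have l: "0 \<le> ln \<kappa>" using assms by simp
  have "ln W \<le> ln (q * \<kappa> ^ 7)" using assms by (intro ln_mono) auto
  also have "\<dots> = ln q + 7 * ln \<kappa>" using assms by (simp add: ln_mult ln_realpow)
  also have "ln q \<le> q - 1" using assms by (intro ln_le_minus_one) auto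
  finally have "1 + 2 * ln W \<le> 2 * q + 14 * ln \<kappa>" by simp
  also have "14 * ln \<kappa> \<le> 3 * q * ln \<kappa>" using assms l by (intro mult_right_mono) auto
  also have "2 * q + 3 * q * ln \<kappa> \<le> 3 * q * (1 + ln \<kappa>)" using assms by (simp add: distrib_left)
  finally show ?thesis by simp
qed

lemma neg_ln_le_of_power_bound:
  fixes W q \<kappa> :: real
  assumes "0 < W" "1 / W \<le> q * \<kappa> ^ 7" "15 \<le> q" "1 \<le> \<kappa>"
  shows "- 2 * ln W \<le> 3 * q * (1 + ln \<kappa>)"
  using ln_le_of_power_bound[of "1 / W" q \<kappa>] assms by (simp add: ln_div)

text \<open>The lower half of \<open>Theta_size\<close>, in the form in which batch variances occur.
  It covers \<open>s = 0\<close>, since a batch is never empty.\<close>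

lemma Theta_size_ratio:
  assumes "Theta_size c c' (q * s) b" "0 < c" "0 < q"
  shows "s / real b \<le> 1 / (c * q)"
proof -
  have "c * (q * s) \<le> real b" "0 < real b" using assms by (auto simp: Theta_size_def)
  then show ?thesis using assms(2,3) by (simp add: divide_simps mult_ac)
qed

lemma Theta_size_upper:
  assumes "Theta_size c c' r b" "0 \<le> c'" "0 \<le> r"
  shows "real b \<le> 1 + c' * r"
  using assms mult_nonneg_nonneg[OF assms(2,3)] by (auto simp: Theta_size_def max_def split: if_splits)

text \<open>The problem, the accuracy and the batch sizes are fixed, but no run: the assumptions of
  \<open>amigo_process\<close> are derived here and must be available before a run is
  considered.\<close>

locale amigo_rates = stochastic_bilevel f g fh gh P p
  for f g :: "real^'x \<Rightarrow> real^'y \<Rightarrow> real"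
    and fh gh :: "real^'x \<Rightarrow> real^'y \<Rightarrow> 's \<Rightarrow> real"
    and P :: "'s measure" and p :: bilevel_consts +
  fixes S c c' \<epsilon> :: real and bs :: batch_sizes
  assumes S: "(sd_gxy p)\<^sup>2 \<le> S" and eps: "0 < \<epsilon>"
    and c: "Theta_const p S \<le> c" "c \<le> c'"
    and sizes: "Theta_sizes c c' p \<epsilon> bs"
begin

abbreviation "m \<equiv> magnitude p S"
abbreviation "\<kappa> \<equiv> kappa_g p"

lemma S_nonneg: "0 \<le> S"
  using S zero_le_power2 order_trans by blast

section \<open>Bounds by powers of \<open>m\<close> and \<open>\<kappa>\<close>\<close>

lemma m_bounds:
  "1 \<le> m" "Lf p \<le> m" "Bf p \<le> m" "Lg p \<le> m" "1 / Lg p \<le> m" "Lg' p \<le> m" "1 / Lg' p \<le> m"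
  "Mg p \<le> m" "1 / (Lf p + Mg p * Bf p) \<le> m" "S \<le> m"
proof -
  have nn: "0 \<le> Lf p" "0 \<le> Bf p" "0 \<le> Lg p" "0 \<le> 1 / Lg p" "0 \<le> Lg' p" "0 \<le> 1 / Lg' p" "0 \<le> Mg p"
    "0 \<le> 1 / (Lf p + Mg p * Bf p)" "0 \<le> S"
    using consts_nonneg consts_pos Lg_pos S_nonneg by (simp_all del: zero_le_divide_iff add: zero_le_divide_1_iff less_imp_le)
  show "1 \<le> m" "Lf p \<le> m" "Bf p \<le> m" "Lg p \<le> m" "1 / Lg p \<le> m" "Lg' p \<le> m" "1 / Lg' p \<le> m"
    "Mg p \<le> m" "1 / (Lf p + Mg p * Bf p) \<le> m" "S \<le> m"
    unfolding magnitude_def using nn by linarith+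
qed

lemma m_pos: "0 < m"
  using m_bounds(1) by linarith

lemma \<kappa>_pos: "0 < \<kappa>"
  using kappa_g_ge_1 by linarith

lemmas monomial_mono = power_mult_mono[OF m_bounds(1) kappa_g_ge_1]

lemma m_power_mono: "i \<le> j \<Longrightarrow> m ^ i \<le> m ^ j"
  using m_bounds(1) by (rule power_increasing[rotated])

text \<open>\<open>1 / mug p\<close> is the one parameter without a fixed bound; the powers of
  \<open>\<kappa>\<close> in the estimates of the smoothness constants stem from here.\<close>

lemma inv_mug: "1 / mug p \<le> m * \<kappa>"
proof -
  have "1 / mug p = 1 / Lg p * \<kappa>" using Lg_pos by (simp add: kappa_g_def)
  also have "\<dots> \<le> m * \<kappa>" using \<kappa>_pos by (intro mult_right_mono m_bounds) auto
  finally show ?thesis .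
qed

lemma mug_le: "mug p \<le> m"
  using ssc.m_le_L m_bounds(4) by linarith

lemma lam_le: "lam p \<le> 2 * m ^ 3 * \<kappa>"
proof -
  have "Mg p * Bf p * (1 / mug p) \<le> m * m * (m * \<kappa>)"
    using consts_nonneg consts_pos m_pos by (intro mult_mono m_bounds inv_mug) auto
  then have "lam p \<le> m + m ^ 3 * \<kappa>"
    using m_bounds(2) by (simp add: lam_def power3_eq_cube mult_ac)
  moreover have "m ^ 1 * \<kappa> ^ 0 \<le> m ^ 3 * \<kappa> ^ 1" by (rule monomial_mono) auto
  ultimately show ?thesis by simp
qed

lemma L_y_le: "L_y p \<le> m\<^sup>2 * \<kappa>"
proof -
  have "Lg' p * (1 / mug p) \<le> m * (m * \<kappa>)"
    using consts_pos m_pos by (intro mult_mono m_bounds inv_mug) auto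
  then show ?thesis by (simp add: L_y_def power2_eq_square mult_ac)
qed

lemma one_plus_L_y_le: "1 + L_y p \<le> 2 * m\<^sup>2 * \<kappa>"
proof -
  have "m ^ 0 * \<kappa> ^ 0 \<le> m ^ 2 * \<kappa> ^ 1" by (rule monomial_mono) auto
  then show ?thesis using L_y_le by simp
qed

lemma L_outer_le: "L_outer p \<le> 8 * m ^ 7 * \<kappa> ^ 3"
proof -
  have "lam p * (1 + L_y p)\<^sup>2 \<le> (2 * m ^ 3 * \<kappa>) * (2 * m\<^sup>2 * \<kappa>)\<^sup>2"
    using lam_pos L_y_pos m_pos \<kappa>_pos
    by (intro mult_mono power_mono lam_le one_plus_L_y_le) auto
  also have "\<dots> = 8 * m ^ 7 * \<kappa> ^ 3" by (simp add: eval_nat_numeral)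
  finally show ?thesis using consts_pos by (simp add: L_outer_eq)
qed

lemma L_psi_le: "L_psi p \<le> 4 * m ^ 5 * \<kappa>\<^sup>2"
proof -
  have "lam p * (1 + L_y p) \<le> (2 * m ^ 3 * \<kappa>) * (2 * m\<^sup>2 * \<kappa>)"
    using lam_pos L_y_pos m_pos \<kappa>_pos by (intro mult_mono lam_le one_plus_L_y_le) auto
  also have "\<dots> = 4 * m ^ 5 * \<kappa>\<^sup>2" by (simp add: eval_nat_numeral)
  finally have 1: "lam p * (1 + L_y p) \<le> 4 * m ^ 5 * \<kappa>\<^sup>2" .
  have "m ^ 1 * \<kappa> ^ 0 \<le> m ^ 5 * \<kappa> ^ 2" by (rule monomial_mono) auto
  then have "Lg' p \<le> 4 * m ^ 5 * \<kappa>\<^sup>2" using m_bounds(6) m_pos by simp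
  with 1 show ?thesis using consts_pos by (simp add: L_psi_eq)
qed

lemma L_psi_sq_le: "(L_psi p)\<^sup>2 \<le> 16 * m ^ 10 * \<kappa> ^ 4"
proof -
  have "(L_psi p)\<^sup>2 \<le> (4 * m ^ 5 * \<kappa>\<^sup>2)\<^sup>2" using L_psi_pos by (intro power_mono L_psi_le) simp
  then show ?thesis by (simp add: power_mult_distrib flip: power_mult)
qed

lemma L_z_sq_le: "(L_z p)\<^sup>2 \<le> 4 * m ^ 8 * \<kappa> ^ 4"
proof -
  have "L_z p = lam p * (1 / mug p)" using consts_pos by (simp add: L_z_eq)
  also have "\<dots> \<le> (2 * m ^ 3 * \<kappa>) * (m * \<kappa>)"
    using lam_pos consts_pos m_pos \<kappa>_pos by (intro mult_mono lam_le inv_mug) auto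
  also have "\<dots> = 2 * m ^ 4 * \<kappa>\<^sup>2" by (simp add: eval_nat_numeral)
  finally have "(L_z p)\<^sup>2 \<le> (2 * m ^ 4 * \<kappa>\<^sup>2)\<^sup>2" using L_z_pos by (intro power_mono) auto
  then show ?thesis by (simp add: power_mult_distrib flip: power_mult)
qed

text \<open>\<open>mug p \<le> m\<close> keeps \<open>Mg p * Bf p / mug p\<close> from degenerating,
  so \<open>lam p\<close> is at least \<open>(Lf p + Mg p * Bf p) / m\<close>. Reciprocals matter
  because the arguments of the logarithms are quotients.\<close>

lemma inv_lam: "1 / lam p \<le> m\<^sup>2"
proof -
  have "1 / m \<le> 1 / mug p" using mug_le consts_pos by (intro frac_le) auto
  then have "Mg p * Bf p * (1 / m) \<le> Mg p * Bf p * (1 / mug p)"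
    using consts_nonneg by (intro mult_left_mono) auto
  moreover have "Lf p * (1 / m) \<le> Lf p * 1" using consts_nonneg m_bounds(1) m_pos by (intro mult_left_mono) auto
  ultimately have le: "(Lf p + Mg p * Bf p) * (1 / m) \<le> lam p" by (simp add: lam_def add_divide_distrib)
  have pos: "0 < (Lf p + Mg p * Bf p) * (1 / m)" using consts_pos m_pos by simp
  have "1 / lam p \<le> 1 / ((Lf p + Mg p * Bf p) * (1 / m))" using le pos by (intro frac_le) auto
  also have "\<dots> = 1 / (Lf p + Mg p * Bf p) * m" by simp
  also have "\<dots> \<le> m * m" using m_pos by (intro mult_right_mono m_bounds) auto
  finally show ?thesis by (simp add: power2_eq_square)
qed

lemma inv_L_outer: "1 / L_outer p \<le> m\<^sup>2"
proof -
  have "lam p * 1 \<le> lam p * (1 + L_y p)\<^sup>2"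
    using lam_pos L_y_pos by (intro mult_left_mono) auto
  then have "1 / L_outer p \<le> 1 / lam p"
    using lam_pos consts_pos by (intro frac_le) (auto simp: L_outer_eq)
  then show ?thesis using inv_lam by linarith
qed

lemma inv_Lg'_sq: "1 / (Lg' p)\<^sup>2 \<le> m\<^sup>2"
proof -
  have "(1 / Lg' p)\<^sup>2 \<le> m\<^sup>2" using consts_pos by (intro power_mono m_bounds) auto
  then show ?thesis by (simp add: power_divide)
qed

lemma inv_L_psi_sq: "1 / (L_psi p)\<^sup>2 \<le> m\<^sup>2"
proof -
  have "(Lg' p)\<^sup>2 \<le> (L_psi p)\<^sup>2" using consts_pos by (intro power_mono) (auto simp: L_psi_eq)
  then have "1 / (L_psi p)\<^sup>2 \<le> 1 / (Lg' p)\<^sup>2" using consts_pos by (intro frac_le) auto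
  then show ?thesis using inv_Lg'_sq by linarith
qed

lemma inv_L_y_sq: "1 / (L_y p)\<^sup>2 \<le> m ^ 4"
proof -
  have "1 / L_y p = mug p * (1 / Lg' p)" using consts_pos by (simp add: L_y_def)
  also have "\<dots> \<le> m * m" using consts_pos m_pos by (intro mult_mono mug_le m_bounds) auto
  finally have "(1 / L_y p)\<^sup>2 \<le> (m * m)\<^sup>2" using L_y_pos by (intro power_mono) auto
  then show ?thesis by (simp add: power_divide eval_nat_numeral)
qed

lemma L_y_sq_le: "(L_y p)\<^sup>2 \<le> m ^ 4 * \<kappa>\<^sup>2"
proof -
  have "(L_y p)\<^sup>2 \<le> (m\<^sup>2 * \<kappa>)\<^sup>2" using L_y_pos by (intro power_mono L_y_le) auto
  then show ?thesis by (simp add: power_mult_distrib flip: power_mult)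
qed

lemma c_large: "10^10 * m ^ 40 \<le> c" "0 < c" "0 < c'"
proof -
  show 1: "10^10 * m ^ 40 \<le> c" using c(1) by (simp add: Theta_const_def)
  have "0 < 10^10 * m ^ 40" using m_pos by simp
  then show "0 < c" "0 < c'" using 1 c(2) by linarith+
qed

lemma size_pos: "1 \<le> size_g bs" "1 \<le> size_f bs" "1 \<le> size_gyy bs" "1 \<le> size_gxy bs"
  using sizes by (auto simp: Theta_sizes_def Theta_size_def)

lemma var_nonneg: "0 \<le> var_gxy p bs" "0 \<le> var_gyy p bs" "0 \<le> var_f p bs" "0 \<le> var_g p bs"
  by (simp_all add: var_gxy_def var_gyy_def var_f_def var_g_def)

text \<open>Each variance is paired with the power of \<open>\<kappa>\<close> that it has to cancel
  in \<open>total_noise_le\<close>. The maximum in the size of the Hessian batch is used twice: its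
  first entry gives a bound proportional to \<open>\<epsilon>\<close>, its second a bound free of
  \<open>\<epsilon>\<close>.\<close>

lemma var_bounds:
  "\<kappa>\<^sup>2 * var_gxy p bs \<le> \<epsilon> / c" "\<kappa>\<^sup>2 * var_f p bs \<le> \<epsilon> / c" "\<kappa> ^ 5 * var_g p bs \<le> \<epsilon> / c"
  "\<kappa> ^ 3 * var_gyy p bs \<le> \<epsilon> / c" "var_gyy p bs \<le> 1 / (c * (\<kappa> ^ 3 * (mug p)\<^sup>2))" "var_gxy p bs \<le> m"
proof -
  have pos: "0 < \<kappa>\<^sup>2 / \<epsilon>" "0 < \<kappa> ^ 5 / \<epsilon>" "0 < \<kappa> ^ 3 / \<epsilon> * max 1 (\<epsilon> * (mug p)\<^sup>2)"
    using \<kappa>_pos eps by (simp_all add: less_max_iff_disj)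
  have "Theta_size c c' (\<kappa>\<^sup>2 / \<epsilon> * (sd_gxy p)\<^sup>2) (size_gxy bs)"
    using sizes by (simp add: Theta_sizes_def)
  from Theta_size_ratio[OF this c_large(2) pos(1)]
  show "\<kappa>\<^sup>2 * var_gxy p bs \<le> \<epsilon> / c" using \<kappa>_pos eps c_large by (simp add: var_gxy_def field_simps)
  have "Theta_size c c' (\<kappa>\<^sup>2 / \<epsilon> * (sd_f p)\<^sup>2) (size_f bs)"
    using sizes by (simp add: Theta_sizes_def)
  from Theta_size_ratio[OF this c_large(2) pos(1)]
  show "\<kappa>\<^sup>2 * var_f p bs \<le> \<epsilon> / c" using \<kappa>_pos eps c_large by (simp add: var_f_def field_simps)
  have "Theta_size c c' (\<kappa> ^ 5 / \<epsilon> * (sd_g p)\<^sup>2) (size_g bs)"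
    using sizes by (simp add: Theta_sizes_def)
  from Theta_size_ratio[OF this c_large(2) pos(2)]
  show "\<kappa> ^ 5 * var_g p bs \<le> \<epsilon> / c" using \<kappa>_pos eps c_large by (simp add: var_g_def field_simps)
  have "Theta_size c c' (\<kappa> ^ 3 / \<epsilon> * max 1 (\<epsilon> * (mug p)\<^sup>2) * (sd_gyy p)\<^sup>2) (size_gyy bs)"
    using sizes by (simp add: Theta_sizes_def mult_ac)
  from Theta_size_ratio[OF this c_large(2) pos(3)]
  have yy: "var_gyy p bs \<le> 1 / (c * (\<kappa> ^ 3 / \<epsilon> * max 1 (\<epsilon> * (mug p)\<^sup>2)))" by (simp add: var_gyy_def)
  have "var_gyy p bs \<le> 1 / (c * (\<kappa> ^ 3 / \<epsilon> * 1))"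
    by (rule order_trans[OF yy]) (intro frac_le mult_left_mono; use \<kappa>_pos eps c_large in simp)
  then show "\<kappa> ^ 3 * var_gyy p bs \<le> \<epsilon> / c" using \<kappa>_pos eps c_large by (simp add: field_simps)
  have "var_gyy p bs \<le> 1 / (c * (\<kappa> ^ 3 / \<epsilon> * (\<epsilon> * (mug p)\<^sup>2)))"
    by (rule order_trans[OF yy]) (intro frac_le mult_left_mono; use \<kappa>_pos eps c_large consts_pos in simp)
  then show "var_gyy p bs \<le> 1 / (c * (\<kappa> ^ 3 * (mug p)\<^sup>2))" using eps by simp
  have "(sd_gxy p)\<^sup>2 / real (size_gxy bs) \<le> (sd_gxy p)\<^sup>2 / 1" using size_pos(4) by (intro divide_left_mono) auto
  then show "var_gxy p bs \<le> m" using S m_bounds(10) by (simp add: var_gxy_def)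
qed

text \<open>The loop for \<open>z\<close> has to contract for large \<open>\<epsilon>\<close> too,
  hence the bound free of \<open>\<epsilon>\<close>. As \<open>mug p * \<kappa> = Lg p\<close>, the
  claim comes down to \<open>2 \<le> c * Lg p ^ 4\<close>.\<close>

lemma var_gyy_small: "var_gyy p bs \<le> mug p * Lg p / 2"
proof -
  have mk: "mug p * \<kappa> = Lg p" using consts_pos by (simp add: kappa_g_def)
  have "2 * m ^ 4 \<le> 10^10 * m ^ 40" using m_power_mono[of 4 40] m_pos by (intro mult_mono) auto
  then have c2: "2 * m ^ 4 \<le> c" using c_large(1) by linarith
  have "(1 / Lg p) ^ 4 \<le> m ^ 4" using Lg_pos by (intro power_mono m_bounds) auto
  then have "1 \<le> m ^ 4 * Lg p ^ 4" using Lg_pos by (simp add: power_divide divide_le_eq)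
  then have "2 * 1 \<le> 2 * (m ^ 4 * Lg p ^ 4)" by simp
  also have "\<dots> = (2 * m ^ 4) * Lg p ^ 4" by simp
  also have "\<dots> \<le> c * Lg p ^ 4" using c2 Lg_pos by (intro mult_right_mono) auto
  also have "\<dots> = c * (\<kappa> ^ 3 * (mug p)\<^sup>2) * (mug p * Lg p)"
    unfolding mk[symmetric] by (simp add: power_mult_distrib eval_nat_numeral mult_ac)
  finally have "1 / (c * (\<kappa> ^ 3 * (mug p)\<^sup>2)) \<le> mug p * Lg p / 2"
    using c_large \<kappa>_pos consts_pos by (simp add: divide_simps mult_ac)
  then show ?thesis using var_bounds(5) by linarith
qed

text \<open>The exponents 17 of \<open>m\<close> and 7 of \<open>\<kappa>\<close> are those of the
  bound for \<open>(L_z p)\<^sup>2 * L_outer p / (L_psi p)\<^sup>2\<close> in \<open>C3'\<close>;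
  the factor 1000 covers the numerical coefficients of all arguments.\<close>

definition q_log :: real where "q_log = 1000 * m ^ 17"

lemma q_log_ge: "15 \<le> q_log"
  using m_power_mono[of 0 17] by (simp add: q_log_def)

lemma power_le_q: "i \<le> 17 \<Longrightarrow> j \<le> 7 \<Longrightarrow> m ^ i * \<kappa> ^ j \<le> m ^ 17 * \<kappa> ^ 7"
  by (rule monomial_mono)

text \<open>Every logarithm in the choice of \<open>T\<close> and \<open>N\<close> is at most \<open>ln q_log + 7 * ln \<kappa>\<close>.\<close>

lemma log_arguments:
  "6 + 24 * (L_psi p)\<^sup>2 / eta0 p \<le> q_log * \<kappa> ^ 7"
  "1 + 4 * (L_y p)\<^sup>2 / (L_outer p)\<^sup>2 * max (eta0 p) (8 * zeta0 p) \<le> q_log * \<kappa> ^ 7"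
  "1 / (5 * (L_psi p)\<^sup>2 / eta0 p) \<le> q_log * \<kappa> ^ 7"
  "1 / (L_outer p / (4 * (L_y p)\<^sup>2)) \<le> q_log * \<kappa> ^ 7"
  "4 + 12 / eta0 p * (2 * (L_psi p)\<^sup>2 + var_x p bs) \<le> q_log * \<kappa> ^ 7"
  "1 + 2 * (L_z p)\<^sup>2 / (L_y p)\<^sup>2 * (1 + 16 * (L_y p)\<^sup>2) \<le> q_log * \<kappa> ^ 7"
  "1 / ((L_psi p)\<^sup>2 / (4 * (L_z p)\<^sup>2 * eta0 p)) \<le> q_log * \<kappa> ^ 7"
  "1 / (step_gamma p * (var_gxy p bs + (Lg' p)\<^sup>2)) \<le> q_log * \<kappa> ^ 7"
proof -
  let ?u = "m ^ 17 * \<kappa> ^ 7"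
  have u1: "1 \<le> ?u" using power_le_q[of 0 0] by simp
  have q: "q_log * \<kappa> ^ 7 = 1000 * ?u" by (simp add: q_log_def)
  have iL: "0 \<le> 1 / L_outer p" using L_outer_pos by simp
  have a1: "(L_psi p)\<^sup>2 * (1 / L_outer p) \<le> 16 * ?u"
  proof -
    have "(L_psi p)\<^sup>2 * (1 / L_outer p) \<le> (16 * m ^ 10 * \<kappa> ^ 4) * m\<^sup>2"
      using iL m_pos \<kappa>_pos by (intro mult_mono L_psi_sq_le inv_L_outer) auto
    also have "\<dots> = 16 * (m ^ 12 * \<kappa> ^ 4)" by (simp add: eval_nat_numeral)
    also have "\<dots> \<le> 16 * ?u" by (intro mult_left_mono power_le_q) auto
    finally show ?thesis .
  qed
  then show "6 + 24 * (L_psi p)\<^sup>2 / eta0 p \<le> q_log * \<kappa> ^ 7" using u1 unfolding q eta0_def by simp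
  have a2: "(L_y p)\<^sup>2 * (1 / L_outer p) \<le> ?u"
  proof -
    have "(L_y p)\<^sup>2 * (1 / L_outer p) \<le> (m ^ 4 * \<kappa>\<^sup>2) * m\<^sup>2"
      using iL m_pos \<kappa>_pos by (intro mult_mono L_y_sq_le inv_L_outer) auto
    also have "\<dots> = m ^ 6 * \<kappa> ^ 2" by (simp add: eval_nat_numeral)
    also have "\<dots> \<le> ?u" by (intro power_le_q) auto
    finally show ?thesis .
  qed
  have "4 * (L_y p)\<^sup>2 / (L_outer p)\<^sup>2 * max (L_outer p) (8 * (2 * L_outer p)) = 64 * ((L_y p)\<^sup>2 * (1 / L_outer p))"
    using L_outer_pos by (simp add: max_def power2_eq_square)
  then show "1 + 4 * (L_y p)\<^sup>2 / (L_outer p)\<^sup>2 * max (eta0 p) (8 * zeta0 p) \<le> q_log * \<kappa> ^ 7"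
    unfolding q eta0_def zeta0_def using a2 u1 by linarith
  have "L_outer p * (1 / (L_psi p)\<^sup>2) \<le> (8 * m ^ 7 * \<kappa> ^ 3) * m\<^sup>2"
    using m_pos \<kappa>_pos by (intro mult_mono L_outer_le inv_L_psi_sq) auto
  also have "\<dots> = 8 * (m ^ 9 * \<kappa> ^ 3)" by (simp add: eval_nat_numeral)
  also have "\<dots> \<le> 8 * ?u" by (intro mult_left_mono power_le_q) auto
  finally have a3: "L_outer p * (1 / (L_psi p)\<^sup>2) \<le> 8 * ?u" .
  have "1 / (5 * (L_psi p)\<^sup>2 / eta0 p) = 1 / 5 * (L_outer p * (1 / (L_psi p)\<^sup>2))" by (simp add: eta0_def)
  then show "1 / (5 * (L_psi p)\<^sup>2 / eta0 p) \<le> q_log * \<kappa> ^ 7" unfolding q using a3 u1 by linarith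
  have "1 / (L_outer p / (4 * (L_y p)\<^sup>2)) = 4 * ((L_y p)\<^sup>2 * (1 / L_outer p))" by simp
  then show "1 / (L_outer p / (4 * (L_y p)\<^sup>2)) \<le> q_log * \<kappa> ^ 7" unfolding q using a2 u1 by linarith
  have vx: "var_x p bs \<le> 3 * (m ^ 6 * \<kappa>\<^sup>2)"
  proof -
    have "mug p * Lg p \<le> m * m" using consts_pos Lg_pos m_pos by (intro mult_mono mug_le m_bounds) auto
    then have v: "var_gyy p bs \<le> m\<^sup>2 / 2" using var_gyy_small by (simp add: power2_eq_square)
    have "(L_y p)\<^sup>2 * var_gyy p bs \<le> (m ^ 4 * \<kappa>\<^sup>2) * (m\<^sup>2 / 2)"
      using var_nonneg m_pos \<kappa>_pos by (intro mult_mono L_y_sq_le v) auto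
    also have "\<dots> = m ^ 6 * \<kappa>\<^sup>2 / 2" by (simp add: eval_nat_numeral)
    finally have "2 * ((L_y p)\<^sup>2 * var_gyy p bs) \<le> m ^ 6 * \<kappa>\<^sup>2" by simp
    moreover have "m ^ 1 * \<kappa> ^ 0 \<le> m ^ 6 * \<kappa> ^ 2" by (rule monomial_mono) auto
    then have "2 * var_gxy p bs \<le> 2 * (m ^ 6 * \<kappa>\<^sup>2)" using var_bounds(6) by simp
    moreover have "var_x p bs = 2 * var_gxy p bs + 2 * ((L_y p)\<^sup>2 * var_gyy p bs)"
      by (simp add: var_x_def L_y_def power_divide)
    ultimately show ?thesis by simp
  qed
  have "1 / L_outer p * var_x p bs \<le> m\<^sup>2 * (3 * (m ^ 6 * \<kappa>\<^sup>2))"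
    using iL m_pos \<kappa>_pos var_nonneg by (intro mult_mono inv_L_outer vx) (auto simp: var_x_def)
  also have "\<dots> = 3 * (m ^ 8 * \<kappa> ^ 2)" by (simp add: eval_nat_numeral)
  also have "\<dots> \<le> 3 * ?u" by (intro mult_left_mono power_le_q) auto
  finally have a5: "1 / L_outer p * var_x p bs \<le> 3 * ?u" .
  have "12 / eta0 p * (2 * (L_psi p)\<^sup>2 + var_x p bs)
      = 24 * ((L_psi p)\<^sup>2 * (1 / L_outer p)) + 12 * (1 / L_outer p * var_x p bs)"
    by (simp add: eta0_def algebra_simps add_divide_distrib)
  then show "4 + 12 / eta0 p * (2 * (L_psi p)\<^sup>2 + var_x p bs) \<le> q_log * \<kappa> ^ 7"
    unfolding q using a1 a5 u1 by linarith
  have "(L_z p)\<^sup>2 * (1 / (L_y p)\<^sup>2) \<le> (4 * m ^ 8 * \<kappa> ^ 4) * m ^ 4"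
    using m_pos \<kappa>_pos by (intro mult_mono L_z_sq_le inv_L_y_sq) auto
  also have "\<dots> = 4 * (m ^ 12 * \<kappa> ^ 4)" by (simp add: eval_nat_numeral)
  also have "\<dots> \<le> 4 * ?u" by (intro mult_left_mono power_le_q) auto
  finally have a6: "(L_z p)\<^sup>2 * (1 / (L_y p)\<^sup>2) \<le> 4 * ?u" .
  have "m ^ 8 * \<kappa> ^ 4 \<le> ?u" by (intro power_le_q) auto
  then have a7: "(L_z p)\<^sup>2 \<le> 4 * ?u" using L_z_sq_le by simp
  have "2 * (L_z p)\<^sup>2 / (L_y p)\<^sup>2 * (1 + 16 * (L_y p)\<^sup>2) = 2 * ((L_z p)\<^sup>2 * (1 / (L_y p)\<^sup>2)) + 32 * (L_z p)\<^sup>2"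
    using L_y_pos by (simp add: field_simps)
  then show "1 + 2 * (L_z p)\<^sup>2 / (L_y p)\<^sup>2 * (1 + 16 * (L_y p)\<^sup>2) \<le> q_log * \<kappa> ^ 7"
    unfolding q using a6 a7 u1 by linarith
  have "(L_z p)\<^sup>2 * (L_outer p * (1 / (L_psi p)\<^sup>2)) \<le> (4 * m ^ 8 * \<kappa> ^ 4) * ((8 * m ^ 7 * \<kappa> ^ 3) * m\<^sup>2)"
    using m_pos \<kappa>_pos L_outer_pos by (intro mult_mono L_outer_le inv_L_psi_sq L_z_sq_le) auto
  also have "\<dots> = 32 * ?u" by (simp add: eval_nat_numeral)
  finally have a8: "(L_z p)\<^sup>2 * (L_outer p * (1 / (L_psi p)\<^sup>2)) \<le> 32 * ?u" .
  have "1 / ((L_psi p)\<^sup>2 / (4 * (L_z p)\<^sup>2 * eta0 p)) = 4 * ((L_z p)\<^sup>2 * (L_outer p * (1 / (L_psi p)\<^sup>2)))"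
    by (simp add: eta0_def)
  then show "1 / ((L_psi p)\<^sup>2 / (4 * (L_z p)\<^sup>2 * eta0 p)) \<le> q_log * \<kappa> ^ 7"
    unfolding q using a8 u1 by linarith
  have "1 / (var_gxy p bs + (Lg' p)\<^sup>2) \<le> 1 / (Lg' p)\<^sup>2" using var_nonneg consts_pos by (intro frac_le) auto
  then have i: "1 / (var_gxy p bs + (Lg' p)\<^sup>2) \<le> m\<^sup>2" using inv_Lg'_sq by linarith
  have "L_outer p * (1 / (var_gxy p bs + (Lg' p)\<^sup>2)) \<le> (8 * m ^ 7 * \<kappa> ^ 3) * m\<^sup>2"
    using m_pos \<kappa>_pos var_nonneg by (intro mult_mono L_outer_le i) auto
  also have "\<dots> = 8 * (m ^ 9 * \<kappa> ^ 3)" by (simp add: eval_nat_numeral)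
  also have "\<dots> \<le> 8 * ?u" by (intro mult_left_mono power_le_q) auto
  finally have a9: "L_outer p * (1 / (var_gxy p bs + (Lg' p)\<^sup>2)) \<le> 8 * ?u" .
  have "1 / (step_gamma p * (var_gxy p bs + (Lg' p)\<^sup>2)) = L_outer p * (1 / (var_gxy p bs + (Lg' p)\<^sup>2))"
    by (simp add: step_gamma_def)
  then show "1 / (step_gamma p * (var_gxy p bs + (Lg' p)\<^sup>2)) \<le> q_log * \<kappa> ^ 7"
    unfolding q using a9 u1 by linarith
qed

abbreviation log_factor :: real where "log_factor \<equiv> 1 + ln \<kappa>"

lemma log_factor_ge: "1 \<le> log_factor"
  using kappa_g_ge_1 by simp

lemma C_max_le: "C_max p \<le> 3 * q_log * log_factor" "C_max' p bs \<le> 3 * q_log * log_factor"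
proof -
  note up = ln_le_of_power_bound[OF _ _ q_log_ge kappa_g_ge_1]
    and dn = neg_ln_le_of_power_bound[OF _ _ q_log_ge kappa_g_ge_1]
  have nn: "0 \<le> 3 * q_log * log_factor" using q_log_ge log_factor_ge by simp
  have vx: "0 \<le> var_x p bs" using var_nonneg by (simp add: var_x_def)
  have "C1 p \<le> 3 * q_log * log_factor"
    unfolding C1_def
  proof (rule up[OF _ log_arguments(1)])
    have "0 \<le> 24 * (L_psi p)\<^sup>2 / eta0 p" using L_outer_pos by (simp add: eta0_def)
    then show "0 < 6 + 24 * (L_psi p)\<^sup>2 / eta0 p" by linarith
  qed
  moreover have "C2 p \<le> 3 * q_log * log_factor"
  proof -
    have "0 \<le> 4 * (L_y p)\<^sup>2 / (L_outer p)\<^sup>2 * max (eta0 p) (8 * zeta0 p)"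
      using L_outer_pos by (intro mult_nonneg_nonneg) (auto simp: eta0_def zeta0_def max_def)
    then have "0 < 1 + 4 * (L_y p)\<^sup>2 / (L_outer p)\<^sup>2 * max (eta0 p) (8 * zeta0 p)" by linarith
    from up[OF this log_arguments(2)] show ?thesis unfolding C2_def by linarith
  qed
  moreover have "- 2 * ln (5 * (L_psi p)\<^sup>2 / eta0 p) \<le> 3 * q_log * log_factor"
    by (rule dn[OF _ log_arguments(3)]) (use L_outer_pos L_psi_pos in \<open>simp add: eta0_def\<close>)
  moreover have "- 2 * ln (L_outer p / (4 * (L_y p)\<^sup>2)) \<le> 3 * q_log * log_factor"
    by (rule dn[OF _ log_arguments(4)]) (use L_outer_pos L_y_pos in simp)
  ultimately show "C_max p \<le> 3 * q_log * log_factor"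
    using nn unfolding C3_def by (intro max.boundedI)
  have "C1' p bs \<le> 3 * q_log * log_factor"
    unfolding C1'_def
  proof (rule up[OF _ log_arguments(5)])
    have "0 \<le> 12 / eta0 p * (2 * (L_psi p)\<^sup>2 + var_x p bs)"
      using L_outer_pos vx by (intro mult_nonneg_nonneg add_nonneg_nonneg) (auto simp: eta0_def)
    then show "0 < 4 + 12 / eta0 p * (2 * (L_psi p)\<^sup>2 + var_x p bs)" by linarith
  qed
  moreover have "C2' p \<le> 3 * q_log * log_factor"
  proof -
    have "0 \<le> 2 * (L_z p)\<^sup>2 / (L_y p)\<^sup>2 * (1 + 16 * (L_y p)\<^sup>2)" by (intro mult_nonneg_nonneg) auto
    then have "0 < 1 + 2 * (L_z p)\<^sup>2 / (L_y p)\<^sup>2 * (1 + 16 * (L_y p)\<^sup>2)" by linarith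
    from up[OF this log_arguments(6)] show ?thesis unfolding C2'_def by linarith
  qed
  moreover have "- 2 * ln ((L_psi p)\<^sup>2 / (4 * (L_z p)\<^sup>2 * eta0 p)) \<le> 3 * q_log * log_factor"
    by (rule dn[OF _ log_arguments(7)]) (use L_outer_pos L_z_pos L_psi_pos in \<open>simp add: eta0_def\<close>)
  moreover have "- 2 * ln (step_gamma p * (var_gxy p bs + (Lg' p)\<^sup>2)) \<le> 3 * q_log * log_factor"
  proof (rule dn[OF _ log_arguments(8)])
    show "0 < step_gamma p * (var_gxy p bs + (Lg' p)\<^sup>2)"
      unfolding step_gamma_def using L_outer_pos var_nonneg consts_pos
      by (intro mult_pos_pos add_nonneg_pos) auto
  qed
  ultimately show "C_max' p bs \<le> 3 * q_log * log_factor"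
    using nn unfolding C3'_def by (intro max.boundedI)
qed

text \<open>Each maximum is at most \<open>3 * q_log * log_factor\<close>. \<open>N_choice\<close>
  takes both maxima with a factor 4, half of it from \<open>step_beta\<close>, which makes 24;
  rounding adds 1.\<close>

lemma T_N_le:
  "real (T_choice p) \<le> 25 * q_log * log_factor * \<kappa>" "real (N_choice p bs) \<le> 25 * q_log * log_factor * \<kappa>"
proof -
  let ?l = "q_log * log_factor * \<kappa>"
  have "1 * 1 * 1 \<le> ?l" using q_log_ge log_factor_ge kappa_g_ge_1 by (intro mult_mono) auto
  then have l: "1 \<le> ?l" by simp
  have "1 / step_alpha p * (1 / mug p) * C_max p = \<kappa> * C_max p" by (simp add: step_alpha_def kappa_g_def)
  also have "\<dots> \<le> \<kappa> * (3 * q_log * log_factor)" using \<kappa>_pos by (intro mult_left_mono C_max_le) auto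
  also have "\<dots> = 3 * ?l" by simp
  finally have "real (T_choice p) \<le> 3 * ?l + 1"
    unfolding T_choice_def using l by (intro nat_floor_plus_one_le) auto
  then show "real (T_choice p) \<le> 25 * q_log * log_factor * \<kappa>" using l by simp
  have "2 * (1 / step_beta p) * (1 / mug p) * (C_max p + C_max' p bs) = 4 * (\<kappa> * (C_max p + C_max' p bs))"
    by (simp add: step_beta_def kappa_g_def)
  also have "\<dots> \<le> 4 * (\<kappa> * (3 * q_log * log_factor + 3 * q_log * log_factor))"
    using \<kappa>_pos by (intro mult_left_mono add_mono C_max_le) auto
  also have "\<dots> = 24 * ?l" by simp
  finally have "real (N_choice p bs) \<le> 24 * ?l + 1"
    unfolding N_choice_def using l by (intro nat_floor_plus_one_le) auto
  then show "real (N_choice p bs) \<le> 25 * q_log * log_factor * \<kappa>" using l by simp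
qed

text \<open>Each batch size is its order plus at most 1 for rounding, and up to the common factor
  these units cost \<open>4 * \<kappa>\<close>. By the hypothesis \<open>\<kappa>\<close> is itself
  dominated by the order of the noise.\<close>

lemma iteration_cost_le:
  assumes "1 \<le> c' * (\<kappa> / \<epsilon> * noise_level p \<epsilon>)"
  shows "real (T_choice p) * real (size_g bs) + real (N_choice p bs) * real (size_gyy bs)
      + real (size_gxy bs) + real (size_f bs) \<le> 125 * q_log * log_factor * (c' * (\<kappa>\<^sup>2 / \<epsilon> * noise_level p \<epsilon>))"
proof -
  let ?a = "25 * q_log * log_factor"
  let ?mx = "max 1 (\<epsilon> * (mug p)\<^sup>2)"
  have c'0: "0 \<le> c'" using c_large by simp
  have "1 * 1 \<le> q_log * log_factor" using q_log_ge log_factor_ge by (intro mult_mono) auto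
  then have a1: "1 \<le> ?a" by simp
  have mx0: "0 \<le> ?mx" by simp
  have nn: "0 \<le> \<kappa> ^ 5 * (sd_g p)\<^sup>2 / \<epsilon>" "0 \<le> \<kappa> ^ 3 / \<epsilon> * (sd_gyy p)\<^sup>2 * ?mx"
    "0 \<le> \<kappa>\<^sup>2 / \<epsilon> * (sd_gxy p)\<^sup>2" "0 \<le> \<kappa>\<^sup>2 * (sd_f p)\<^sup>2 / \<epsilon>"
    using \<kappa>_pos eps mx0 by (simp_all add: less_imp_le)
  have sz: "real (size_g bs) \<le> 1 + c' * (\<kappa> ^ 5 * (sd_g p)\<^sup>2 / \<epsilon>)"
    "real (size_gyy bs) \<le> 1 + c' * (\<kappa> ^ 3 / \<epsilon> * (sd_gyy p)\<^sup>2 * ?mx)"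
    "real (size_gxy bs) \<le> 1 + c' * (\<kappa>\<^sup>2 / \<epsilon> * (sd_gxy p)\<^sup>2)"
    "real (size_f bs) \<le> 1 + c' * (\<kappa>\<^sup>2 * (sd_f p)\<^sup>2 / \<epsilon>)"
    using sizes c'0 nn unfolding Theta_sizes_def by (blast intro: Theta_size_upper)+
  have "real (T_choice p) * real (size_g bs) \<le> (?a * \<kappa>) * (1 + c' * (\<kappa> ^ 5 * (sd_g p)\<^sup>2 / \<epsilon>))"
    using a1 \<kappa>_pos by (intro mult_mono T_N_le sz) auto
  moreover have "real (N_choice p bs) * real (size_gyy bs)
      \<le> (?a * \<kappa>) * (1 + c' * (\<kappa> ^ 3 / \<epsilon> * (sd_gyy p)\<^sup>2 * ?mx))"
    using a1 \<kappa>_pos by (intro mult_mono T_N_le sz) auto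
  moreover have one: "real n \<le> ?a * (\<kappa> + c' * r)" if "real n \<le> 1 + c' * r" "0 \<le> r" for n r
  proof -
    have "real n \<le> 1 * (\<kappa> + c' * r)" using that kappa_g_ge_1 by simp
    also have "\<dots> \<le> ?a * (\<kappa> + c' * r)" using a1 \<kappa>_pos c'0 that by (intro mult_right_mono) auto
    finally show ?thesis .
  qed
  moreover note one[OF sz(3) nn(3)] one[OF sz(4) nn(4)]
  ultimately have "real (T_choice p) * real (size_g bs) + real (N_choice p bs) * real (size_gyy bs)
      + real (size_gxy bs) + real (size_f bs)
    \<le> (?a * \<kappa>) * (1 + c' * (\<kappa> ^ 5 * (sd_g p)\<^sup>2 / \<epsilon>)) + (?a * \<kappa>) * (1 + c' * (\<kappa> ^ 3 / \<epsilon> * (sd_gyy p)\<^sup>2 * ?mx))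
      + ?a * (\<kappa> + c' * (\<kappa>\<^sup>2 / \<epsilon> * (sd_gxy p)\<^sup>2)) + ?a * (\<kappa> + c' * (\<kappa>\<^sup>2 * (sd_f p)\<^sup>2 / \<epsilon>))"
    by linarith
  also have "\<dots> = ?a * (4 * \<kappa> + c' * (\<kappa>\<^sup>2 / \<epsilon> * noise_level p \<epsilon>))"
    unfolding noise_level_def by (simp add: distrib_left add_divide_distrib eval_nat_numeral mult_ac)
  also have "\<dots> \<le> ?a * (4 * (c' * (\<kappa>\<^sup>2 / \<epsilon> * noise_level p \<epsilon>)) + c' * (\<kappa>\<^sup>2 / \<epsilon> * noise_level p \<epsilon>))"
  proof (intro mult_left_mono add_right_mono)
    have "\<kappa> * 1 \<le> \<kappa> * (c' * (\<kappa> / \<epsilon> * noise_level p \<epsilon>))" using assms \<kappa>_pos by (intro mult_left_mono) auto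
    then show "\<kappa> \<le> c' * (\<kappa>\<^sup>2 / \<epsilon> * noise_level p \<epsilon>)" by (simp add: power2_eq_square mult_ac)
  qed (use a1 in auto)
  also have "25 * a * b * (4 * x + x) = 125 * a * b * x" for a b x :: real by simp
  finally show ?thesis .
qed

end

section \<open>Total noise, number of iterations and complexity\<close>

locale amigo_converges = amigo_rates f g fh gh P p S c c' \<epsilon> bs + amigo_process f g fh gh P p M \<xi> init bs
  for f g :: "real^'x \<Rightarrow> real^'y \<Rightarrow> real"
    and fh gh :: "real^'x \<Rightarrow> real^'y \<Rightarrow> 's \<Rightarrow> real"
    and P :: "'s measure" and p :: bilevel_consts and S c c' \<epsilon> :: real and bs :: batch_sizes
    and M :: "'w measure" and \<xi> :: "sample_label \<Rightarrow> 'w \<Rightarrow> 's"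
    and init :: "'w \<Rightarrow> (real^'x) \<times> (real^'y) \<times> (real^'y)"
begin

text \<open>\<open>weight_z\<close> is at most a multiple of \<open>lam p / (L_z p)\<^sup>2\<close>;
  as \<open>L_z p = lam p / mug p\<close>, the factor \<open>lam p\<close> cancels against
  \<open>L_outer\<close>, and \<open>mug p * L_y p = Lg' p\<close> removes \<open>\<kappa>\<close>.
  Bounding the two factors separately would multiply \<open>var_f p bs / (mug p)\<^sup>2\<close> by
  a further \<open>\<kappa> ^ 3\<close>, which batches of order \<open>\<kappa>\<^sup>2\<close> do
  not offset.\<close>

lemma weight_z_L_outer: "weight_z p * L_outer p \<le> m\<^sup>2"
proof -
  have "weight_z p * L_outer p \<le> lam p / (48 * (L_z p)\<^sup>2) * L_outer p"
    using L_outer_pos by (intro mult_right_mono) (auto simp: weight_z_def)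
  also have "\<dots> = (mug p * (1 + L_y p))\<^sup>2 / 48"
    using lam_pos consts_pos by (simp add: L_z_eq L_outer_eq power2_eq_square field_simps)
  also have "mug p * (1 + L_y p) = mug p + Lg' p" using consts_pos by (simp add: L_y_def distrib_left)
  also have "(mug p + Lg' p)\<^sup>2 / 48 \<le> (m + m)\<^sup>2 / 48"
    using consts_pos by (intro divide_right_mono power_mono add_mono mug_le m_bounds) auto
  also have "\<dots> \<le> m\<^sup>2" by (simp add: power2_eq_square)
  finally show ?thesis .
qed

text \<open>After multiplication by \<open>L_outer\<close> every summand is at most a number times
  \<open>m ^ 12 * \<epsilon> / c\<close>, with no power of \<open>\<kappa>\<close> left. The batch
  sizes are what the summands demand: \<open>\<kappa> ^ 5\<close> for \<open>g\<close> because of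
  \<open>(L_psi p)\<^sup>2 * noise_y\<close>, \<open>\<kappa> ^ 3\<close> for the Hessian because of
  \<open>noise_z\<close>, \<open>\<kappa>\<^sup>2\<close> for \<open>f\<close> and the Jacobian
  because of the factors \<open>1 / (mug p)\<^sup>2\<close>.\<close>

lemma total_noise_le: "4 * L_outer p * lam p * noise_y + 8 * (L_outer p * drift_noise) \<le> \<epsilon> / 2"
proof -
  define \<delta> where "\<delta> = \<epsilon> / c"
  define D where "D = m ^ 12 * \<delta>"
  have \<delta>: "0 \<le> \<delta>" using eps c_large by (simp add: \<delta>_def)
  have le_D: "m ^ i * \<delta> \<le> D" if "i \<le> 12" for i
    unfolding D_def using that \<delta> by (intro mult_right_mono m_power_mono) auto
  have D0: "\<delta> \<le> D" using le_D[of 0] by simp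
  have inv_mug2: "1 / (mug p)\<^sup>2 \<le> m\<^sup>2 * \<kappa>\<^sup>2"
  proof -
    have "(1 / mug p)\<^sup>2 \<le> (m * \<kappa>)\<^sup>2" using consts_pos by (intro power_mono inv_mug) auto
    then show ?thesis by (simp add: power_divide power_mult_distrib)
  qed
  have inv_Lm: "1 / (Lg p * mug p) \<le> m\<^sup>2 * \<kappa>"
  proof -
    have "1 / Lg p * (1 / mug p) \<le> m * (m * \<kappa>)" using Lg_pos consts_pos m_pos
      by (intro mult_mono inv_mug m_bounds) auto
    then show ?thesis by (simp add: power2_eq_square)
  qed
  have ny: "\<kappa> ^ 4 * noise_y \<le> m\<^sup>2 * \<delta>"
  proof -
    have "\<kappa> ^ 4 * noise_y = \<kappa> ^ 4 * var_g p bs * (1 / (Lg p * mug p))" by (simp add: noise_y_def)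
    also have "\<dots> \<le> \<kappa> ^ 4 * var_g p bs * (m\<^sup>2 * \<kappa>)"
      using var_nonneg \<kappa>_pos by (intro mult_left_mono inv_Lm) auto
    also have "\<dots> = m\<^sup>2 * (\<kappa> ^ 5 * var_g p bs)" by (simp add: eval_nat_numeral mult_ac)
    also have "\<dots> \<le> m\<^sup>2 * \<delta>" unfolding \<delta>_def by (intro mult_left_mono var_bounds) auto
    finally show ?thesis .
  qed
  have psi_ny: "(L_psi p)\<^sup>2 * noise_y \<le> 16 * D"
  proof -
    have "(L_psi p)\<^sup>2 * noise_y \<le> (16 * m ^ 10 * \<kappa> ^ 4) * noise_y"
      using noise_nonneg by (intro mult_right_mono L_psi_sq_le) auto
    also have "\<dots> = 16 * m ^ 10 * (\<kappa> ^ 4 * noise_y)" by simp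
    also have "\<dots> \<le> 16 * m ^ 10 * (m\<^sup>2 * \<delta>)" using m_pos by (intro mult_left_mono ny) auto
    also have "\<dots> = 16 * D" by (simp add: D_def eval_nat_numeral mult_ac)
    finally show ?thesis .
  qed
  have L_ny: "L_outer p * noise_y \<le> 8 * D"
  proof -
    have "L_outer p * noise_y \<le> (8 * m ^ 7 * \<kappa> ^ 3) * noise_y"
      using noise_nonneg by (intro mult_right_mono L_outer_le) auto
    also have "\<dots> \<le> (8 * m ^ 7 * \<kappa> ^ 4) * noise_y"
      using noise_nonneg m_pos kappa_g_ge_1 by (intro mult_right_mono mult_left_mono power_increasing) auto
    also have "\<dots> = 8 * m ^ 7 * (\<kappa> ^ 4 * noise_y)" by simp
    also have "\<dots> \<le> 8 * m ^ 7 * (m\<^sup>2 * \<delta>)" using m_pos by (intro mult_left_mono ny) auto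
    also have "\<dots> = 8 * (m ^ 9 * \<delta>)" by (simp add: eval_nat_numeral mult_ac)
    also have "\<dots> \<le> 8 * D" by (intro mult_left_mono le_D) auto
    finally show ?thesis .
  qed
  have wL: "weight_y p * L_outer p * noise_y \<le> 8 * D"
  proof -
    have "weight_y p * (L_outer p * noise_y) \<le> 1 * (L_outer p * noise_y)"
      using weight_y_bounds noise_nonneg L_outer_pos by (intro mult_right_mono) auto
    then show ?thesis using L_ny by (simp add: mult.assoc)
  qed
  have lamL: "L_outer p * lam p * noise_y \<le> 16 * D"
  proof -
    have "lam p * L_outer p * noise_y \<le> (L_psi p)\<^sup>2 * noise_y"
      using noise_nonneg by (intro mult_right_mono lam_L_outer_le)
    then show ?thesis using psi_ny by (simp add: mult.commute)
  qed
  have k2: "x \<le> \<kappa>\<^sup>2 * x" if "0 \<le> x" for x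
  proof -
    have "1 \<le> \<kappa>\<^sup>2" using kappa_g_ge_1 by simp
    from mult_right_mono[OF this that] show ?thesis by simp
  qed
  have sf: "var_f p bs \<le> D"
    using k2[OF var_nonneg(3)] var_bounds(2) D0 unfolding \<delta>_def by linarith
  have t: "var_f p bs / (mug p)\<^sup>2 \<le> m\<^sup>2 * \<delta>"
  proof -
    have "var_f p bs * (1 / (mug p)\<^sup>2) \<le> var_f p bs * (m\<^sup>2 * \<kappa>\<^sup>2)"
      using var_nonneg by (intro mult_left_mono inv_mug2)
    also have "\<dots> = m\<^sup>2 * (\<kappa>\<^sup>2 * var_f p bs)" by simp
    also have "\<dots> \<le> m\<^sup>2 * \<delta>" unfolding \<delta>_def by (intro mult_left_mono var_bounds) auto
    finally show ?thesis by simp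
  qed
  have B2: "(Bf p)\<^sup>2 \<le> m\<^sup>2" using consts_nonneg by (intro power_mono m_bounds)
  have xy: "var_gxy p bs * (Bf p / mug p)\<^sup>2 \<le> D"
  proof -
    have "var_gxy p bs * ((Bf p)\<^sup>2 * (1 / (mug p)\<^sup>2)) \<le> var_gxy p bs * (m\<^sup>2 * (m\<^sup>2 * \<kappa>\<^sup>2))"
      using var_nonneg consts_pos by (intro mult_left_mono mult_mono B2 inv_mug2) auto
    also have "\<dots> = m ^ 4 * (\<kappa>\<^sup>2 * var_gxy p bs)" by (simp add: eval_nat_numeral mult_ac)
    also have "\<dots> \<le> m ^ 4 * \<delta>" unfolding \<delta>_def using m_pos by (intro mult_left_mono var_bounds) auto
    also have "\<dots> \<le> D" by (rule le_D) simp
    finally show ?thesis by (simp add: power_divide)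
  qed
  have nz: "noise_z \<le> 3 * (m ^ 6 * \<delta>)"
  proof -
    let ?r = "var_gyy p bs / (Lg p * mug p)"
    have r: "0 \<le> ?r" "?r \<le> 1 / 2" using var_nonneg Lg_pos consts_pos var_gyy_small by (auto simp: field_simps)
    have "?r * ((Bf p)\<^sup>2 * (1 / (mug p)\<^sup>2)) \<le> (var_gyy p bs * (m\<^sup>2 * \<kappa>)) * (m\<^sup>2 * (m\<^sup>2 * \<kappa>\<^sup>2))"
    proof (intro mult_mono B2 inv_mug2)
      have "var_gyy p bs * (1 / (Lg p * mug p)) \<le> var_gyy p bs * (m\<^sup>2 * \<kappa>)"
        using var_nonneg by (intro mult_left_mono inv_Lm)
      then show "?r \<le> var_gyy p bs * (m\<^sup>2 * \<kappa>)" by simp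
    qed (use var_nonneg \<kappa>_pos consts_pos m_pos in auto)
    also have "\<dots> = m ^ 6 * (\<kappa> ^ 3 * var_gyy p bs)" by (simp add: eval_nat_numeral mult_ac)
    also have "\<dots> \<le> m ^ 6 * \<delta>" unfolding \<delta>_def using m_pos by (intro mult_left_mono var_bounds) auto
    finally have 1: "?r * ((Bf p)\<^sup>2 * (1 / (mug p)\<^sup>2)) \<le> m ^ 6 * \<delta>" .
    \<comment> \<open>A product of two variances: \<open>var_gyy_small\<close> bounds the first
      factor by \<open>1 / 2\<close>, so only the second has to pay for powers of
      \<open>\<kappa>\<close>.\<close>
    have "?r * (var_f p bs / (mug p)\<^sup>2) \<le> 1 / 2 * (m\<^sup>2 * \<delta>)"
      using r t var_nonneg by (intro mult_mono) auto
    also have "m\<^sup>2 * \<delta> \<le> m ^ 6 * \<delta>" using \<delta> by (intro mult_right_mono m_power_mono) auto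
    finally have 2: "?r * (var_f p bs / (mug p)\<^sup>2) \<le> 1 / 2 * (m ^ 6 * \<delta>)" by simp
    have "noise_z = 2 * (?r * ((Bf p)\<^sup>2 * (1 / (mug p)\<^sup>2))) + 2 * (?r * (var_f p bs / (mug p)\<^sup>2))"
      by (simp add: noise_z_def add_divide_distrib distrib_left mult_ac)
    then show ?thesis using 1 2 by linarith
  qed
  have "m\<^sup>2 * \<delta> \<le> m ^ 6 * \<delta>" using \<delta> by (intro mult_right_mono m_power_mono) auto
  then have tn: "8 * (var_f p bs / (mug p)\<^sup>2) + 2 * noise_z \<le> 14 * (m ^ 6 * \<delta>)" using t nz by linarith
  have "(Lg' p)\<^sup>2 \<le> m\<^sup>2" using consts_pos by (intro power_mono m_bounds) auto
  moreover have "m \<le> m\<^sup>2" using m_power_mono[of 1 2] by simp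
  ultimately have Q: "3 * ((Lg' p)\<^sup>2 + 2 * var_gxy p bs) + 3 * (weight_z p * L_outer p) \<le> 12 * m\<^sup>2"
  proof -
    assume 1: "(Lg' p)\<^sup>2 \<le> m\<^sup>2" and 2: "m \<le> m\<^sup>2"
    have "3 * ((Lg' p)\<^sup>2 + 2 * var_gxy p bs) + 3 * (weight_z p * L_outer p) \<le> 3 * (m\<^sup>2 + 2 * m) + 3 * m\<^sup>2"
      by (intro add_mono mult_left_mono 1 var_bounds weight_z_L_outer) auto
    also have "\<dots> \<le> 12 * m\<^sup>2" using 2 by simp
    finally show ?thesis .
  qed
  have Qtn: "(3 * ((Lg' p)\<^sup>2 + 2 * var_gxy p bs) + 3 * (weight_z p * L_outer p))
      * (8 * (var_f p bs / (mug p)\<^sup>2) + 2 * noise_z) \<le> 168 * D"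
  proof -
    have "(3 * ((Lg' p)\<^sup>2 + 2 * var_gxy p bs) + 3 * (weight_z p * L_outer p))
        * (8 * (var_f p bs / (mug p)\<^sup>2) + 2 * noise_z) \<le> (12 * m\<^sup>2) * (14 * (m ^ 6 * \<delta>))"
      using var_nonneg noise_nonneg by (intro mult_mono Q tn) auto
    also have "\<dots> = 168 * (m ^ 8 * \<delta>)" by (simp add: eval_nat_numeral mult_ac)
    also have "\<dots> \<le> 168 * D" by (intro mult_left_mono le_D) auto
    finally show ?thesis .
  qed
  have "L_outer p * drift_noise = 4 * ((L_psi p)\<^sup>2 * noise_y) + 2 * (weight_y p * L_outer p * noise_y)
      + 3 * (var_f p bs + 2 * (var_gxy p bs * (Bf p / mug p)\<^sup>2))
      + (3 * ((Lg' p)\<^sup>2 + 2 * var_gxy p bs) + 3 * (weight_z p * L_outer p))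
      * (8 * (var_f p bs / (mug p)\<^sup>2) + 2 * noise_z)"
  proof -
    \<comment> \<open>Clearing the divisions by \<open>L\<close> joins the weight with
      \<open>L_outer\<close>, so that \<open>weight_z_L_outer\<close> applies to the
      product.\<close>
    have gen: "L * ((4 * a / L + 2 * b) * n + 3 / L * e + (3 / L * d + 3 * z) * u)
      = 4 * (a * n) + 2 * (b * L * n) + 3 * e + (3 * d + 3 * (z * L)) * u"
      if "0 < L" for L a b n e d z u :: real
      using that by (simp add: field_simps)
    show ?thesis unfolding drift_noise_def gen[OF L_outer_pos] by (simp only: mult.assoc)
  qed
  also have "\<dots> \<le> 4 * (16 * D) + 2 * (8 * D) + 3 * (D + 2 * D) + 168 * D"
    by (intro add_mono mult_left_mono psi_ny wL sf xy Qtn) auto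
  finally have "4 * L_outer p * lam p * noise_y + 8 * (L_outer p * drift_noise) \<le> 2200 * D"
    using lamL D0 \<delta> by (simp add: mult.assoc)
  also have "2200 * D \<le> \<epsilon> / 2"
  proof -
    have "4400 * m ^ 12 \<le> 10^10 * m ^ 40" using m_power_mono[of 12 40] m_pos by (intro mult_mono) auto
    then have "4400 * m ^ 12 * \<delta> \<le> c * \<delta>" using c_large \<delta> by (intro mult_right_mono) auto
    then show ?thesis using c_large by (simp add: D_def \<delta>_def)
  qed
  finally show ?thesis .
qed

text \<open>The budget \<open>\<epsilon>\<close> is halved. With \<open>k\<close> of order
  \<open>\<kappa> ^ 3 / \<epsilon> * gap\<close> the initial gap takes one half, because
  \<open>L_outer\<close> is at most of order \<open>\<kappa> ^ 3\<close>; the noise takes the other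
  half, whatever \<open>k\<close> is.\<close>

lemma complexity_bound:
  assumes bdd: "bdd_below (range (outer_obj f g))"
    and int: "integrable M (\<lambda>\<omega>. outer_obj f g (xk 0 \<omega>))" "integrable M (ery 0)"
      "integrable M (\<lambda>\<omega>. (norm (zprev 0 \<omega>))\<^sup>2)"
  defines "gap \<equiv> initial_gap M f g fh gh p bs \<xi> init"
  shows "\<exists>k\<ge>1. (\<forall>i\<in>{1..k}. integrable M (grad_sq i))
    \<and> 1 / real k * (\<Sum>i=1..k. LINT \<omega>|M. grad_sq i \<omega>) \<le> \<epsilon>
    \<and> (1 \<le> c' * (\<kappa> ^ 3 / \<epsilon> * gap) \<longrightarrow> 1 \<le> c' * (\<kappa> / \<epsilon> * noise_level p \<epsilon>) \<longrightarrow>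
       real (complexity bs (T_choice p) (N_choice p bs) k)
         \<le> O_const p S c' * log_factor * (\<kappa> ^ 5 / \<epsilon>\<^sup>2 * noise_level p \<epsilon> * gap))"
proof -
  define h where "h = \<kappa> ^ 3 / \<epsilon> * gap"
  \<comment> \<open>The added 1 keeps \<open>k\<close> positive when the gap is 0. Together with the
    ceiling it costs at most 2, which is absorbed once \<open>1 \<le> c' * h\<close>.\<close>
  define k where "k = nat \<lceil>c' * h\<rceil> + 1"
  note bound = gradient_sum_bound[OF bdd int, folded gap_def]
  have gap0: "0 \<le> gap" by (rule bound(3))
  have h0: "0 \<le> h" using gap0 \<kappa>_pos eps by (simp add: h_def)
  have k1: "1 \<le> k" and kh: "c' * h \<le> real k" and kle: "real k \<le> c' * h + 2"
    using h0 c_large by (auto simp: k_def) linarith+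
  have nn: "0 \<le> (LINT \<omega>|M. grad_sq i \<omega>)" for i by (rule integral_nonneg_AE) (simp add: grad_sq_def)
  have drift0: "0 \<le> drift_noise"
    unfolding drift_noise_def using noise_nonneg L_outer_pos weight_y_bounds weight_z_bounds
    by (intro add_nonneg_nonneg mult_nonneg_nonneg) (auto simp: less_imp_le)
  \<comment> \<open>The average runs over the points 1 to \<open>k\<close> while the telescoped sum
    starts at 0: one more iteration is summed and the first term dropped. The noise then counts
    \<open>Suc k\<close> times, at most \<open>2 * k\<close>, whence the 8 in
    \<open>total_noise_le\<close>.\<close>
  have "(\<Sum>i=1..k. LINT \<omega>|M. grad_sq i \<omega>) \<le> (\<Sum>i<Suc k. LINT \<omega>|M. grad_sq i \<omega>)"
    by (intro sum_mono2 nn) auto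
  also have "\<dots> \<le> 8 * L_outer p * gap + 4 * L_outer p * lam p * noise_y + 4 * L_outer p * (real (Suc k) * drift_noise)"
    by (rule bound(2))
  finally have total: "(\<Sum>i=1..k. LINT \<omega>|M. grad_sq i \<omega>)
    \<le> 8 * L_outer p * gap + 4 * L_outer p * lam p * noise_y + 4 * L_outer p * (real (Suc k) * drift_noise)" .
  have s1: "8 * L_outer p * gap \<le> real k * (\<epsilon> / 2)"
  proof -
    have "8 * L_outer p * gap \<le> 8 * (8 * m ^ 7 * \<kappa> ^ 3) * gap"
      using gap0 by (intro mult_right_mono mult_left_mono L_outer_le) auto
    also have "\<dots> = (128 * m ^ 7) * h * (\<epsilon> / 2)" using eps by (simp add: h_def)
    also have "\<dots> \<le> c' * h * (\<epsilon> / 2)"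
    proof (intro mult_right_mono)
      have "128 * m ^ 7 \<le> 10^10 * m ^ 40" using m_power_mono[of 7 40] m_pos by (intro mult_mono) auto
      then show "128 * m ^ 7 \<le> c'" using c_large(1) c(2) by linarith
    qed (use h0 eps in auto)
    also have "\<dots> \<le> real k * (\<epsilon> / 2)" using kh eps by (intro mult_right_mono) auto
    finally show ?thesis .
  qed
  have s2: "4 * L_outer p * lam p * noise_y \<le> real k * (4 * L_outer p * lam p * noise_y)"
  proof -
    have "0 \<le> 4 * L_outer p * lam p * noise_y"
      using L_outer_pos lam_pos noise_nonneg by (intro mult_nonneg_nonneg) auto
    moreover have "1 \<le> real k" using k1 by simp
    ultimately have "1 * (4 * L_outer p * lam p * noise_y) \<le> real k * (4 * L_outer p * lam p * noise_y)"
      by (intro mult_right_mono)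
    then show ?thesis by simp
  qed
  have s3: "4 * L_outer p * (real (Suc k) * drift_noise) \<le> real k * (8 * (L_outer p * drift_noise))"
  proof -
    have "real (Suc k) \<le> 2 * real k" using k1 by simp
    then have "4 * L_outer p * (real (Suc k) * drift_noise) \<le> 4 * L_outer p * (2 * real k * drift_noise)"
      using L_outer_pos drift0 by (intro mult_left_mono mult_right_mono) auto
    then show ?thesis by (simp add: mult_ac)
  qed
  note order_trans[OF total add_mono[OF add_mono[OF s1 s2] s3]]
  also have "real k * (\<epsilon> / 2) + real k * (4 * L_outer p * lam p * noise_y) + real k * (8 * (L_outer p * drift_noise))
      = real k * (\<epsilon> / 2) + real k * (4 * L_outer p * lam p * noise_y + 8 * (L_outer p * drift_noise))"
    by (simp only: distrib_left add.assoc)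
  also have "\<dots> \<le> real k * (\<epsilon> / 2) + real k * (\<epsilon> / 2)"
    by (intro add_left_mono mult_left_mono total_noise_le) simp
  also have "\<dots> = real k * \<epsilon>" by (simp flip: distrib_left)
  finally have "(\<Sum>i=1..k. LINT \<omega>|M. grad_sq i \<omega>) \<le> real k * \<epsilon>" .
  then have avg: "1 / real k * (\<Sum>i=1..k. LINT \<omega>|M. grad_sq i \<omega>) \<le> \<epsilon>"
    using k1 by (simp add: divide_le_eq mult.commute)
  have "real (complexity bs (T_choice p) (N_choice p bs) k)
         \<le> O_const p S c' * log_factor * (\<kappa> ^ 5 / \<epsilon>\<^sup>2 * noise_level p \<epsilon> * gap)"
    if 1: "1 \<le> c' * h" and 2: "1 \<le> c' * (\<kappa> / \<epsilon> * noise_level p \<epsilon>)"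
  proof -
    let ?r = "\<kappa>\<^sup>2 / \<epsilon> * noise_level p \<epsilon>"
    have "0 \<le> noise_level p \<epsilon>" by (auto simp: noise_level_def intro!: add_nonneg_nonneg mult_nonneg_nonneg simp: max_def)
    then have r0: "0 \<le> ?r" using \<kappa>_pos eps by simp
    have "real (complexity bs (T_choice p) (N_choice p bs) k)
      = real k * (real (T_choice p) * real (size_g bs) + real (N_choice p bs) * real (size_gyy bs)
        + real (size_gxy bs) + real (size_f bs))"
      by (simp add: complexity_def)
    also have "\<dots> \<le> (3 * (c' * h)) * (125 * q_log * log_factor * (c' * ?r))"
      using kle 1 by (intro mult_mono iteration_cost_le[OF 2]) auto
    also have "\<dots> = (375 * q_log) * (c'\<^sup>2 * log_factor * (h * ?r))" by (simp add: power2_eq_square)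
    also have "\<dots> \<le> (10^10 * m ^ 40) * (c'\<^sup>2 * log_factor * (h * ?r))"
    proof (rule mult_right_mono)
      have "375 * 1000 * m ^ 17 \<le> 10^10 * m ^ 40" using m_power_mono[of 17 40] m_pos by (intro mult_mono) auto
      then show "375 * q_log \<le> 10^10 * m ^ 40" by (simp add: q_log_def)
      show "0 \<le> c'\<^sup>2 * log_factor * (h * ?r)" 
        by (rule mult_nonneg_nonneg[OF mult_nonneg_nonneg mult_nonneg_nonneg[OF h0 r0]])
          (use log_factor_ge in auto)
    qed
    also have "\<dots> = O_const p S c' * log_factor * (\<kappa> ^ 5 / \<epsilon>\<^sup>2 * noise_level p \<epsilon> * gap)"
      using eps by (simp add: O_const_def h_def eval_nat_numeral mult_ac)
    finally show ?thesis .
  qed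
  with k1 avg bound(1) show ?thesis unfolding h_def by blast
qed

lemma T_N_O:
  "real (T_choice p) \<le> O_const p S c' * log_factor * \<kappa>" "real (N_choice p bs) \<le> O_const p S c' * log_factor * \<kappa>"
proof -
  have "1 \<le> m ^ 40" using m_power_mono[of 0 40] by simp
  then have "1 \<le> c'" using c_large(1) c(2) by simp
  then have "1 * 1 \<le> c' * c'" by (intro mult_mono) auto
  then have c2: "1 \<le> c'\<^sup>2" by (simp add: power2_eq_square)
  have "25 * 1000 * m ^ 17 \<le> 10^10 * m ^ 40" using m_power_mono[of 17 40] m_pos by (intro mult_mono) auto
  then have "25 * q_log \<le> 10^10 * m ^ 40" by (simp add: q_log_def)
  then have "25 * q_log * 1 \<le> 10^10 * m ^ 40 * c'\<^sup>2"
    by (rule mult_mono[OF _ c2]) (use m_pos in auto)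
  then have "25 * q_log * log_factor * \<kappa> \<le> O_const p S c' * log_factor * \<kappa>"
    using log_factor_ge \<kappa>_pos by (intro mult_right_mono) (auto simp: O_const_def)
  then show "real (T_choice p) \<le> O_const p S c' * log_factor * \<kappa>"
    "real (N_choice p bs) \<le> O_const p S c' * log_factor * \<kappa>" using T_N_le by linarith+
qed

end

theorem corollary4:
  fixes f g :: "real^'x \<Rightarrow> real^'y \<Rightarrow> real"
    and fh gh :: "real^'x \<Rightarrow> real^'y \<Rightarrow> 's \<Rightarrow> real"
    and P :: "'s measure" and M :: "'w measure"
    and \<xi> :: "sample_label \<Rightarrow> 'w \<Rightarrow> 's"
    and init :: "'w \<Rightarrow> (real^'x) \<times> (real^'y) \<times> (real^'y)"
    and p :: bilevel_consts and bs :: batch_sizes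
    and \<mu> S c c' \<epsilon> :: real
  assumes problem: "stochastic_bilevel f g fh gh P p"
    and inf_finite: "bdd_below (range (outer_obj f g))"
    and nonconvex: "\<mu> < 0" "\<bar>\<mu>\<bar> \<le> L_outer p"
      "\<And>x x'. outer_obj f g x - outer_obj f g x'
         \<le> inner (grad (outer_obj f g) x) (x - x') - \<mu> / 2 * (norm (x - x'))\<^sup>2"
    and randomness: "amigo_randomness M P \<xi> init"
    and init_finite:
      "integrable M (\<lambda>\<omega>. outer_obj f g (fst (init \<omega>)))"
      "integrable M (\<lambda>\<omega>. (norm (fst (snd (init \<omega>)) - ystar g (fst (init \<omega>))))\<^sup>2)"
      "integrable M (\<lambda>\<omega>. (norm (snd (snd (init \<omega>))))\<^sup>2)"
    and S: "(sd_gxy p)\<^sup>2 \<le> S"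
    and eps: "0 < \<epsilon>"
    and c: "Theta_const p S \<le> c" "c \<le> c'"
    and sizes: "Theta_sizes c c' p \<epsilon> bs"
  shows "real (T_choice p) \<le> O_const p S c' * (1 + ln (kappa_g p)) * kappa_g p
    \<and> real (N_choice p bs) \<le> O_const p S c' * (1 + ln (kappa_g p)) * kappa_g p
    \<and> (\<exists>k\<ge>1.
      (\<forall>i\<in>{1..k}. integrable M
         (\<lambda>\<omega>. (norm (grad (outer_obj f g) (fst (amigo_run fh gh p bs \<xi> init i \<omega>))))\<^sup>2)) \<and>
      1 / real k * (\<Sum>i=1..k. LINT \<omega>|M.
         (norm (grad (outer_obj f g) (fst (amigo_run fh gh p bs \<xi> init i \<omega>))))\<^sup>2) \<le> \<epsilon> \<and>
      (1 \<le> c' * ((kappa_g p)^3 / \<epsilon> * initial_gap M f g fh gh p bs \<xi> init) \<longrightarrow>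
       1 \<le> c' * (kappa_g p / \<epsilon> * noise_level p \<epsilon>) \<longrightarrow>
       real (complexity bs (T_choice p) (N_choice p bs) k)
         \<le> O_const p S c' * (1 + ln (kappa_g p)) *
            ((kappa_g p)^5 / \<epsilon>\<^sup>2 * noise_level p \<epsilon> * initial_gap M f g fh gh p bs \<xi> init)))"
proof -
  \<comment> \<open>The rates come first: they supply the nonempty batches and the small Hessian
    noise that \<open>amigo_process\<close> assumes.\<close>
  interpret rates: amigo_rates f g fh gh P p S c c' \<epsilon> bs
    using problem S eps c sizes by (simp add: amigo_rates_def amigo_rates_axioms_def)
  interpret amigo_randomness M P \<xi> init by (rule randomness)
  interpret amigo_converges f g fh gh P p S c c' \<epsilon> bs M \<xi> init
    by unfold_locales (use rates.size_pos rates.var_gyy_small in auto)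
  have x0: "xk 0 = (\<lambda>\<omega>. fst (init \<omega>))" by (simp add: fun_eq_iff xk_def amigo_run_def)
  have ey0: "ery 0 = (\<lambda>\<omega>. (norm (fst (snd (init \<omega>)) - ystar g (fst (init \<omega>))))\<^sup>2)"
    by (simp add: fun_eq_iff ery_def xk_def yprev_def amigo_run_def)
  have z0: "zprev 0 = (\<lambda>\<omega>. snd (snd (init \<omega>)))" by (simp add: fun_eq_iff zprev_def amigo_run_def)
  have gs: "grad_sq = (\<lambda>i \<omega>. (norm (grad (outer_obj f g) (fst (amigo_run fh gh p bs \<xi> init i \<omega>))))\<^sup>2)"
    by (simp add: fun_eq_iff grad_sq_def xk_def)
  show ?thesis
    using complexity_bound[OF inf_finite] init_finite T_N_O unfolding x0 ey0 z0 gs by blast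
qed

end
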